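(* Let $G$ be a Carnot group of step $r$ with Carnot-Carathéodory metric $d_{cc}$ and a fixed system $\Delta$ of Christ cubes, and let $(Y,\|\cdot\|)$ be a Banach space for which there exist $p\ge2$ and $K\ge1$ with $$\frac{\|x-y\|^p+\|y-z\|^p}2\ge\left\|\frac{x-z}2\right\|^p+\left\|\frac{x+z-2y}{2K}\right\|^p\qquad\forall x,y,z\in Y.$$ There exist $\alpha,\zeta,\lambda>0$ depending only on $G$ and $Y$ such that if $\epsilon\in(0,1/2)$, $m\in\mathbb N$, $\psi\ge0$, $h:G\to Y$ is $\psi$-LLD, and $S\in\Delta$ satisfies $$\ell(S)\ge\lambda\epsilon^{-(r+1)(3p+1)}\tau^{-m}\psi,$$ then $$\sum_{k=0}^m\ \sum_{\substack{Q\in\Delta_k(S)\\ cd_h^{UC}(Q,\zeta\epsilon^r)>\epsilon\,\mathrm{Lip}_h(\psi)}}|Q|\ \le\ \epsilon^{-\alpha}|S|.$$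
   Context: A Carnot group of step $r$ is a simply connected Lie group $G$ whose Lie algebra is stratified nilpotent: $\mathfrak g=\bigoplus_{j=1}^r\mathcal V_j$ with $[\mathcal V_i,\mathcal V_j]\subset\mathcal V_{i+j}$, $\mathcal V_r\neq0$, and $\mathcal V_1$ (the horizontal layer, with an inner product) generating $\mathfrak g$. $d_{cc}$ is the infimum of lengths of curves tangent to the left-invariant subbundle generated by $\mathcal V_1$, measured with the left-invariant extension of the inner product. $G$ is identified with $\mathfrak g$ via the exponential map, and $|\cdot|$ of a set denotes Lebesgue measure (a left-invariant measure). Christ cubes: $\Delta=\{Q_\omega^k\subset G:k\in\mathbb Z,\omega\in I_k\}$ with constants $a_0,a_1>0$, $\tau\in(0,1)$ such that (a) $|G\setminus\bigcup_\omega Q_\omega^k|=0$ for all $k$; (b) if $j\ge k$ then $Q_\alpha^j\subset Q_\omega^k$ or $Q_\alpha^j\cap Q_\omega^k=\emptyset$; (c) for each $(j,\alpha)$ and $k<j$ there is a unique $\omega$ with $Q_\alpha^j\subset Q_\omega^k$; (d) $\mathrm{diam}(Q_\omega^k)\le a_1\tau^k$; (e) each $Q_\omega^k$ contains a ball $B_{cc}(z,a_0\tau^k)$. Such a system exists by a theorem of Christ and is fixed once and for all for $G$. Put $\ell(Q_\omega^k)=\tau^k$, $\Delta_k=\{Q_\omega^k:\omega\in I_k\}$, and for $S\in\Delta_j$, $\Delta_k(S)=\{Q\in\Delta_{j+k}:Q\subseteq S\}$. For $Q\in\Delta$, $B_Q$ is the ball of radius $a_0\ell(Q)$ from (e); $\eta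 B_Q$ is the concentric ball with radius multiplied by $\eta$. For $h:(G,d_{cc})\to Y$ and $t\ge0$, $\mathrm{Lip}_h(t)=\sup_{d_{cc}(x,y)>t}\frac{\|h(x)-h(y)\|}{d_{cc}(x,y)}$; $h$ is $\psi$-LLD ($\psi$-Lipschitz at large distances) if $\mathrm{Lip}_h(\psi)<\infty$ and $\sup_{d_{cc}(x,y)\le\psi}\|h(x)-h(y)\|\le\mathrm{Lip}_h(\psi)\,\psi$. For $Q\in\Delta$, $\eta>0$, $$cd_h^{UC}(Q,\eta)=\frac1{\eta a_0\ell(Q)}\inf_{T,v}\ \sup\{\|h(x)-T(x)-v\|:x\in\eta B_Q\},$$ the infimum being over all group homomorphisms $T:G\to Y$ and all $v\in Y$. *)

theory Defs
  imports "HOL-Analysis.Analysis"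
begin

fun nested_bracket :: "('a \<Rightarrow> 'a \<Rightarrow> 'a) \<Rightarrow> 'a list \<Rightarrow> 'a::zero" where
  "nested_bracket brk [] = 0"
| "nested_bracket brk [x] = x"
| "nested_bracket brk (x # y # zs) = brk x (nested_bracket brk (y # zs))"

text \<open>
  The Baker-Campbell-Hausdorff series of \<open>log (exp x exp y)\<close> in Dynkin's form, cut off at total
  degree \<open>r\<close>; in a Lie algebra that is nilpotent of step \<open>r\<close> nothing is lost by the cut-off.
  The list \<open>[(a\<^sub>1, b\<^sub>1), ..., (a\<^sub>n, b\<^sub>n)]\<close> stands for the right-nested commutator of the word
  \<open>x^a\<^sub>1 y^b\<^sub>1 ... x^a\<^sub>n y^b\<^sub>n\<close>.
\<close>

definition bch_exponents :: "nat \<Rightarrow> nat \<Rightarrow> (nat \<times> nat) list set" where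
  "bch_exponents r n =
     {ps. length ps = n \<and> (\<forall>(a, b)\<in>set ps. a + b > 0) \<and> (\<Sum>(a, b)\<leftarrow>ps. a + b) \<le> r}"

definition bch :: "nat \<Rightarrow> ('a \<Rightarrow> 'a \<Rightarrow> 'a) \<Rightarrow> 'a::real_vector \<Rightarrow> 'a \<Rightarrow> 'a" where
  "bch r brk x y =
     (\<Sum>n = 1..r. \<Sum>ps\<in>bch_exponents r n.
        ((-1) ^ (n - 1) / (real n * real (\<Sum>(a, b)\<leftarrow>ps. a + b) * (\<Prod>(a, b)\<leftarrow>ps. fact a * fact b)))
          *\<^sub>R nested_bracket brk (concat (map (\<lambda>(a, b). replicate a x @ replicate b y) ps)))"

text \<open>
  A Carnot group is given in exponential coordinates: the underlying manifold is the Lie algebra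
  itself, the type \<open>'a\<close>, the exponential map is the identity, and so the group law is the
  Baker-Campbell-Hausdorff product. The inner product of \<open>V 1\<close> is the restriction of the one of
  \<open>'a\<close>, which is not used in any other way; the layers need not be orthogonal to each other.
  The group axioms follow from the other ones; they are listed as part of the structure.
\<close>

locale carnot_group =
  fixes r :: nat
    and V :: "nat \<Rightarrow> 'a::euclidean_space set"
    and brk :: "'a \<Rightarrow> 'a \<Rightarrow> 'a"
    and mul :: "'a \<Rightarrow> 'a \<Rightarrow> 'a"
  assumes bilinear_brk: "bilinear brk"
    and alternating: "\<And>x. brk x x = 0"
    and jacobi: "\<And>x y z. brk x (brk y z) + brk y (brk z x) + brk z (brk x y) = 0"
    and step_pos: "r \<ge> 1"
    and subspace_layer: "\<And>j. subspace (V j)"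
    and layer_trivial: "\<And>j. j \<notin> {1..r} \<Longrightarrow> V j = {0}"
    and direct_sum: "\<And>x. \<exists>!f. f \<in> (\<Pi>\<^sub>E j\<in>{1..r}. V j) \<and> x = (\<Sum>j = 1..r. f j)"
    and brk_layers: "\<And>i j x y. i \<in> {1..r} \<Longrightarrow> j \<in> {1..r} \<Longrightarrow> x \<in> V i \<Longrightarrow> y \<in> V j
                       \<Longrightarrow> brk x y \<in> V (i + j)"
    and last_layer: "V r \<noteq> {0}"
    and generating: "(\<lambda>W. subspace W \<and> (\<forall>x\<in>W. \<forall>y\<in>W. brk x y \<in> W)) hull (V 1) = UNIV"
    and mul_bch: "\<And>x y. mul x y = bch r brk x y"
    and group_axioms: "group mul 0 uminus"

text \<open>
  \<open>u\<close> is the velocity of \<open>\<gamma>\<close> in the left trivialisation: at \<open>p\<close>, a vector \<open>v\<close> of the Lie algebra is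
  carried by the left translation to \<open>frechet_derivative (mul p) (at 0) v\<close>. \<open>H\<close> is the horizontal
  layer, \<open>L\<close> the length. The speed has to be integrable, since a piecewise continuously
  differentiable curve in the sense of the library may have unbounded speed near its finitely many
  exceptional parameters.
\<close>

definition horizontal_curve ::
  "'a::euclidean_space set \<Rightarrow> ('a \<Rightarrow> 'a \<Rightarrow> 'a) \<Rightarrow> (real \<Rightarrow> 'a) \<Rightarrow> (real \<Rightarrow> 'a) \<Rightarrow> real \<Rightarrow> bool" where
  "horizontal_curve H mul \<gamma> u L \<longleftrightarrow>
     \<gamma> piecewise_C1_differentiable_on {0..1} \<and>
     (\<exists>N. finite N \<and> (\<forall>t\<in>{0..1} - N. u t \<in> H \<and>
        (\<gamma> has_vector_derivative frechet_derivative (mul (\<gamma> t)) (at 0) (u t)) (at t))) \<and>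
     ((\<lambda>t. norm (u t)) has_integral L) {0..1}"

definition cc_dist :: "'a::euclidean_space set \<Rightarrow> ('a \<Rightarrow> 'a \<Rightarrow> 'a) \<Rightarrow> 'a \<Rightarrow> 'a \<Rightarrow> real" where
  "cc_dist H mul x y = Inf {L. \<exists>\<gamma> u. \<gamma> 0 = x \<and> \<gamma> 1 = y \<and> horizontal_curve H mul \<gamma> u L}"

definition dball :: "('a \<Rightarrow> 'a \<Rightarrow> real) \<Rightarrow> 'a \<Rightarrow> real \<Rightarrow> 'a set" where
  "dball d x \<rho> = {y. d x y < \<rho>}"

text \<open>
  The cube of generation \<open>k\<close> with index \<open>\<omega> \<in> I k\<close> is \<open>Q k \<omega>\<close>, and \<open>z k \<omega>\<close> is the centre of the ball
  inside it. A cube is the pair \<open>(k, \<omega>)\<close> and not merely the set, because one set may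
  occur in several generations, and its side length \<open>\<tau>\<^sup>k\<close> depends on the generation.
\<close>

locale christ_cubes =
  fixes d :: "'a::euclidean_space \<Rightarrow> 'a \<Rightarrow> real"
    and I :: "int \<Rightarrow> 'i set"
    and Q :: "int \<Rightarrow> 'i \<Rightarrow> 'a set"
    and z :: "int \<Rightarrow> 'i \<Rightarrow> 'a"
    and a0 a1 \<tau> :: real
  assumes constants: "a0 > 0" "a1 > 0" "0 < \<tau>" "\<tau> < 1"
    and measurable_cube: "\<And>k \<omega>. \<omega> \<in> I k \<Longrightarrow> Q k \<omega> \<in> sets lebesgue"
    and covering: "\<And>k. UNIV - (\<Union>\<omega>\<in>I k. Q k \<omega>) \<in> null_sets lebesgue"
    and nested: "\<And>j k \<alpha> \<omega>. k \<le> j \<Longrightarrow> \<alpha> \<in> I j \<Longrightarrow> \<omega> \<in> I k \<Longrightarrow>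
                   Q j \<alpha> \<subseteq> Q k \<omega> \<or> Q j \<alpha> \<inter> Q k \<omega> = {}"
    and ancestor: "\<And>j k \<alpha>. k < j \<Longrightarrow> \<alpha> \<in> I j \<Longrightarrow> \<exists>!\<omega>. \<omega> \<in> I k \<and> Q j \<alpha> \<subseteq> Q k \<omega>"
    and diam: "\<And>k \<omega> x y. \<omega> \<in> I k \<Longrightarrow> x \<in> Q k \<omega> \<Longrightarrow> y \<in> Q k \<omega> \<Longrightarrow> d x y \<le> a1 * \<tau> powi k"
    and inner_ball: "\<And>k \<omega>. \<omega> \<in> I k \<Longrightarrow> dball d (z k \<omega>) (a0 * \<tau> powi k) \<subseteq> Q k \<omega>"

definition Lip_at :: "('a \<Rightarrow> 'a \<Rightarrow> real) \<Rightarrow> ('a \<Rightarrow> 'b::real_normed_vector) \<Rightarrow> real \<Rightarrow> ennreal" where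
  "Lip_at d h t = (SUP (x, y)\<in>{(x, y). d x y > t}. ennreal (norm (h x - h y) / d x y))"

definition LLD :: "('a \<Rightarrow> 'a \<Rightarrow> real) \<Rightarrow> real \<Rightarrow> ('a \<Rightarrow> 'b::real_normed_vector) \<Rightarrow> bool" where
  "LLD d \<psi> h \<longleftrightarrow> Lip_at d h \<psi> < \<infinity> \<and>
     (SUP (x, y)\<in>{(x, y). d x y \<le> \<psi>}. ennreal (norm (h x - h y))) \<le> Lip_at d h \<psi> * ennreal \<psi>"

text \<open>
  The quantity \<open>cd_h^UC\<close> of a ball of centre \<open>c\<close> and radius \<open>\<rho>\<close>; for a cube \<open>Q\<close> and \<open>\<eta> > 0\<close> the ball is
  \<open>\<eta> B_Q\<close>, thus \<open>\<rho> = \<eta> a\<^sub>0 \<ell>(Q)\<close>. The homomorphisms are not required to be continuous.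
\<close>

definition cd_UC_ball ::
  "('a \<Rightarrow> 'a \<Rightarrow> real) \<Rightarrow> ('a \<Rightarrow> 'a \<Rightarrow> 'a) \<Rightarrow> ('a \<Rightarrow> 'b::real_normed_vector) \<Rightarrow> 'a \<Rightarrow> real \<Rightarrow> ennreal" where
  "cd_UC_ball d mul h c \<rho> =
     (INF (T, v)\<in>{T. \<forall>x y. T (mul x y) = T x + T y} \<times> UNIV.
        SUP x\<in>dball d c \<rho>. ennreal (norm (h x - T x - v))) / ennreal \<rho>"

definition cd_UC ::
  "('a \<Rightarrow> 'a \<Rightarrow> real) \<Rightarrow> ('a \<Rightarrow> 'a \<Rightarrow> 'a) \<Rightarrow> (int \<Rightarrow> 'i \<Rightarrow> 'a) \<Rightarrow> real \<Rightarrow> real \<Rightarrow>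
     ('a \<Rightarrow> 'b::real_normed_vector) \<Rightarrow> int \<Rightarrow> 'i \<Rightarrow> real \<Rightarrow> ennreal" where
  "cd_UC d mul z a0 \<tau> h k \<omega> \<eta> = cd_UC_ball d mul h (z k \<omega>) (\<eta> * a0 * \<tau> powi k)"

text \<open>The indices, in generation \<open>j + k\<close>, of the cubes of \<open>\<Delta>\<^sub>k(S)\<close> for \<open>S = Q j \<sigma>\<close>.\<close>

definition subcubes :: "(int \<Rightarrow> 'i set) \<Rightarrow> (int \<Rightarrow> 'i \<Rightarrow> 'a set) \<Rightarrow> int \<Rightarrow> 'i \<Rightarrow> nat \<Rightarrow> 'i set" where
  "subcubes I Q j \<sigma> k = {\<omega> \<in> I (j + int k). Q (j + int k) \<omega> \<subseteq> Q j \<sigma>}"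

end

theory Submission
  imports Defs
begin

text \<open>
  The proof plays two facts about the horizontal lines \<open>t \<mapsto> x exp (t e)\<close> against each other, where \<open>e\<close> runs
  through a finite basis \<open>E\<close> of the first layer.

  Bends are rare. On one line, the mean of the \<open>p\<close>-th powers of the dyadic difference quotients of \<open>h\<close>
  increases as the scale decreases, and by uniform convexity every increase dominates the \<open>p\<close>-th
  powers of the midpoint defects at that scale; the total increase is at most the \<open>p\<close>-th power of the
  Lipschitz constant, as long as the scale is at least \<open>\<psi>\<close> (\<open>dyadic_energy\<close>). Right translations
  preserve Lebesgue measure, because they are triangular with respect to the layers
  (\<open>triangular_map_measure\<close>). Integration over all parallel lines therefore bounds the measure of the
  points at which lines bend by a proportion \<open>\<theta>\<close>, summed over all dyadic scales
  (\<open>measure_of_bent_points\<close>). A bend persists in a ball of radius a power of \<open>\<theta>\<close> times the scale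
  (\<open>ldev_stable\<close>).

  Straight lines give a homomorphism. Suppose that near the centre of a cube no line in a
  direction of \<open>E\<close> bends by a proportion \<open>\<theta>\<close> at the scales between \<open>R\<close> and \<open>\<theta> R\<close>, where \<open>R\<close> is
  comparable to the side length. Then \<open>h\<close> is affine on segments of length \<open>R\<close> up to an error of order \<open>\<theta> R\<close>.
  Parallel segments that start within \<open>\<epsilon> ^ r R\<close> of each other end within a constant times \<open>\<epsilon> R\<close> of each
  other (\<open>d_right_translation\<close>), so the slope of \<open>h\<close> in direction \<open>e\<close> is nearly the same for all of
  them. By a quantitative form of Chow's theorem (\<open>horizontal_factorization\<close>), a bounded number of short
  horizontal steps leads to any point of a ball of radius \<open>\<zeta> \<epsilon> ^ r R\<close>. Adding up the steps shows that
  \<open>h\<close> is close to a constant plus the homomorphism with these slopes (\<open>near_homomorphism_on_ball\<close>); the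
  error is as required if \<open>\<theta>\<close> is a small multiple of \<open>\<epsilon> ^ (r + 1)\<close>.

  Hence every bad cube contains a ball of bent points whose measure is at least that of the cube times a
  constant and a power of \<open>\<epsilon>\<close>. Counting the bad cubes by means of these balls loses powers of \<open>1 / \<epsilon>\<close> and constants, and as
  \<open>\<epsilon> < 1 / 2\<close> a large \<open>\<alpha>\<close> absorbs both. The lower bound for the side length of \<open>S\<close> guarantees that the
  smallest scale in use, a multiple of \<open>\<theta>\<close> times the side length of the smallest cubes, still exceeds \<open>\<psi>\<close> by
  a multiple of \<open>1 / \<theta>\<close>.
\<close>

section \<open>Bracket and group law\<close>

context carnot_group
begin

lemmas brk_add_left = bilinear_ladd[OF bilinear_brk]
lemmas brk_add_right = bilinear_radd[OF bilinear_brk]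
lemmas brk_diff_left = bilinear_lsub[OF bilinear_brk]
lemmas brk_diff_right = bilinear_rsub[OF bilinear_brk]
lemmas brk_scale_left = bilinear_lmul[OF bilinear_brk]
lemmas brk_scale_right = bilinear_rmul[OF bilinear_brk]
lemmas brk_0_left [simp] = bilinear_lzero[OF bilinear_brk]
lemmas brk_0_right [simp] = bilinear_rzero[OF bilinear_brk]

lemma brk_antisym: "brk y x = - brk x y"
proof -
  have "brk (x + y) (x + y) = brk x y + brk y x"
    by (simp add: brk_add_left brk_add_right alternating[of x] alternating[of y])
  then show ?thesis
    by (metis alternating add.commute add_eq_0_iff)
qed

lemma mul_assoc: "mul (mul x y) z = mul x (mul y z)"
  and mul_0_left [simp]: "mul 0 x = x"
  and mul_0_right [simp]: "mul x 0 = x"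
  and mul_minus_left [simp]: "mul (- x) x = 0"
  and mul_minus_right [simp]: "mul x (- x) = 0"
proof -
  interpret grp: group mul 0 uminus by (rule group_axioms)
  show "mul (mul x y) z = mul x (mul y z)" by (rule grp.assoc)
  show "mul 0 x = x" "mul x 0 = x" "mul (- x) x = 0" "mul x (- x) = 0" by simp_all
qed

lemma mul_cancel_left [simp]: "mul (- g) (mul g x) = x" "mul g (mul (- g) x) = x"
  by (simp_all flip: mul_assoc)

lemma mul_cancel_right [simp]: "mul (mul x g) (- g) = x" "mul (mul x (- g)) g = x"
  by (simp_all add: mul_assoc)

lemma minus_mul: "- mul x y = mul (- y) (- x)"
proof -
  have "mul (- mul x y) (mul (mul x y) (mul (- y) (- x))) = mul (- y) (- x)"
    by (rule mul_cancel_left)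
  moreover have "mul (mul x y) (mul (- y) (- x)) = 0"
    by (simp add: mul_assoc)
  ultimately show ?thesis by simp
qed

section \<open>The descending filtration\<close>

text \<open>The filtration is by ideals. As \<open>V 1\<close> generates, it is the lower central series.\<close>

definition tail :: "nat \<Rightarrow> 'a set" where
  "tail m = span (\<Union>i\<in>{m..}. V i)"

lemma subspace_tail: "subspace (tail m)"
  by (simp add: tail_def)

lemma tail_antimono: "m \<le> n \<Longrightarrow> tail n \<subseteq> tail m"
  unfolding tail_def by (rule span_mono, rule UN_mono) auto

lemma layer_subset_tail: "V m \<subseteq> tail m"
  unfolding tail_def by (auto intro: span_base)

lemma tail_0 [simp]: "0 \<in> tail m" and tail_add: "x \<in> tail m \<Longrightarrow> y \<in> tail m \<Longrightarrow> x + y \<in> tail m"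
  and tail_diff: "x \<in> tail m \<Longrightarrow> y \<in> tail m \<Longrightarrow> x - y \<in> tail m"
  and tail_scale: "x \<in> tail m \<Longrightarrow> c *\<^sub>R x \<in> tail m"
  and tail_sum: "(\<And>i. i \<in> A \<Longrightarrow> f i \<in> tail m) \<Longrightarrow> sum f A \<in> tail m"
  using subspace_tail[of m]
  by (auto simp: subspace_0 subspace_add subspace_diff subspace_scale subspace_neg subspace_sum)

lemma tail_1: "tail (Suc 0) = UNIV"
proof -
  have "x \<in> tail (Suc 0)" for x
  proof -
    obtain f where "f \<in> (\<Pi>\<^sub>E j\<in>{1..r}. V j)" and x: "x = (\<Sum>j = 1..r. f j)"
      using direct_sum[of x] by blast
    then have "f j \<in> tail (Suc 0)" if "j \<in> {1..r}" for j
    proof -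
      have "f j \<in> V j" using \<open>f \<in> _\<close> that by (rule PiE_mem)
      then show ?thesis using layer_subset_tail[of j] tail_antimono[of "Suc 0" j] that by auto
    qed
    then show ?thesis unfolding x by (rule tail_sum)
  qed
  then show ?thesis by blast
qed

lemma tail_beyond_step: "r < m \<Longrightarrow> tail m = {0}"
proof -
  assume "r < m"
  then have "V i = {0}" if "i \<ge> m" for i
    using that by (intro layer_trivial) auto
  then have "(\<Union>i\<in>{m..}. V i) = {0}" by auto
  then show ?thesis by (simp add: tail_def)
qed

lemma brk_layer: "x \<in> V i \<Longrightarrow> y \<in> V j \<Longrightarrow> brk x y \<in> V (i + j)"
proof (cases "i \<in> {1..r} \<and> j \<in> {1..r}")
  case False
  assume "x \<in> V i" "y \<in> V j"
  with False have "x = 0 \<or> y = 0" using layer_trivial by blast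
  then show ?thesis using subspace_0[OF subspace_layer] by auto
qed (use brk_layers in auto)

lemma brk_tail:
  assumes "x \<in> tail a" "y \<in> tail b"
  shows "brk x y \<in> tail (a + b)"
proof -
  have 1: "brk u v \<in> tail (a + b)" if u: "u \<in> V i" "a \<le> i" and v: "v \<in> tail b" for u v i
  proof -
    have "subspace {v. brk u v \<in> tail (a + b)}"
      by (auto simp: subspace_def brk_add_right brk_scale_right intro: tail_add tail_scale)
    moreover have "w \<in> {v. brk u v \<in> tail (a + b)}" if "w \<in> (\<Union>i\<in>{b..}. V i)" for w
    proof -
      from that obtain j where "j \<ge> b" "w \<in> V j" by auto
      then have "brk u w \<in> V (i + j)" using u brk_layer by auto
      then show ?thesis
        using layer_subset_tail[of "i + j"] tail_antimono[of "a + b" "i + j"] \<open>a \<le> i\<close> \<open>b \<le> j\<close> by auto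
    qed
    ultimately have "span (\<Union>i\<in>{b..}. V i) \<subseteq> {v. brk u v \<in> tail (a + b)}"
      by (intro span_minimal) auto
    then show ?thesis using v by (auto simp: tail_def)
  qed
  have "subspace {u. brk u y \<in> tail (a + b)}"
    by (auto simp: subspace_def brk_add_left brk_scale_left intro: tail_add tail_scale)
  then have "span (\<Union>i\<in>{a..}. V i) \<subseteq> {u. brk u y \<in> tail (a + b)}"
    by (intro span_minimal) (use 1 assms(2) in auto)
  then show ?thesis using assms(1) by (auto simp: tail_def)
qed

lemma brk_tail_Suc: "x \<in> tail m \<Longrightarrow> brk x y \<in> tail (Suc m)" "x \<in> tail m \<Longrightarrow> brk y x \<in> tail (Suc m)"
  using brk_tail[of x m y "Suc 0"] brk_tail[of y "Suc 0" x m] by (auto simp: tail_1)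

section \<open>The Baker-Campbell-Hausdorff product as a sum over words\<close>

abbreviation nb :: "'a list \<Rightarrow> 'a" where "nb \<equiv> nested_bracket brk"

lemma nb_Cons: "us \<noteq> [] \<Longrightarrow> nb (u # us) = brk u (nb us)"
  by (cases us) auto

text \<open>A word in two letters is a list of Booleans; \<open>True\<close> stands for the left factor of the product and
  \<open>False\<close> for the right one. In this form, facts about the summands of the
  Baker-Campbell-Hausdorff formula are inductions on lists.\<close>

definition word :: "(nat \<times> nat) list \<Rightarrow> bool list" where
  "word ps = concat (map (\<lambda>(a, b). replicate a True @ replicate b False) ps)"

definition letter :: "'a \<Rightarrow> 'a \<Rightarrow> bool \<Rightarrow> 'a" where
  "letter x y c = (if c then x else y)"

definition words :: "(nat \<times> (nat \<times> nat) list) set" where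
  "words = (SIGMA n:{1..r}. bch_exponents r n)"

definition coef :: "nat \<times> (nat \<times> nat) list \<Rightarrow> real" where
  "coef = (\<lambda>(n, ps). (-1) ^ (n - 1) / (real n * real (\<Sum>(a, b)\<leftarrow>ps. a + b) * (\<Prod>(a, b)\<leftarrow>ps. fact a * fact b)))"

definition wterm :: "'a \<Rightarrow> 'a \<Rightarrow> nat \<times> (nat \<times> nat) list \<Rightarrow> 'a" where
  "wterm x y w = coef w *\<^sub>R nb (map (letter x y) (word (snd w)))"

lemma map_letter_word:
  "map (letter x y) (word ps) = concat (map (\<lambda>(a, b). replicate a x @ replicate b y) ps)"
  by (induction ps) (auto simp: word_def letter_def)

lemma length_word: "length (word ps) = (\<Sum>(a, b)\<leftarrow>ps. a + b)"
  by (induction ps) (auto simp: word_def)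

lemma finite_bch_exponents: "finite (bch_exponents r n)"
proof (rule finite_subset)
  show "bch_exponents r n \<subseteq> {ps. set ps \<subseteq> {..r} \<times> {..r} \<and> length ps = n}"
  proof
    fix ps assume ps: "ps \<in> bch_exponents r n"
    have "p \<in> {..r} \<times> {..r}" if p: "p \<in> set ps" for p
    proof -
      have "(case p of (a, b) \<Rightarrow> a + b) \<in> set (map (\<lambda>(a, b). a + b) ps)"
        unfolding set_map by (rule imageI[OF p])
      then have "(case p of (a, b) \<Rightarrow> a + b) \<le> (\<Sum>(a, b)\<leftarrow>ps. a + b)"
        by (rule member_le_sum_list) (rule le0)
      also have "\<dots> \<le> r" using ps unfolding bch_exponents_def by blast
      finally show ?thesis by (cases p) simp
    qed
    then show "ps \<in> {ps. set ps \<subseteq> {..r} \<times> {..r} \<and> length ps = n}"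
      using ps unfolding bch_exponents_def by blast
  qed
  show "finite {ps. set ps \<subseteq> {..r} \<times> {..r} \<and> length ps = n}"
    by (rule finite_lists_length_eq) auto
qed

lemma finite_words: "finite words"
  unfolding words_def by (auto intro: finite_SigmaI finite_bch_exponents)

lemma mul_eq_sum_words: "mul x y = (\<Sum>w\<in>words. wterm x y w)"
proof -
  have "sum (wterm x y) words = (\<Sum>n = 1..r. \<Sum>ps\<in>bch_exponents r n. wterm x y (n, ps))"
    unfolding words_def by (subst sum.Sigma) (auto simp: finite_bch_exponents)
  then show ?thesis
    unfolding mul_bch bch_def
    by (simp only: \<open>sum (wterm x y) words = _\<close>) (simp only: wterm_def coef_def map_letter_word snd_conv case_prod_conv)
qed

lemma length_ge_sum_list_pos:
  "(\<forall>(a, b)\<in>set ps. a + b > 0) \<Longrightarrow> length ps \<le> (\<Sum>(a, b)\<leftarrow>ps. a + b::nat)"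
  by (induction ps) auto

lemma words_length: "(n, ps) \<in> words \<Longrightarrow> 1 \<le> n \<and> n = length ps \<and> n \<le> length (word ps)"
  using length_ge_sum_list_pos[of ps] by (auto simp: words_def bch_exponents_def length_word)

lemma list_length_1: "length ps = Suc 0 \<longleftrightarrow> (\<exists>p. ps = [p])"
  by (auto simp: length_Suc_conv)

lemma list_length_2: "length ps = 2 \<longleftrightarrow> (\<exists>p q. ps = [p, q])"
  by (auto simp: numeral_2_eq_2 length_Suc_conv)

lemma words_of_length_1:
  "{w \<in> words. length (word (snd w)) = 1} = {(1, [(1, 0)]), (1, [(0, 1)])}" (is "?L = ?R")
proof
  show "?L \<subseteq> ?R"
  proof
    fix w assume w: "w \<in> ?L"
    obtain n ps where [simp]: "w = (n, ps)" by (cases w)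
    have "n = 1" "length ps = 1" using w words_length[of n ps] by auto
    then obtain a b where "ps = [(a, b)]" by (auto simp: list_length_1)
    with \<open>n = 1\<close> w show "w \<in> ?R" by (auto simp: length_word)
  qed
  show "?R \<subseteq> ?L"
    using step_pos by (auto simp: words_def bch_exponents_def length_word)
qed

lemma words_of_length_2:
  assumes "r \<ge> 2"
  shows "{w \<in> words. length (word (snd w)) = 2} =
    {(1, [(2, 0)]), (1, [(1, 1)]), (1, [(0, 2)]),
     (2, [(1, 0), (1, 0)]), (2, [(1, 0), (0, 1)]), (2, [(0, 1), (1, 0)]), (2, [(0, 1), (0, 1)])}" (is "?L = ?R")
proof
  show "?L \<subseteq> ?R"
  proof
    fix w assume w: "w \<in> ?L"
    obtain n ps where [simp]: "w = (n, ps)" by (cases w)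
    have len: "n = length ps" "n = 1 \<or> n = 2" using w words_length[of n ps] by auto
    show "w \<in> ?R"
    proof (cases "n = 1")
      case True
      with len obtain a b where "ps = [(a, b)]" by (metis One_nat_def list_length_1 old.prod.exhaust)
      moreover from this w have "a + b = 2" by (auto simp: length_word)
      then have "a = 2 \<and> b = 0 \<or> a = 1 \<and> b = 1 \<or> a = 0 \<and> b = 2" by arith
      ultimately show ?thesis using True by auto
    next
      case False
      with len obtain a b c d where ps: "ps = [(a, b), (c, d)]" by (auto simp: list_length_2)
      with w have "a + b + (c + d) = 2" "a + b > 0" "c + d > 0"
        by (auto simp: length_word words_def bch_exponents_def)
      then have "(a = 1 \<and> b = 0 \<or> a = 0 \<and> b = 1) \<and> (c = 1 \<and> d = 0 \<or> c = 0 \<and> d = 1)" by arith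
      with ps False len show ?thesis by auto
    qed
  qed
  show "?R \<subseteq> ?L"
    using assms by (auto simp: words_def bch_exponents_def length_word)
qed

lemma terms_of_length_1: "(\<Sum>w\<in>{w \<in> words. length (word (snd w)) = 1}. wterm x y w) = x + y"
  unfolding words_of_length_1
  by (simp add: wterm_def coef_def word_def letter_def)

lemma brk_eq_0_if_step_1: "r = 1 \<Longrightarrow> brk x y = 0"
  using brk_tail[of x "Suc 0" y "Suc 0"] tail_beyond_step[of "Suc (Suc 0)"] by (simp add: tail_1)

text \<open>A single syllable gives \<open>[x, y] / 2\<close>; the words \<open>x y\<close> and \<open>y x\<close> made of two syllables have equal
  coefficients and cancel.\<close>

lemma terms_of_length_2:
  "(\<Sum>w\<in>{w \<in> words. length (word (snd w)) = 2}. wterm x y w) = (1 / 2) *\<^sub>R brk x y"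
proof (cases "r \<ge> 2")
  case True
  have 2: "replicate 2 c = [c, c]" for c :: bool by (simp add: numeral_2_eq_2)
  show ?thesis
    unfolding words_of_length_2[OF True]
    by (simp add: wterm_def coef_def word_def letter_def alternating 2 brk_antisym[of y x])
next
  case False
  then have r: "r = 1" using step_pos by linarith
  have "{w \<in> words. length (word (snd w)) = 2} = {}"
    unfolding words_def bch_exponents_def by (auto simp: length_word r)
  then show ?thesis using brk_eq_0_if_step_1[OF r] by (simp only: sum.empty scaleR_zero_right)
qed

definition long_terms :: "'a \<Rightarrow> 'a \<Rightarrow> 'a" where
  "long_terms x y = (\<Sum>w\<in>{w \<in> words. 3 \<le> length (word (snd w))}. wterm x y w)"

lemma mul_expand: "mul x y = x + y + (1 / 2) *\<^sub>R brk x y + long_terms x y"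
proof -
  have "words = {w \<in> words. length (word (snd w)) = 1} \<union> {w \<in> words. length (word (snd w)) = 2}
      \<union> {w \<in> words. 3 \<le> length (word (snd w))}" (is "_ = ?A \<union> ?B \<union> ?C")
    using words_length by force
  then have "mul x y = sum (wterm x y) (?A \<union> ?B \<union> ?C)" by (simp only: mul_eq_sum_words)
  also have "\<dots> = sum (wterm x y) ?A + sum (wterm x y) ?B + sum (wterm x y) ?C"
    by (subst sum.union_disjoint | force simp: finite_words)+
  finally show ?thesis by (simp only: terms_of_length_1 terms_of_length_2 long_terms_def)
qed

lemma nb_letter_diff:
  assumes "x - x' \<in> tail m" "y - y' \<in> tail m" "bs \<noteq> []"
  shows "nb (map (letter x y) bs) - nb (map (letter x' y') bs) \<in> tail (if length bs = 1 then m else Suc m)"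
  using assms(3)
proof (induction bs)
  case (Cons b bs)
  have b: "letter x y b - letter x' y' b \<in> tail m" using assms by (simp add: letter_def)
  show ?case
  proof (cases "bs = []")
    case True
    then show ?thesis using b by simp
  next
    case False
    let ?U = "nb (map (letter x y) bs)" and ?U' = "nb (map (letter x' y') bs)"
    have "?U - ?U' \<in> tail m"
      using Cons.IH[OF False] tail_antimono[of m "Suc m"] by (auto split: if_splits)
    then have "brk (letter x y b - letter x' y' b) ?U + brk (letter x' y' b) (?U - ?U') \<in> tail (Suc m)"
      using b by (intro tail_add brk_tail_Suc)
    then show ?thesis
      using False by (simp add: nb_Cons brk_diff_left brk_diff_right)
  qed
qed simp

text \<open>The group law is addition up to the next step of the filtration, uniformly in the base point:
  in every word with two letters or more, the perturbation sits inside a bracket. This yields both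
  the triangular form of translations and the additivity of the projection to \<open>V 1\<close>.\<close>

lemma mul_perturb:
  assumes "x - x' \<in> tail m" "y - y' \<in> tail m"
  shows "mul x y - mul x' y' - ((x - x') + (y - y')) \<in> tail (Suc m)"
proof -
  have "brk x y - brk x' y' = brk (x - x') y + brk x' (y - y')"
    by (simp add: brk_diff_left brk_diff_right)
  also have "\<dots> \<in> tail (Suc m)"
    using assms by (intro tail_add brk_tail_Suc)
  finally have 1: "brk x y - brk x' y' \<in> tail (Suc m)" .
  have "wterm x y w - wterm x' y' w \<in> tail (Suc m)" if "3 \<le> length (word (snd w))" for w
  proof -
    have "nb (map (letter x y) (word (snd w))) - nb (map (letter x' y') (word (snd w))) \<in> tail (Suc m)"
      using nb_letter_diff[OF assms, of "word (snd w)"] that by (cases "word (snd w) = []") auto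
    then show ?thesis unfolding wterm_def scaleR_diff_right[symmetric] by (rule tail_scale)
  qed
  then have 2: "long_terms x y - long_terms x' y' \<in> tail (Suc m)"
    unfolding long_terms_def sum_subtractf[symmetric] by (intro tail_sum) auto
  have "mul x y - mul x' y' - ((x - x') + (y - y'))
      = (1 / 2) *\<^sub>R (brk x y - brk x' y') + (long_terms x y - long_terms x' y')"
    unfolding mul_expand by (simp add: algebra_simps)
  then show ?thesis using 1 2 by (auto intro: tail_add tail_scale)
qed

lemma mul_tail_approx: "x \<in> tail m \<Longrightarrow> y \<in> tail m \<Longrightarrow> mul x y - (x + y) \<in> tail (Suc m)"
  using mul_perturb[of x 0 m y 0] by simp

lemma nb_tail: "bs \<noteq> [] \<Longrightarrow> x \<in> tail i \<Longrightarrow> y \<in> tail j \<Longrightarrow>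
    nb (map (letter x y) bs) \<in> tail (sum_list (map (\<lambda>b. if b then i else j) bs))"
proof (induction bs)
  case (Cons b bs)
  have b: "letter x y b \<in> tail (if b then i else j)" using Cons.prems by (simp add: letter_def)
  show ?case
  proof (cases "bs = []")
    case False
    then show ?thesis using brk_tail[OF b Cons.IH[OF False Cons.prems(2,3)]] by (simp add: nb_Cons)
  qed (use b in simp)
qed simp

lemma weight_ge:
  assumes "w True \<ge> (1::nat)" "w False \<ge> 1"
  shows "c \<in> set bs \<Longrightarrow> w c + length bs \<le> sum_list (map w bs) + 1"
proof (induction bs)
  case (Cons b bs)
  have "length bs \<le> sum_list (map w bs)"
  proof (induction bs)
    case (Cons a bs)
    then show ?case using assms by (cases a) auto
  qed simp
  moreover have "w b \<ge> 1" using assms by (cases b) auto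
  ultimately show ?case using Cons by auto
qed simp

lemma weight_ge_both:
  assumes w: "w True \<ge> (1::nat)" "w False \<ge> 1" and bs: "True \<in> set bs" "False \<in> set bs"
  shows "w True + w False + length bs \<le> sum_list (map w bs) + 2"
proof (cases bs)
  case (Cons b cs)
  then have "(\<not> b) \<in> set cs" using bs by (cases b) auto
  from weight_ge[OF w this] show ?thesis using Cons by (cases b) auto
qed (use bs in simp)

lemma nb_replicate: "length bs \<ge> 2 \<Longrightarrow> set bs \<subseteq> {c} \<Longrightarrow> nb (map (letter x y) bs) = 0"
proof (induction bs)
  case (Cons b bs)
  show ?case
  proof (cases "length bs \<ge> 2")
    case True
    then have "bs \<noteq> []" by auto
    then show ?thesis using Cons True by (simp add: nb_Cons)
  next
    case False
    then have "length bs = Suc 0" using Cons.prems by simp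
    then obtain b' where "bs = [b']" by (auto simp: length_Suc_conv)
    then show ?thesis using Cons.prems by (simp add: alternating)
  qed
qed simp

text \<open>A bracket of at least three letters from \<open>x\<close> and \<open>y\<close> either repeats one letter, and then it
  vanishes, or it contains both letters and a further one of weight at least one.\<close>

lemma nb_long_tail:
  assumes "x \<in> tail i" "y \<in> tail j" "i \<ge> 1" "j \<ge> 1" "3 \<le> length bs"
  shows "nb (map (letter x y) bs) \<in> tail (Suc (i + j))"
proof (cases "True \<in> set bs \<and> False \<in> set bs")
  case True
  let ?w = "\<lambda>b. if b then i else j"
  have "Suc (i + j) \<le> sum_list (map ?w bs)"
    using weight_ge_both[of ?w bs] True assms by auto
  moreover have "nb (map (letter x y) bs) \<in> tail (sum_list (map ?w bs))"
    using assms by (intro nb_tail) auto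
  ultimately show ?thesis using tail_antimono by blast
next
  case False
  then obtain c where "set bs \<subseteq> {c}" by (metis (full_types) insertI1 subsetI)
  then show ?thesis using nb_replicate[of bs c x y] assms by simp
qed

text \<open>Put \<open>u = y x\<close> and \<open>x y = u + k\<close>. By the second-order expansion \<open>k\<close> is \<open>[x, y]\<close> to leading order, and
  perturbing the left factor of \<open>u u\<^sup>-\<^sup>1 = 0\<close> by \<open>k\<close> changes the product by \<open>k\<close> to leading order.\<close>

lemma group_commutator_approx:
  assumes "x \<in> tail i" "y \<in> tail j" "i \<ge> 1" "j \<ge> 1"
  shows "mul (mul x y) (- mul y x) - brk x y \<in> tail (Suc (i + j))"
proof -
  have long: "long_terms u v \<in> tail (Suc (i + j))"
    if "u = x \<and> v = y \<or> u = y \<and> v = x" for u v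
    unfolding long_terms_def
  proof (rule tail_sum)
    fix w assume "w \<in> {w \<in> words. 3 \<le> length (word (snd w))}"
    then have "nb (map (letter u v) (word (snd w))) \<in> tail (Suc (i + j))"
      using nb_long_tail[of x i y j "word (snd w)"] nb_long_tail[of y j x i "word (snd w)"] assms that
      by (auto simp: add.commute)
    then show "wterm u v w \<in> tail (Suc (i + j))" unfolding wterm_def by (rule tail_scale)
  qed
  let ?k = "mul x y - mul y x"
  have "?k - brk x y = long_terms x y - long_terms y x"
    unfolding mul_expand brk_antisym[of y x] by (simp add: algebra_simps flip: scaleR_left_distrib)
  then have 1: "?k - brk x y \<in> tail (Suc (i + j))"
    using long by (auto intro: tail_diff)
  then have "?k - brk x y \<in> tail (i + j)" using tail_antimono[of "i + j" "Suc (i + j)"] by auto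
  from tail_add[OF this brk_tail[OF assms(1,2)]] have "?k \<in> tail (i + j)" by simp
  then have 2: "mul (mul x y) (- mul y x) - ?k \<in> tail (Suc (i + j))"
    using mul_perturb[of "mul x y" "mul y x" "i + j" "- mul y x" "- mul y x"] by simp
  show ?thesis using tail_add[OF 1 2] by simp
qed

lemma mul_collinear: "mul (s *\<^sub>R e) (t *\<^sub>R e) = (s + t) *\<^sub>R e"
proof -
  have nb: "\<exists>c. nb (map (letter (s *\<^sub>R e) (t *\<^sub>R e)) bs) = (if length bs \<ge> 2 then 0 else c *\<^sub>R e)" for bs
  proof (induction bs)
    case Nil
    have "(0::'a) = 0 *\<^sub>R e" by simp
    then show ?case by auto
  next
    case (Cons b bs)
    have l: "\<exists>c. letter (s *\<^sub>R e) (t *\<^sub>R e) b = c *\<^sub>R e" by (auto simp: letter_def)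
    show ?case
    proof (cases "bs = []")
      case False
      then show ?thesis using Cons.IH l
        by (auto simp: nb_Cons brk_scale_left brk_scale_right alternating split: if_splits)
    qed (use l in simp)
  qed
  have "long_terms (s *\<^sub>R e) (t *\<^sub>R e) = 0"
    unfolding long_terms_def
  proof (rule sum.neutral, rule ballI)
    fix w assume "w \<in> {w \<in> words. 3 \<le> length (word (snd w))}"
    then show "wterm (s *\<^sub>R e) (t *\<^sub>R e) w = 0"
      using nb[of "word (snd w)"] by (auto simp: wterm_def)
  qed
  then show ?thesis
    unfolding mul_expand by (simp add: brk_scale_left brk_scale_right alternating scaleR_left_distrib)
qed

section \<open>Projections to the layers and dilations\<close>

definition pr :: "nat \<Rightarrow> 'a \<Rightarrow> 'a" where
  "pr j x = (if j \<in> {1..r} then (THE f. f \<in> (\<Pi>\<^sub>E j\<in>{1..r}. V j) \<and> x = (\<Sum>j = 1..r. f j)) j else 0)"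

lemma pr_in_layer: "pr j x \<in> V j" and sum_pr: "(\<Sum>j = 1..r. pr j x) = x"
proof -
  define f where "f = (THE f. f \<in> (\<Pi>\<^sub>E j\<in>{1..r}. V j) \<and> x = (\<Sum>j = 1..r. f j))"
  have f: "f \<in> (\<Pi>\<^sub>E j\<in>{1..r}. V j) \<and> x = (\<Sum>j = 1..r. f j)"
    unfolding f_def using theI'[OF direct_sum[of x]] .
  have pr: "pr j x = (if j \<in> {1..r} then f j else 0)" for j
    unfolding pr_def f_def ..
  show "pr j x \<in> V j"
    using PiE_mem[OF f[THEN conjunct1]] subspace_0[OF subspace_layer[of j]] by (simp add: pr)
  have "(\<Sum>j = 1..r. pr j x) = (\<Sum>j = 1..r. f j)"
    by (rule sum.cong) (auto simp: pr)
  then show "(\<Sum>j = 1..r. pr j x) = x" using f by metis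
qed

lemmas sum_pr_Suc [simp] = sum_pr[unfolded One_nat_def]

lemma pr_unique:
  assumes g: "\<And>i. i \<in> {1..r} \<Longrightarrow> g i \<in> V i" and x: "x = (\<Sum>i = 1..r. g i)" and j: "j \<in> {1..r}"
  shows "pr j x = g j"
proof -
  have 1: "restrict g {1..r} \<in> (\<Pi>\<^sub>E j\<in>{1..r}. V j) \<and> x = (\<Sum>j = 1..r. restrict g {1..r} j)"
    using g x by auto
  have 2: "restrict (\<lambda>j. pr j x) {1..r} \<in> (\<Pi>\<^sub>E j\<in>{1..r}. V j) \<and> x = (\<Sum>j = 1..r. restrict (\<lambda>j. pr j x) {1..r} j)"
    using pr_in_layer sum_pr by auto
  have "restrict g {1..r} = restrict (\<lambda>j. pr j x) {1..r}"
    using direct_sum[of x] 1 2 by blast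
  then show ?thesis using j by (metis restrict_apply')
qed

lemma linear_pr: "linear (pr j)"
proof (cases "j \<in> {1..r}")
  case True
  show ?thesis
  proof (rule linearI)
    show "pr j (x + y) = pr j x + pr j y" for x y
      by (rule pr_unique[OF _ _ True])
         (auto simp: sum.distrib intro: subspace_add[OF subspace_layer] pr_in_layer)
    show "pr j (c *\<^sub>R x) = c *\<^sub>R pr j x" for c x
      by (rule pr_unique[OF _ _ True])
         (auto intro: subspace_scale[OF subspace_layer] pr_in_layer simp flip: scaleR_sum_right)
  qed
next
  case False
  then have "pr j = (\<lambda>x. 0)" by (auto simp: pr_def)
  then show ?thesis by (simp add: linear_zero)
qed

lemma pr_layer: "x \<in> V i \<Longrightarrow> pr j x = (if i = j then x else 0)"
proof (cases "i \<in> {1..r} \<and> j \<in> {1..r}")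
  case True
  assume "x \<in> V i"
  then show ?thesis using True
    by (intro pr_unique[where g = "\<lambda>j. if i = j then x else 0"]) (auto intro: subspace_0[OF subspace_layer])
next
  case False
  assume x: "x \<in> V i"
  from False consider "j \<notin> {1..r}" | "i \<notin> {1..r}" by blast
  then show ?thesis
  proof cases
    case 1
    then show ?thesis using x layer_trivial[of i] by (auto simp: pr_def)
  next
    case 2
    then have "x = 0" using x layer_trivial by auto
    then show ?thesis by (simp add: linear_0[OF linear_pr])
  qed
qed

lemma tail_induct:
  assumes x: "x \<in> tail m" and S: "subspace S" and "\<And>i v. m \<le> i \<Longrightarrow> v \<in> V i \<Longrightarrow> v \<in> S"
  shows "x \<in> S"
proof -
  have "tail m \<subseteq> S" unfolding tail_def using assms by (intro span_minimal) auto
  then show ?thesis using x by auto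
qed

lemma pr_tail_0: "x \<in> tail m \<Longrightarrow> j < m \<Longrightarrow> pr j x = 0"
proof -
  assume x: "x \<in> tail m" and j: "j < m"
  have "x \<in> {x. pr j x = 0}"
    by (rule tail_induct[OF x])
       (use j in \<open>auto simp: subspace_def linear_0[OF linear_pr] linear_add[OF linear_pr] linear_scale[OF linear_pr] pr_layer\<close>)
  then show ?thesis by simp
qed

lemma diff_pr_tail: "x \<in> tail m \<Longrightarrow> x - pr m x \<in> tail (Suc m)"
proof -
  assume x: "x \<in> tail m"
  have eq: "x + y - (pr m x + pr m y) = (x - pr m x) + (y - pr m y)" for x y by simp
  have "x \<in> {x. x - pr m x \<in> tail (Suc m)}"
  proof (rule tail_induct[OF x])
    show "subspace {x. x - pr m x \<in> tail (Suc m)}"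
      unfolding subspace_def linear_add[OF linear_pr] linear_scale[OF linear_pr] linear_0[OF linear_pr]
        mem_Collect_eq eq scaleR_diff_right[symmetric]
      by (auto intro: tail_add tail_scale)
    fix i v assume "m \<le> i" "v \<in> V i"
    then show "v \<in> {x. x - pr m x \<in> tail (Suc m)}"
      using layer_subset_tail[of i] tail_antimono[of "Suc m" i]
      by (cases "i = m") (auto simp: pr_layer)
  qed
  then show ?thesis by simp
qed

definition dil :: "real \<Rightarrow> 'a \<Rightarrow> 'a" where
  "dil s x = (\<Sum>j = 1..r. s ^ j *\<^sub>R pr j x)"

lemma linear_dil: "linear (dil s)"
  unfolding dil_def by (intro linear_compose_sum ballI linear_compose_scale_right linear_pr)

lemma pr_dil: "j \<in> {1..r} \<Longrightarrow> pr j (dil s x) = s ^ j *\<^sub>R pr j x"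
  by (rule pr_unique[where g = "\<lambda>j. s ^ j *\<^sub>R pr j x"])
     (auto simp: dil_def intro: subspace_scale[OF subspace_layer] pr_in_layer)

lemma dil_layer: "x \<in> V i \<Longrightarrow> dil s x = s ^ i *\<^sub>R x"
proof (cases "i \<in> {1..r}")
  case True
  assume "x \<in> V i"
  then have "dil s x = (\<Sum>j = 1..r. if i = j then s ^ i *\<^sub>R x else 0)"
    unfolding dil_def by (intro sum.cong) (auto simp: pr_layer)
  then show ?thesis using True by simp
next
  case False
  assume "x \<in> V i"
  then have "x = 0" using False layer_trivial by auto
  then show ?thesis by (simp add: linear_0[OF linear_dil])
qed

lemma dil_dil: "dil s (dil t x) = dil (s * t) x"
  unfolding dil_def[of s "dil t x"] dil_def[of "s * t"]
  by (rule sum.cong) (auto simp: pr_dil power_mult_distrib)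

lemma dil_1 [simp]: "dil 1 x = x"
  by (simp add: dil_def sum_pr)

lemma dil_0 [simp]: "dil s 0 = 0"
  by (rule linear_0[OF linear_dil])

lemma dil_inverse [simp]: "s \<noteq> 0 \<Longrightarrow> dil s (dil (inverse s) x) = x" "s \<noteq> 0 \<Longrightarrow> dil (inverse s) (dil s x) = x"
  by (simp_all add: dil_dil)

lemma dil_brk: "dil s (brk x y) = brk (dil s x) (dil s y)"
proof -
  have "brk x y = brk (\<Sum>i = 1..r. pr i x) (\<Sum>j = 1..r. pr j y)" by (simp add: sum_pr)
  also have "\<dots> = (\<Sum>(i, j)\<in>{1..r} \<times> {1..r}. brk (pr i x) (pr j y))"
    by (rule bilinear_sum[OF bilinear_brk])
  finally have "dil s (brk x y) = (\<Sum>(i, j)\<in>{1..r} \<times> {1..r}. dil s (brk (pr i x) (pr j y)))"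
    by (simp add: linear_sum[OF linear_dil] split_def)
  also have "\<dots> = (\<Sum>(i, j)\<in>{1..r} \<times> {1..r}. brk (s ^ i *\<^sub>R pr i x) (s ^ j *\<^sub>R pr j y))"
    by (rule sum.cong)
       (auto simp: dil_layer[OF brk_layer[OF pr_in_layer pr_in_layer]] brk_scale_left brk_scale_right power_add)
  also have "\<dots> = brk (dil s x) (dil s y)"
    unfolding dil_def by (rule bilinear_sum[OF bilinear_brk, symmetric])
  finally show ?thesis .
qed

lemma dil_mul: "dil s (mul x y) = mul (dil s x) (dil s y)"
proof -
  have "dil s (nb (map (letter x y) bs)) = nb (map (letter (dil s x) (dil s y)) bs)" for bs
  proof (induction bs)
    case (Cons b bs)
    then show ?case by (cases "bs = []") (auto simp: nb_Cons dil_brk letter_def)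
  qed simp
  then show ?thesis
    by (simp add: mul_eq_sum_words linear_sum[OF linear_dil] wterm_def linear_scale[OF linear_dil])
qed

end

section \<open>Continuously differentiable maps\<close>

text \<open>In finite dimension, continuity of every directional derivative is continuity of the derivative.\<close>

definition C1map :: "('c::euclidean_space \<Rightarrow> 'd::euclidean_space) \<Rightarrow> bool" where
  "C1map f \<longleftrightarrow> (\<exists>D. (\<forall>z. (f has_derivative D z) (at z)) \<and> (\<forall>v. continuous_on UNIV (\<lambda>z. D z v)))"

lemma C1map_linear: "linear f \<Longrightarrow> C1map f"
  unfolding C1map_def
  by (rule exI[of _ "\<lambda>z. f"]) (auto intro: linear_imp_has_derivative continuous_on_const)

lemma C1map_sum: "(\<And>i. i \<in> A \<Longrightarrow> C1map (f i)) \<Longrightarrow> C1map (\<lambda>z. \<Sum>i\<in>A. f i z)"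
proof -
  assume "\<And>i. i \<in> A \<Longrightarrow> C1map (f i)"
  then obtain D where "\<And>i. i \<in> A \<Longrightarrow> (\<forall>z. (f i has_derivative D i z) (at z)) \<and> (\<forall>v. continuous_on UNIV (\<lambda>z. D i z v))"
    unfolding C1map_def by metis
  then show ?thesis unfolding C1map_def
    by (intro exI[of _ "\<lambda>z v. \<Sum>i\<in>A. D i z v"]) (auto intro!: has_derivative_sum continuous_on_sum)
qed

lemma C1map_continuous: "C1map f \<Longrightarrow> continuous_on UNIV f"
  unfolding C1map_def
  by (meson continuous_at_imp_continuous_on has_derivative_continuous)

lemma C1map_bilinear:
  assumes "bilinear g" "C1map f" "C1map h"
  shows "C1map (\<lambda>z. g (f z) (h z))"
proof -
  interpret bounded_bilinear g using assms(1) by (simp add: bilinear_conv_bounded_bilinear)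
  from assms obtain D E where
    D: "\<And>z. (f has_derivative D z) (at z)" "\<And>v. continuous_on UNIV (\<lambda>z. D z v)" and
    E: "\<And>z. (h has_derivative E z) (at z)" "\<And>v. continuous_on UNIV (\<lambda>z. E z v)"
    unfolding C1map_def by metis
  show ?thesis unfolding C1map_def
  proof (intro exI[of _ "\<lambda>z v. g (f z) (E z v) + g (D z v) (h z)"] conjI allI)
    show "((\<lambda>z. g (f z) (h z)) has_derivative (\<lambda>v. g (f z) (E z v) + g (D z v) (h z))) (at z)" for z
      by (rule FDERIV[OF D(1) E(1)])
    show "continuous_on UNIV (\<lambda>z. g (f z) (E z v) + g (D z v) (h z))" for v
      by (rule continuous_on_add;
          rule continuous_on[OF C1map_continuous[OF assms(2)] E(2)] continuous_on[OF D(2) C1map_continuous[OF assms(3)]])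
  qed
qed

lemma C1map_scaleR: "C1map f \<Longrightarrow> C1map (\<lambda>z. c *\<^sub>R f z)"
proof -
  assume "C1map f"
  then obtain D where
    D: "\<And>z. (f has_derivative D z) (at z)" "\<And>v. continuous_on UNIV (\<lambda>z. D z v)"
    unfolding C1map_def by metis
  show ?thesis unfolding C1map_def
  proof (intro exI[of _ "\<lambda>z v. c *\<^sub>R D z v"] conjI allI)
    show "((\<lambda>z. c *\<^sub>R f z) has_derivative (\<lambda>v. c *\<^sub>R D z v)) (at z)" for z
      by (rule has_derivative_scaleR_right[OF D(1)])
    show "continuous_on UNIV (\<lambda>z. c *\<^sub>R D z v)" for v
      by (rule continuous_on_scaleR[OF continuous_on_const D(2)])
  qed
qed

lemma C1_derivative_bounded:
  fixes D :: "'c::euclidean_space \<Rightarrow> 'c \<Rightarrow> 'd::euclidean_space"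
  assumes lin: "\<And>z. linear (D z)" and cont: "\<And>v. continuous_on UNIV (\<lambda>z. D z v)"
  shows "\<exists>C>0. \<forall>z v. norm z \<le> B \<longrightarrow> norm (D z v) \<le> C * norm v"
proof -
  have "\<exists>K. \<forall>z. norm z \<le> B \<longrightarrow> norm (D z b) \<le> K" for b
  proof -
    have "compact ((\<lambda>z. D z b) ` cball 0 B)"
      by (intro compact_continuous_image continuous_on_subset[OF cont]) auto
    then have "bounded ((\<lambda>z. D z b) ` cball 0 B)" by (rule compact_imp_bounded)
    then obtain K where "\<forall>x\<in>(\<lambda>z. D z b) ` cball 0 B. norm x \<le> K"
      unfolding bounded_iff by blast
    then show ?thesis by (intro exI[of _ K]) auto
  qed
  then obtain K where K: "\<And>b z. norm z \<le> B \<Longrightarrow> norm (D z b) \<le> K b" by metis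
  define C where "C = (\<Sum>b\<in>Basis. \<bar>K b\<bar>) + 1"
  have "C > 0" unfolding C_def by (smt (verit) sum_nonneg abs_ge_zero)
  have "norm (D z v) \<le> C * norm v" if z: "norm z \<le> B" for z v
  proof -
    have "D z v = D z (\<Sum>b\<in>Basis. (v \<bullet> b) *\<^sub>R b)" by (simp only: euclidean_representation)
    also have "\<dots> = (\<Sum>b\<in>Basis. (v \<bullet> b) *\<^sub>R D z b)" by (simp add: linear_sum[OF lin] linear_scale[OF lin])
    finally have "norm (D z v) \<le> (\<Sum>b\<in>Basis. norm ((v \<bullet> b) *\<^sub>R D z b))" by (metis norm_sum)
    also have "\<dots> \<le> (\<Sum>b\<in>Basis. norm v * \<bar>K b\<bar>)"
      using K[OF z] by (intro sum_mono) (auto intro!: mult_mono Basis_le_norm order_trans[OF K[OF z]])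
    also have "\<dots> \<le> C * norm v"
      by (simp add: C_def algebra_simps flip: sum_distrib_left)
    finally show ?thesis .
  qed
  then show ?thesis using \<open>C > 0\<close> by blast
qed

lemma C1map_lipschitz_on_bounded:
  assumes "C1map f"
  shows "\<exists>C>0. \<forall>x y. norm x \<le> B \<longrightarrow> norm y \<le> B \<longrightarrow> norm (f x - f y) \<le> C * norm (x - y)"
proof -
  from assms obtain D where
    D: "\<And>z. (f has_derivative D z) (at z)" "\<And>v. continuous_on UNIV (\<lambda>z. D z v)"
    unfolding C1map_def by metis
  obtain C where C: "C > 0" "\<And>z v. norm z \<le> B \<Longrightarrow> norm (D z v) \<le> C * norm v"
    using C1_derivative_bounded[OF has_derivative_linear[OF D(1)] D(2)] by blast
  have "norm (f x - f y) \<le> C * norm (x - y)" if "norm x \<le> B" "norm y \<le> B" for x y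
  proof (rule differentiable_bound[of "cball 0 B" f D])
    show "(f has_derivative D z) (at z within cball 0 B)" for z
      using D(1) by (rule has_derivative_at_withinI)
    show "onorm (D z) \<le> C" if "z \<in> cball 0 B" for z
      using C that by (intro onorm_bound) auto
  qed (use that in auto)
  then show ?thesis using \<open>C > 0\<close> by blast
qed

lemma continuous_on_derivative_apply:
  fixes D :: "'c::euclidean_space \<Rightarrow> 'c \<Rightarrow> 'd::euclidean_space"
  assumes lin: "\<And>z. linear (D z)" and cont: "\<And>v. continuous_on UNIV (\<lambda>z. D z v)"
    and g: "continuous_on S g" and h: "continuous_on S h"
  shows "continuous_on S (\<lambda>t. D (g t) (h t))"
proof -
  have eq: "D z v = (\<Sum>b\<in>Basis. (v \<bullet> b) *\<^sub>R D z b)" for z v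
  proof -
    have "D z (\<Sum>b\<in>Basis. (v \<bullet> b) *\<^sub>R b) = (\<Sum>b\<in>Basis. (v \<bullet> b) *\<^sub>R D z b)"
      by (simp add: linear_sum[OF lin] linear_scale[OF lin])
    then show ?thesis by (simp only: euclidean_representation)
  qed
  have "continuous_on S (\<lambda>t. D (g t) b)" for b
    by (rule continuous_on_compose2[OF cont g]) simp
  then have "continuous_on S (\<lambda>t. \<Sum>b\<in>Basis. (h t \<bullet> b) *\<^sub>R D (g t) b)"
    by (intro continuous_on_sum continuous_on_scaleR continuous_on_inner h continuous_on_const)
  then show ?thesis unfolding eq[of "g _" "h _"] .
qed

context carnot_group
begin

lemma C1map_mul: "C1map (\<lambda>z. mul (fst z) (snd z))"
proof -
  have nb: "C1map (\<lambda>z. nb (map (letter (fst z) (snd z)) bs))" for bs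
  proof (induction bs)
    case Nil
    then show ?case by (simp add: C1map_linear linear_zero)
  next
    case (Cons b bs)
    have l: "C1map (\<lambda>z. letter (fst z) (snd z) b)"
      by (cases b) (auto simp: letter_def intro!: C1map_linear linear_fst linear_snd)
    show ?case
    proof (cases "bs = []")
      case False
      then show ?thesis using C1map_bilinear[OF bilinear_brk l Cons.IH] by (simp add: nb_Cons)
    qed (use l in simp)
  qed
  show ?thesis
    unfolding mul_eq_sum_words wterm_def by (intro C1map_sum C1map_scaleR nb)
qed

lemma continuous_on_mul [continuous_intros]:
  "continuous_on S f \<Longrightarrow> continuous_on S g \<Longrightarrow> continuous_on S (\<lambda>z. mul (f z) (g z))"
  using continuous_on_compose2[OF C1map_continuous[OF C1map_mul] continuous_on_Pair[of S f g]] by simp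

lemma mul_lipschitz_on_bounded:
  "\<exists>C>0. \<forall>x y x' y'. norm x \<le> B \<longrightarrow> norm y \<le> B \<longrightarrow> norm x' \<le> B \<longrightarrow> norm y' \<le> B \<longrightarrow>
     norm (mul x y - mul x' y') \<le> C * (norm (x - x') + norm (y - y'))"
proof -
  obtain C where C: "C > 0" "\<And>z w. norm z \<le> 2 * B \<Longrightarrow> norm w \<le> 2 * B \<Longrightarrow>
      norm (mul (fst z) (snd z) - mul (fst w) (snd w)) \<le> C * norm (z - w)"
    using C1map_lipschitz_on_bounded[OF C1map_mul, of "2 * B"] by auto
  have "norm (mul x y - mul x' y') \<le> C * (norm (x - x') + norm (y - y'))"
    if "norm x \<le> B" "norm y \<le> B" "norm x' \<le> B" "norm y' \<le> B" for x y x' y'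
  proof -
    have "norm (x, y) \<le> 2 * B" "norm (x', y') \<le> 2 * B"
      using norm_Pair_le[of x y] norm_Pair_le[of x' y'] that by linarith+
    from C(2)[OF this] have "norm (mul x y - mul x' y') \<le> C * norm (x - x', y - y')" by simp
    also have "\<dots> \<le> C * (norm (x - x') + norm (y - y'))"
      using C(1) by (intro mult_left_mono norm_Pair_le) auto
    finally show ?thesis .
  qed
  then show ?thesis using C(1) by blast
qed

lemma mul_bounded_on_bounded:
  "\<exists>C>0. \<forall>x y. norm x \<le> B \<longrightarrow> norm y \<le> B \<longrightarrow> norm (mul x y) \<le> C"
proof -
  obtain C where C: "C > 0" "\<And>x y x' y'. norm x \<le> \<bar>B\<bar> \<Longrightarrow> norm y \<le> \<bar>B\<bar> \<Longrightarrow> norm x' \<le> \<bar>B\<bar> \<Longrightarrow> norm y' \<le> \<bar>B\<bar> \<Longrightarrow>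
     norm (mul x y - mul x' y') \<le> C * (norm (x - x') + norm (y - y'))"
    using mul_lipschitz_on_bounded[of "\<bar>B\<bar>"] by metis
  have "norm (mul x y) \<le> C * (2 * \<bar>B\<bar>) + 1" if "norm x \<le> B" "norm y \<le> B" for x y
  proof -
    have "norm (mul x y) \<le> C * (norm x + norm y)"
      using C(2)[of x y 0 0] that by simp
    also have "\<dots> \<le> C * (2 * \<bar>B\<bar>)" using that C(1) by (intro mult_left_mono) auto
    finally show ?thesis by simp
  qed
  moreover have "C * (2 * \<bar>B\<bar>) + 1 > 0" using C(1) by (intro add_nonneg_pos) auto
  ultimately show ?thesis by blast
qed

end

section \<open>Products of horizontal elements\<close>

text \<open>The vectors in \<open>F\<close> may be linearly dependent: the coefficients are those in a basis of \<open>span F\<close>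
  chosen from \<open>F\<close>.\<close>

lemma bounded_span_coefficients:
  fixes F :: "'a::euclidean_space set"
  assumes "finite F"
  shows "\<exists>C\<ge>0. \<forall>v\<in>span F. \<exists>c. v = (\<Sum>b\<in>F. c b *\<^sub>R b) \<and> (\<forall>b\<in>F. \<bar>c b\<bar> \<le> C * norm v)"
proof -
  obtain B where B: "B \<subseteq> F" "independent B" "F \<subseteq> span B"
    using maximal_independent_subset by blast
  have finB: "finite B" using B(1) assms by (rule finite_subset)
  have "\<exists>g::'a \<Rightarrow> real. linear g \<and> (\<forall>x\<in>B. g x = (if x = b then 1 else 0))" for b
    using linear_independent_extend[OF B(2), of "\<lambda>x. if x = b then 1 else 0"] by blast
  then obtain g :: "'a \<Rightarrow> 'a \<Rightarrow> real" where
    g: "\<And>b. linear (g b)" "\<And>b x. x \<in> B \<Longrightarrow> g b x = (if x = b then 1 else 0)"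
    by metis
  have "\<exists>K. \<forall>v. \<bar>g b v\<bar> \<le> K * norm v" for b
    using linear_bounded[OF g(1)] by (simp add: real_norm_def)
  then obtain K where K: "\<And>b v. \<bar>g b v\<bar> \<le> K b * norm v" by metis
  define C where "C = (\<Sum>b\<in>F. \<bar>K b\<bar>)"
  have C0: "C \<ge> 0" unfolding C_def by (intro sum_nonneg) auto
  have rep: "v = (\<Sum>b\<in>B. g b v *\<^sub>R b)" if "v \<in> span B" for v
  proof -
    have "linear (\<lambda>v. \<Sum>b\<in>B. g b v *\<^sub>R b)"
      by (rule linear_compose_sum, rule ballI, rule linearI)
         (simp_all add: linear_add[OF g(1)] linear_scale[OF g(1)] scaleR_left_distrib)
    from linear_eq_on_span[OF linear_id this _ that] show ?thesis
      by (auto simp: g(2) if_distrib[of "\<lambda>c. c *\<^sub>R _"] finB cong: if_cong)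
  qed
  have "\<exists>c. v = (\<Sum>b\<in>F. c b *\<^sub>R b) \<and> (\<forall>b\<in>F. \<bar>c b\<bar> \<le> C * norm v)" if "v \<in> span F" for v
  proof -
    have "v \<in> span B" using that B(3) span_minimal[of F "span B"] by auto
    note rep[OF this]
    also have "(\<Sum>b\<in>B. g b v *\<^sub>R b) = (\<Sum>b\<in>F. (if b \<in> B then g b v else 0) *\<^sub>R b)"
      using B(1) assms by (intro sum.mono_neutral_cong_left) auto
    finally have 1: "v = (\<Sum>b\<in>F. (if b \<in> B then g b v else 0) *\<^sub>R b)" .
    have "\<bar>if b \<in> B then g b v else 0\<bar> \<le> C * norm v" if "b \<in> F" for b
    proof -
      have "\<bar>K b\<bar> \<le> C" unfolding C_def using that assms by (intro member_le_sum) auto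
      then have "K b * norm v \<le> C * norm v" by (intro mult_right_mono) auto
      then show ?thesis using K[of b v] C0 by auto
    qed
    then show ?thesis using 1 by (intro exI[of _ "\<lambda>b. if b \<in> B then g b v else 0"]) blast
  qed
  then show ?thesis using C0 by blast
qed

context carnot_group
begin

definition E :: "'a set" where
  "E = (SOME B. (\<forall>x\<in>B. norm x = 1) \<and> independent B \<and> span B = V 1)"

lemma norm_E: "e \<in> E \<Longrightarrow> norm e = 1" and independent_E: "independent E" and span_E: "span E = V 1"
proof -
  have "\<exists>B. (\<forall>x\<in>B. norm x = 1) \<and> independent B \<and> span B = V 1"
    using orthonormal_basis_subspace[OF subspace_layer[of 1]] by metis
  from someI_ex[OF this] show "e \<in> E \<Longrightarrow> norm e = 1" "independent E" "span E = V 1"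
    unfolding E_def by blast+
qed

lemma finite_E: "finite E"
  using independent_E by (rule independent_imp_finite)

lemma E_layer: "e \<in> E \<Longrightarrow> e \<in> V 1"
  using span_base span_E by blast

fun iterated_brackets :: "nat \<Rightarrow> 'a set" where
  "iterated_brackets 0 = E"
| "iterated_brackets (Suc j) = (\<lambda>(e, b). brk e b) ` (E \<times> iterated_brackets j)"

lemma finite_iterated_brackets: "finite (iterated_brackets j)"
  by (induction j) (auto simp: finite_E)

lemma iterated_brackets_layer: "b \<in> iterated_brackets j \<Longrightarrow> b \<in> V (Suc j)"
proof (induction j arbitrary: b)
  case 0
  then show ?case using E_layer by simp
next
  case (Suc j)
  then obtain e b' where "b = brk e b'" "e \<in> E" "b' \<in> iterated_brackets j" by auto
  then show ?case using brk_layer[OF E_layer Suc.IH] by simp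
qed

text \<open>By the Jacobi identity, the bracket of two right-nested brackets is a combination of right-nested
  brackets, so that their span is a subalgebra containing \<open>V 1\<close>.\<close>

lemma span_iterated_brackets_UNIV: "span (\<Union>j. iterated_brackets j) = UNIV" (is "?W = _")
proof -
  have E_W: "brk e y \<in> ?W" if "e \<in> E" "y \<in> ?W" for e y
  proof -
    have "subspace {y. brk e y \<in> ?W}"
      by (auto simp: subspace_def brk_add_right brk_scale_right intro: span_add span_scale span_zero)
    moreover have "brk e b \<in> ?W" if "b \<in> iterated_brackets j" for b j
    proof -
      have "brk e b \<in> iterated_brackets (Suc j)" using that \<open>e \<in> E\<close> by force
      then show ?thesis by (blast intro: span_base)
    qed
    ultimately have "?W \<subseteq> {y. brk e y \<in> ?W}" by (intro span_minimal) auto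
    then show ?thesis using that by auto
  qed
  have lay_W: "brk b y \<in> ?W" if "b \<in> iterated_brackets j" "y \<in> ?W" for b j y
    using that
  proof (induction j arbitrary: b y)
    case 0
    then show ?case using E_W by simp
  next
    case (Suc j)
    then obtain e c where b: "b = brk e c" "e \<in> E" "c \<in> iterated_brackets j" by auto
    have "brk e (brk c y) + brk c (brk y e) + brk y (brk e c) = 0" by (rule jacobi)
    then have "brk (brk e c) y = brk e (brk c y) - brk c (brk e y)"
      using add_eq_0_iff[of "brk e (brk c y) + brk c (brk y e)" "brk y (brk e c)"]
      by (simp add: brk_antisym[of y "brk e c"] brk_antisym[of e y] bilinear_rneg[OF bilinear_brk])
    then show ?case
      using E_W[OF b(2)] Suc.IH[OF b(3)] Suc.prems(2) by (auto simp: b(1) intro: span_diff)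
  qed
  have "brk x y \<in> ?W" if "x \<in> ?W" "y \<in> ?W" for x y
  proof -
    have "subspace {x. brk x y \<in> ?W}"
      by (auto simp: subspace_def brk_add_left brk_scale_left intro: span_add span_scale span_zero)
    then have "?W \<subseteq> {x. brk x y \<in> ?W}" using lay_W that by (intro span_minimal) auto
    then show ?thesis using that by auto
  qed
  moreover have "V 1 \<subseteq> ?W"
  proof -
    have "E \<subseteq> (\<Union>j. iterated_brackets j)" using iterated_brackets.simps(1) by blast
    then show ?thesis unfolding span_E[symmetric] by (rule span_mono)
  qed
  ultimately have "(\<lambda>W. subspace W \<and> (\<forall>x\<in>W. \<forall>y\<in>W. brk x y \<in> W)) hull (V 1) \<subseteq> ?W"
    by (intro hull_minimal) auto
  then show ?thesis using generating by auto
qed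

lemma layer_spanned: "V (Suc j) \<subseteq> span (iterated_brackets j)"
proof
  fix x assume x: "x \<in> V (Suc j)"
  have "subspace {x. pr (Suc j) x \<in> span (iterated_brackets j)}"
    by (auto simp: subspace_def linear_0[OF linear_pr] linear_add[OF linear_pr] linear_scale[OF linear_pr]
        intro: span_add span_scale span_zero)
  moreover have "pr (Suc j) b \<in> span (iterated_brackets j)" if "b \<in> iterated_brackets i" for b i
    using pr_layer[OF iterated_brackets_layer[OF that], of "Suc j"] that by (auto intro: span_base span_zero)
  ultimately have "span (\<Union>j. iterated_brackets j) \<subseteq> {x. pr (Suc j) x \<in> span (iterated_brackets j)}"
    by (intro span_minimal) auto
  then have "pr (Suc j) x \<in> span (iterated_brackets j)" using span_iterated_brackets_UNIV by auto
  then show "x \<in> span (iterated_brackets j)" using pr_layer[OF x, of "Suc j"] by simp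
qed

definition hprod :: "(real \<times> 'a) list \<Rightarrow> 'a" where
  "hprod ps = foldr (\<lambda>(s, e). mul (s *\<^sub>R e)) ps 0"

definition reach :: "nat \<Rightarrow> real \<Rightarrow> 'a set" where
  "reach N C = hprod ` {ps. length ps \<le> N \<and> set ps \<subseteq> {-C..C} \<times> E}"

text \<open>Bounds that are homogeneous under dilations are not tracked at this stage; scaling recovers them
  in \<open>horizontal_factorization\<close>.\<close>

definition reachable :: "'a set \<Rightarrow> bool" where
  "reachable X \<longleftrightarrow> (\<exists>N C. X \<subseteq> reach N C)"

lemma hprod_Nil [simp]: "hprod [] = 0" and hprod_Cons: "hprod ((s, e) # ps) = mul (s *\<^sub>R e) (hprod ps)"
  by (simp_all add: hprod_def)

lemma hprod_append: "hprod (ps @ qs) = mul (hprod ps) (hprod qs)"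
proof (induction ps)
  case (Cons p ps)
  then show ?case by (cases p) (simp add: hprod_Cons mul_assoc)
qed simp

lemma hprod_single: "hprod [(s, e)] = s *\<^sub>R e"
  by (simp add: hprod_Cons)

lemma hprod_rev: "hprod (rev (map (\<lambda>(s, e). (- s, e)) ps)) = - hprod ps"
proof (induction ps)
  case (Cons p ps)
  then show ?case by (cases p) (simp add: hprod_Cons hprod_append minus_mul hprod_single)
qed simp

lemma reach_iff: "x \<in> reach N C \<longleftrightarrow> (\<exists>ps. x = hprod ps \<and> length ps \<le> N \<and> set ps \<subseteq> {-C..C} \<times> E)"
  by (auto simp: reach_def)

lemma reachable_subset: "reachable Y \<Longrightarrow> X \<subseteq> Y \<Longrightarrow> reachable X"
  by (auto simp: reachable_def)

lemma reachable_mul: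
  assumes "reachable X" "reachable Y"
  shows "reachable ((\<lambda>(x, y). mul x y) ` (X \<times> Y))"
proof -
  obtain N C M D where X: "X \<subseteq> reach N C" and Y: "Y \<subseteq> reach M D"
    using assms by (auto simp: reachable_def)
  have "mul x y \<in> reach (N + M) (max C D)" if "x \<in> X" "y \<in> Y" for x y
  proof -
    obtain ps where ps: "x = hprod ps" "length ps \<le> N" "set ps \<subseteq> {-C..C} \<times> E"
      using subsetD[OF X \<open>x \<in> X\<close>] unfolding reach_iff by blast
    obtain qs where qs: "y = hprod qs" "length qs \<le> M" "set qs \<subseteq> {-D..D} \<times> E"
      using subsetD[OF Y \<open>y \<in> Y\<close>] unfolding reach_iff by blast
    have "set (ps @ qs) \<subseteq> {-max C D..max C D} \<times> E"
      using ps(3) qs(3) by fastforce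
    then show ?thesis
      unfolding reach_def ps(1) qs(1) hprod_append[symmetric]
      by (intro imageI) (use ps(2) qs(2) in auto)
  qed
  then have "(\<lambda>(x, y). mul x y) ` (X \<times> Y) \<subseteq> reach (N + M) (max C D)" by auto
  then show ?thesis unfolding reachable_def by blast
qed

lemma reachable_minus:
  assumes "reachable X"
  shows "reachable (uminus ` X)"
proof -
  obtain N C where X: "X \<subseteq> reach N C" using assms by (auto simp: reachable_def)
  have "- x \<in> reach N C" if "x \<in> X" for x
  proof -
    obtain ps where ps: "x = hprod ps" "length ps \<le> N" "set ps \<subseteq> {-C..C} \<times> E"
      using subsetD[OF X \<open>x \<in> X\<close>] unfolding reach_iff by blast
    have "set (rev (map (\<lambda>(s, e). (- s, e)) ps)) \<subseteq> {-C..C} \<times> E"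
      using ps(3) by fastforce
    then show ?thesis
      unfolding reach_def ps(1) hprod_rev[symmetric] by (intro imageI) (use ps(2) in auto)
  qed
  then show ?thesis unfolding reachable_def by blast
qed

lemma reachable_line: "e \<in> E \<Longrightarrow> reachable ((\<lambda>t. t *\<^sub>R e) ` {-C..C})"
proof -
  assume "e \<in> E"
  then have "t *\<^sub>R e \<in> reach 1 C" if "t \<in> {-C..C}" for t
    unfolding reach_def hprod_single[symmetric] by (intro imageI) (use that in auto)
  then show ?thesis unfolding reachable_def by blast
qed

lemma reachable_0: "reachable {0}"
proof -
  have "hprod [] \<in> reach 0 0" unfolding reach_def by (intro imageI) auto
  then show ?thesis unfolding reachable_def by auto
qed

lemma reachable_bounded: "reachable X \<Longrightarrow> bounded X"
proof -
  have "\<exists>B\<ge>0. \<forall>ps. length ps \<le> N \<longrightarrow> set ps \<subseteq> {-C..C} \<times> E \<longrightarrow> norm (hprod ps) \<le> B" for N C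
  proof (induction N)
    case 0
    show ?case by (rule exI[of _ 0]) auto
  next
    case (Suc N)
    then obtain B where B: "B \<ge> 0" "\<And>ps. length ps \<le> N \<Longrightarrow> set ps \<subseteq> {-C..C} \<times> E \<Longrightarrow> norm (hprod ps) \<le> B" by blast
    obtain K where K: "K > 0" "\<And>x y. norm x \<le> max B \<bar>C\<bar> \<Longrightarrow> norm y \<le> max B \<bar>C\<bar> \<Longrightarrow> norm (mul x y) \<le> K"
      using mul_bounded_on_bounded[of "max B \<bar>C\<bar>"] by blast
    have "norm (hprod ps) \<le> K" if ps: "length ps \<le> Suc N" "set ps \<subseteq> {-C..C} \<times> E" for ps
    proof (cases ps)
      case (Cons p qs)
      obtain s e where p: "p = (s, e)" by (cases p)
      have "norm (s *\<^sub>R e) \<le> max B \<bar>C\<bar>" using ps Cons p norm_E by auto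
      moreover have "norm (hprod qs) \<le> max B \<bar>C\<bar>" using B(2)[of qs] ps Cons by auto
      ultimately show ?thesis using K(2) by (simp add: Cons p hprod_Cons)
    qed (use K in simp)
    then show ?case using K(1) by (intro exI[of _ K]) auto
  qed
  moreover assume "reachable X"
  ultimately show ?thesis
    unfolding reachable_def reach_def bounded_iff by (smt (verit) image_iff mem_Collect_eq subsetD)
qed

text \<open>To leading order, the group commutator of \<open>e\<close> and \<open>t b\<close> is \<open>t [e, b]\<close>. The parameter \<open>t\<close> is thus kept
  in the innermost letter and the outer letters enter with size one, which avoids roots of \<open>t\<close>.\<close>

lemma reachable_bracket:
  "b \<in> iterated_brackets j \<Longrightarrow>
   \<exists>X. reachable X \<and> (\<forall>t. \<bar>t\<bar> \<le> C \<longrightarrow> (\<exists>g\<in>X. g - t *\<^sub>R b \<in> tail (Suc (Suc j))))"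
proof (induction j arbitrary: b)
  case 0
  then have "reachable ((\<lambda>t. t *\<^sub>R b) ` {-C..C})" by (intro reachable_line) simp
  moreover have "\<exists>g\<in>(\<lambda>t. t *\<^sub>R b) ` {-C..C}. g - t *\<^sub>R b \<in> tail (Suc (Suc 0))" if "\<bar>t\<bar> \<le> C" for t
    using that by (intro bexI[of _ "t *\<^sub>R b"] image_eqI[of _ _ t]) auto
  ultimately show ?case by blast
next
  case (Suc j)
  then obtain e c where b: "b = brk e c" "e \<in> E" "c \<in> iterated_brackets j" by auto
  obtain X where X: "reachable X" "\<And>t. \<bar>t\<bar> \<le> C \<Longrightarrow> \<exists>g\<in>X. g - t *\<^sub>R c \<in> tail (Suc (Suc j))"
    using Suc.IH[OF b(3)] by blast
  let ?f = "\<lambda>(x, y). mul x y"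
  have e: "reachable {e}"
    by (rule reachable_subset[OF reachable_line[OF b(2), of 1]]) (auto intro: image_eqI[of _ _ 1])
  define Y where "Y = ?f ` (?f ` ({e} \<times> X) \<times> uminus ` ?f ` (X \<times> {e}))"
  have "reachable Y" unfolding Y_def by (intro reachable_mul reachable_minus e X)
  moreover have "\<exists>w\<in>Y. w - t *\<^sub>R b \<in> tail (Suc (Suc (Suc j)))" if t: "\<bar>t\<bar> \<le> C" for t
  proof -
    obtain g where g: "g \<in> X" "g - t *\<^sub>R c \<in> tail (Suc (Suc j))" using X(2)[OF t] by blast
    have "t *\<^sub>R c \<in> tail (Suc j)"
      using iterated_brackets_layer[OF b(3)] layer_subset_tail by (auto intro: tail_scale)
    from tail_add[OF _ this, of "g - t *\<^sub>R c"] have g': "g \<in> tail (Suc j)"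
      using g(2) tail_antimono[of "Suc j" "Suc (Suc j)"] by auto
    have "mul (mul e g) (- mul g e) - brk e g \<in> tail (Suc (Suc 0 + Suc j))"
      by (rule group_commutator_approx) (use g' in \<open>auto simp: tail_1\<close>)
    moreover have "brk e (g - t *\<^sub>R c) \<in> tail (Suc (Suc (Suc j)))"
      by (rule brk_tail_Suc(2)[OF g(2)])
    ultimately have "mul (mul e g) (- mul g e) - brk e g + brk e (g - t *\<^sub>R c) \<in> tail (Suc (Suc (Suc j)))"
      by (intro tail_add) simp_all
    then have "mul (mul e g) (- mul g e) - t *\<^sub>R b \<in> tail (Suc (Suc (Suc j)))"
      by (simp add: b(1) brk_diff_right brk_scale_right)
    moreover have "mul (mul e g) (- mul g e) \<in> Y"
      unfolding Y_def using g(1) by force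
    ultimately show ?thesis by blast
  qed
  ultimately show ?case by blast
qed

lemma reachable_combination:
  assumes "finite F" "F \<subseteq> iterated_brackets j"
  shows "\<exists>X. reachable X \<and> (\<forall>c. (\<forall>b\<in>F. \<bar>c b\<bar> \<le> C) \<longrightarrow> (\<exists>g\<in>X. g - (\<Sum>b\<in>F. c b *\<^sub>R b) \<in> tail (Suc (Suc j))))"
  using assms
proof (induction F rule: finite_induct)
  case empty
  then show ?case using reachable_0 by (intro exI[of _ "{0}"]) auto
next
  case (insert b F)
  then obtain X where X: "reachable X"
    "\<And>c. (\<forall>b\<in>F. \<bar>c b\<bar> \<le> C) \<Longrightarrow> \<exists>g\<in>X. g - (\<Sum>b\<in>F. c b *\<^sub>R b) \<in> tail (Suc (Suc j))"
    by auto
  obtain Y where Y: "reachable Y" "\<And>t. \<bar>t\<bar> \<le> C \<Longrightarrow> \<exists>g\<in>Y. g - t *\<^sub>R b \<in> tail (Suc (Suc j))"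
    using reachable_bracket[of b j C] insert.prems by auto
  have "reachable ((\<lambda>(x, y). mul x y) ` (Y \<times> X))"
    by (intro reachable_mul X Y)
  moreover have "\<exists>g\<in>(\<lambda>(x, y). mul x y) ` (Y \<times> X). g - (\<Sum>b\<in>insert b F. c b *\<^sub>R b) \<in> tail (Suc (Suc j))"
    if c: "\<forall>b\<in>insert b F. \<bar>c b\<bar> \<le> C" for c
  proof -
    obtain g where g: "g \<in> Y" "g - c b *\<^sub>R b \<in> tail (Suc (Suc j))" using Y(2)[of "c b"] c by auto
    obtain h where h: "h \<in> X" "h - (\<Sum>b\<in>F. c b *\<^sub>R b) \<in> tail (Suc (Suc j))" using X(2)[of c] c by auto
    have tl: "v \<in> tail (Suc j)" if "u \<in> tail (Suc j)" "v - u \<in> tail (Suc (Suc j))" for u v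
      using tail_add[of "v - u" "Suc j" u] that tail_antimono[of "Suc j" "Suc (Suc j)"] by auto
    have lay: "b' \<in> tail (Suc j)" if "b' \<in> insert b F" for b'
      using iterated_brackets_layer insert.prems that layer_subset_tail by blast
    have "g \<in> tail (Suc j)"
      by (rule tl[OF _ g(2)]) (intro tail_scale lay insertI1)
    moreover have "h \<in> tail (Suc j)"
      by (rule tl[OF _ h(2)]) (intro tail_sum tail_scale lay insertI2)
    ultimately have 1: "mul g h - (g + h) \<in> tail (Suc (Suc j))" by (rule mul_tail_approx)
    have "mul g h - (\<Sum>b\<in>insert b F. c b *\<^sub>R b)
        = (mul g h - (g + h)) + (g - c b *\<^sub>R b) + (h - (\<Sum>b\<in>F. c b *\<^sub>R b))"
      using insert.hyps by simp
    also have "\<dots> \<in> tail (Suc (Suc j))" by (intro tail_add 1 g h)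
    finally show ?thesis using g(1) h(1) by force
  qed
  ultimately show ?case by blast
qed

text \<open>Descending induction along the filtration: the component in the first remaining layer is
  produced by commutators, and what is left over lies one step further down.\<close>

lemma reachable_tail: "reachable {x \<in> tail (Suc j). norm x \<le> B}"
proof (induction "r - j" arbitrary: j B)
  case 0
  then have "tail (Suc j) = {0}" by (intro tail_beyond_step) auto
  then show ?case by (intro reachable_subset[OF reachable_0]) auto
next
  case (Suc k)
  obtain K where K: "K \<ge> 0" "\<And>v. norm (pr (Suc j) v) \<le> K * norm v"
  proof -
    obtain K where "\<And>v. norm (pr (Suc j) v) \<le> K * norm v" using linear_bounded[OF linear_pr] by blast
    then have "norm (pr (Suc j) v) \<le> \<bar>K\<bar> * norm v" for v
      by (rule order_trans) (intro mult_right_mono, auto)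
    then show ?thesis using that[of "\<bar>K\<bar>"] by auto
  qed
  obtain C where C: "C \<ge> 0" "\<And>v. v \<in> span (iterated_brackets j) \<Longrightarrow>
      \<exists>c. v = (\<Sum>b\<in>iterated_brackets j. c b *\<^sub>R b) \<and> (\<forall>b\<in>iterated_brackets j. \<bar>c b\<bar> \<le> C * norm v)"
    using bounded_span_coefficients[OF finite_iterated_brackets] by blast
  \<comment> \<open>The component of \<open>x\<close> in \<open>V (Suc j)\<close> has norm at most \<open>K \<bar>B\<bar>\<close>; \<open>C\<close> bounds its coefficients.\<close>
  obtain X where X: "reachable X"
    "\<And>c. (\<forall>b\<in>iterated_brackets j. \<bar>c b\<bar> \<le> C * (K * \<bar>B\<bar>)) \<Longrightarrow>
       \<exists>g\<in>X. g - (\<Sum>b\<in>iterated_brackets j. c b *\<^sub>R b) \<in> tail (Suc (Suc j))"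
    using reachable_combination[OF finite_iterated_brackets order_refl] by blast
  obtain D where D: "\<And>x. x \<in> X \<Longrightarrow> norm x \<le> D"
    using reachable_bounded[OF X(1)] by (auto simp: bounded_iff)
  obtain B' where B': "\<And>x y. norm x \<le> max B D \<Longrightarrow> norm y \<le> max B D \<Longrightarrow> norm (mul x y) \<le> B'"
    using mul_bounded_on_bounded[of "max B D"] by blast
  define Y where "Y = {x \<in> tail (Suc (Suc j)). norm x \<le> B'}"
  have Y: "reachable Y" unfolding Y_def by (rule Suc.hyps(1)) (use Suc.hyps(2) in auto)
  have "x \<in> (\<lambda>(x, y). mul x y) ` (X \<times> Y)" if x: "x \<in> tail (Suc j)" "norm x \<le> B" for x
  proof -
    let ?v = "pr (Suc j) x"
    have "?v \<in> span (iterated_brackets j)" using layer_spanned pr_in_layer by blast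
    then obtain c where c: "?v = (\<Sum>b\<in>iterated_brackets j. c b *\<^sub>R b)"
      "\<And>b. b \<in> iterated_brackets j \<Longrightarrow> \<bar>c b\<bar> \<le> C * norm ?v" using C(2) by blast
    have "norm ?v \<le> K * \<bar>B\<bar>"
      using K(2)[of x] x(2) mult_left_mono[OF _ K(1), of "norm x" "\<bar>B\<bar>"] by linarith
    then have "C * norm ?v \<le> C * (K * \<bar>B\<bar>)" using C(1) by (rule mult_left_mono)
    with c have "\<forall>b\<in>iterated_brackets j. \<bar>c b\<bar> \<le> C * (K * \<bar>B\<bar>)" by force
    then obtain g where g: "g \<in> X" "g - ?v \<in> tail (Suc (Suc j))" using X(2) c(1) by metis
    have xv: "x - ?v \<in> tail (Suc (Suc j))" by (rule diff_pr_tail[OF x(1)])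
    have gx: "x - g \<in> tail (Suc (Suc j))" using tail_diff[OF xv g(2)] by simp
    have "mul (- g) x - mul (- g) g - ((- g - - g) + (x - g)) \<in> tail (Suc (Suc (Suc j)))"
      by (rule mul_perturb) (use gx in auto)
    then have "mul (- g) x - (x - g) \<in> tail (Suc (Suc j))"
      using tail_antimono[of "Suc (Suc j)" "Suc (Suc (Suc j))"] by auto
    from tail_add[OF this gx] have "mul (- g) x \<in> tail (Suc (Suc j))" by simp
    moreover have "norm (mul (- g) x) \<le> B'"
      using D[OF g(1)] x(2) by (intro B') auto
    ultimately have "mul (- g) x \<in> Y" by (simp add: Y_def)
    moreover have "x = mul g (mul (- g) x)" by simp
    ultimately show ?thesis using g(1) by (metis (mono_tags, lifting) SigmaI image_eqI case_prod_conv)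
  qed
  then have "{x \<in> tail (Suc j). norm x \<le> B} \<subseteq> (\<lambda>(x, y). mul x y) ` (X \<times> Y)" by blast
  then show ?case by (rule reachable_subset[OF reachable_mul[OF X(1) Y]])
qed

text \<open>Chow's theorem, with uniform bounds on bounded sets.\<close>

theorem bounded_imp_reachable: "reachable {x. norm x \<le> B}"
  using reachable_tail[of 0 B] by (simp add: tail_1)

lemma dil_hprod: "set ps \<subseteq> UNIV \<times> E \<Longrightarrow> dil s (hprod ps) = hprod (map (\<lambda>(t, e). (s * t, e)) ps)"
proof (induction ps)
  case (Cons p ps)
  then show ?case
    by (cases p) (auto simp: hprod_Cons dil_mul dil_layer[OF E_layer] linear_scale[OF linear_dil] mult.commute)
qed simp

end

section \<open>Horizontal curves\<close>

context carnot_group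
begin

abbreviation LT :: "'a \<Rightarrow> 'a \<Rightarrow> 'a" where
  "LT p \<equiv> frechet_derivative (mul p) (at 0)"

definition joined :: "'a \<Rightarrow> 'a \<Rightarrow> real \<Rightarrow> bool" where
  "joined x y L \<longleftrightarrow> (\<exists>\<gamma> u. \<gamma> 0 = x \<and> \<gamma> 1 = y \<and> horizontal_curve (V 1) mul \<gamma> u L)"

lemma mul_derivative_at: "(mul g has_derivative frechet_derivative (mul g) (at x)) (at x)"
  and continuous_mul_derivative: "continuous_on UNIV (\<lambda>x. frechet_derivative (mul g) (at x) v)"
  and LT_bounded: "\<exists>C>0. \<forall>g v. norm g \<le> B \<longrightarrow> norm (LT g v) \<le> C * norm v"
proof -
  obtain D where
    D: "\<And>z. ((\<lambda>z. mul (fst z) (snd z)) has_derivative D z) (at z)" "\<And>v. continuous_on UNIV (\<lambda>z. D z v)"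
    using C1map_mul unfolding C1map_def by metis
  have 1: "(mul g has_derivative (\<lambda>v. D (g, x) (0, v))) (at x)" for g x
  proof -
    have "((\<lambda>x. (g, x)) has_derivative (\<lambda>v. (0, v))) (at x)"
      by (intro has_derivative_Pair has_derivative_const has_derivative_ident)
    from has_derivative_compose[OF this D(1)[of "(g, x)"]] show ?thesis by simp
  qed
  then have eq: "frechet_derivative (mul g) (at x) = (\<lambda>v. D (g, x) (0, v))" for g x
    using frechet_derivative_at[OF 1] by simp
  show "(mul g has_derivative frechet_derivative (mul g) (at x)) (at x)" unfolding eq by (rule 1)
  show "continuous_on UNIV (\<lambda>x. frechet_derivative (mul g) (at x) v)"
    unfolding eq by (rule continuous_on_compose2[OF D(2)]) (auto intro: continuous_intros)
  show "\<exists>C>0. \<forall>g v. norm g \<le> B \<longrightarrow> norm (LT g v) \<le> C * norm v"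
    using C1_derivative_bounded[OF has_derivative_linear[OF D(1)] D(2), of B]
    unfolding eq by (metis norm_Pair1 norm_Pair2)
qed

lemmas mul_has_derivative = mul_derivative_at[where x = 0]

lemma linear_LT: "linear (LT p)"
  using has_derivative_linear[OF mul_has_derivative] .

text \<open>Applied with \<open>c = 1\<close> to left translations and with \<open>c = s\<close> to dilations.\<close>

lemma horizontal_curve_image:
  assumes F: "\<And>x. (F has_derivative DF x) (at x)" and cont: "\<And>v. continuous_on UNIV (\<lambda>x. DF x v)"
    and inter: "\<And>p v. v \<in> V 1 \<Longrightarrow> DF p (LT p v) = LT (F p) (c *\<^sub>R v)"
    and hc: "horizontal_curve (V 1) mul \<gamma> u L"
  shows "horizontal_curve (V 1) mul (\<lambda>t. F (\<gamma> t)) (\<lambda>t. c *\<^sub>R u t) (\<bar>c\<bar> * L)"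
proof -
  have lin: "linear (DF x)" for x using F by (rule has_derivative_linear)
  have contF: "continuous_on UNIV F" using F by (meson continuous_at_imp_continuous_on has_derivative_continuous)
  have chain: "((\<lambda>t. F (\<gamma> t)) has_vector_derivative DF (\<gamma> t) w) (at t)"
    if "(\<gamma> has_vector_derivative w) (at t)" for t w
    using has_derivative_compose[OF that[unfolded has_vector_derivative_def] F]
    by (simp add: has_vector_derivative_def linear_scale[OF lin])
  from hc obtain N where N: "finite N" "\<And>t. t \<in> {0..1} - N \<Longrightarrow> u t \<in> V 1 \<and>
        (\<gamma> has_vector_derivative LT (\<gamma> t) (u t)) (at t)"
    and pw: "\<gamma> piecewise_C1_differentiable_on {0..1}" and int: "((\<lambda>t. norm (u t)) has_integral L) {0..1}"
    unfolding horizontal_curve_def by blast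
  from pw obtain S D where S: "finite S" "continuous_on {0..1} \<gamma>"
    "\<And>t. t \<in> {0..1} - S \<Longrightarrow> (\<gamma> has_vector_derivative D t) (at t)" "continuous_on ({0..1} - S) D"
    unfolding piecewise_C1_differentiable_on_def C1_differentiable_on_def by blast
  have "(\<lambda>t. F (\<gamma> t)) piecewise_C1_differentiable_on {0..1}"
    unfolding piecewise_C1_differentiable_on_def C1_differentiable_on_def
  proof (intro conjI exI[of _ S] exI[of _ "\<lambda>t. DF (\<gamma> t) (D t)"] ballI)
    show "continuous_on {0..1} (\<lambda>t. F (\<gamma> t))"
      by (rule continuous_on_compose2[OF contF S(2)]) simp
    show "continuous_on ({0..1} - S) (\<lambda>t. DF (\<gamma> t) (D t))"
      by (rule continuous_on_derivative_apply[OF lin cont continuous_on_subset[OF S(2)] S(4)]) auto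
  qed (use S chain in auto)
  moreover have "c *\<^sub>R u t \<in> V 1 \<and> ((\<lambda>t. F (\<gamma> t)) has_vector_derivative LT (F (\<gamma> t)) (c *\<^sub>R u t)) (at t)"
    if "t \<in> {0..1} - N" for t
    using chain[OF conjunct2[OF N(2)[OF that]]] N(2)[OF that] inter
    by (auto intro: subspace_scale[OF subspace_layer])
  moreover have "((\<lambda>t. norm (c *\<^sub>R u t)) has_integral \<bar>c\<bar> * L) {0..1}"
    using has_integral_mult_right[OF int, of "\<bar>c\<bar>"] by simp
  ultimately show ?thesis unfolding horizontal_curve_def using N(1) by blast
qed

lemma joined_left: "joined x y L \<Longrightarrow> joined (mul g x) (mul g y) L"
proof -
  assume "joined x y L"
  then obtain \<gamma> u where c: "\<gamma> 0 = x" "\<gamma> 1 = y" "horizontal_curve (V 1) mul \<gamma> u L"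
    unfolding joined_def by blast
  let ?D = "\<lambda>p. frechet_derivative (mul g) (at p)"
  have "?D p (LT p v) = LT (mul g p) (1 *\<^sub>R v)" for p v
  proof -
    have "((\<lambda>x. mul g (mul p x)) has_derivative (\<lambda>v. ?D p (LT p v))) (at 0)"
      using has_derivative_compose[OF mul_has_derivative[of p], of "mul g" "?D p"] mul_derivative_at[of g p] by simp
    moreover have "(\<lambda>x. mul g (mul p x)) = mul (mul g p)" by (simp add: mul_assoc fun_eq_iff)
    ultimately have "(mul (mul g p) has_derivative (\<lambda>v. ?D p (LT p v))) (at 0)" by simp
    then have "(\<lambda>v. ?D p (LT p v)) = LT (mul g p)" by (rule frechet_derivative_at)
    then show ?thesis by (metis scaleR_one)
  qed
  from horizontal_curve_image[OF mul_derivative_at continuous_mul_derivative this c(3)] show ?thesis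
    unfolding joined_def by (intro exI[of _ "\<lambda>t. mul g (\<gamma> t)"] exI[of _ "\<lambda>t. 1 *\<^sub>R u t"]) (simp add: c)
qed

lemma joined_dil:
  assumes "s > 0" "joined x y L"
  shows "joined (dil s x) (dil s y) (s * L)"
proof -
  obtain \<gamma> u where c: "\<gamma> 0 = x" "\<gamma> 1 = y" "horizontal_curve (V 1) mul \<gamma> u L"
    using assms(2) unfolding joined_def by blast
  have der: "(dil s has_derivative dil s) (at x)" for x
    by (rule linear_imp_has_derivative[OF linear_dil])
  have "dil s (LT p v) = LT (dil s p) (s *\<^sub>R v)" if "v \<in> V 1" for p v
  proof -
    have "((\<lambda>x. dil s (mul p x)) has_derivative (\<lambda>v. dil s (LT p v))) (at 0)"
      by (rule has_derivative_compose[OF mul_has_derivative der])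
    moreover have "((\<lambda>x. mul (dil s p) (dil s x)) has_derivative (\<lambda>v. LT (dil s p) (dil s v))) (at 0)"
      by (rule has_derivative_compose[OF der]) (simp add: mul_has_derivative)
    ultimately have "(\<lambda>v. dil s (LT p v)) = (\<lambda>v. LT (dil s p) (dil s v))"
      unfolding dil_mul by (rule has_derivative_unique)
    then show ?thesis using dil_layer[OF that, of s] by (metis power_one_right)
  qed
  from horizontal_curve_image[OF der continuous_on_const this c(3)] show ?thesis
    unfolding joined_def using assms(1)
    by (intro exI[of _ "\<lambda>t. dil s (\<gamma> t)"] exI[of _ "\<lambda>t. s *\<^sub>R u t"]) (simp add: c)
qed

lemma joined_line:
  assumes "e \<in> V 1"
  shows "joined y (mul y (s *\<^sub>R e)) (\<bar>s\<bar> * norm e)"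
proof -
  have "horizontal_curve (V 1) mul (\<lambda>t. (t * s) *\<^sub>R e) (\<lambda>t. s *\<^sub>R e) (\<bar>s\<bar> * norm e)"
    unfolding horizontal_curve_def
  proof (intro conjI exI[of _ "{}"] ballI)
    have der: "((\<lambda>t. (t * s) *\<^sub>R e) has_vector_derivative s *\<^sub>R e) (at t)" for t
      by (auto intro!: derivative_eq_intros)
    have "(\<lambda>t. (t * s) *\<^sub>R e) C1_differentiable_on {0..1}"
      unfolding C1_differentiable_on_def by (rule exI[of _ "\<lambda>t. s *\<^sub>R e"]) (use der in auto)
    then show "(\<lambda>t. (t * s) *\<^sub>R e) piecewise_C1_differentiable_on {0..1}"
      by (rule C1_differentiable_imp_piecewise)
    fix t
    show "s *\<^sub>R e \<in> V 1" using assms by (rule subspace_scale[OF subspace_layer])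
    have "((\<lambda>h. h *\<^sub>R e) has_derivative (\<lambda>h. h *\<^sub>R e)) (at 0)"
      by (auto intro!: derivative_eq_intros)
    from has_derivative_compose[OF this, of "mul ((t * s) *\<^sub>R e)" "LT ((t * s) *\<^sub>R e)"]
    have "((\<lambda>h. mul ((t * s) *\<^sub>R e) (h *\<^sub>R e)) has_derivative (\<lambda>h. LT ((t * s) *\<^sub>R e) (h *\<^sub>R e))) (at 0)"
      by (simp add: mul_has_derivative)
    moreover have "((\<lambda>h. (t * s + h) *\<^sub>R e) has_derivative (\<lambda>h. h *\<^sub>R e)) (at 0)"
      by (auto intro!: derivative_eq_intros)
    ultimately have "(\<lambda>h. LT ((t * s) *\<^sub>R e) (h *\<^sub>R e)) = (\<lambda>h. h *\<^sub>R e)"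
      unfolding mul_collinear by (rule has_derivative_unique)
    then have "LT ((t * s) *\<^sub>R e) (s *\<^sub>R e) = s *\<^sub>R e" by metis
    then show "((\<lambda>t. (t * s) *\<^sub>R e) has_vector_derivative LT ((t * s) *\<^sub>R e) (s *\<^sub>R e)) (at t)"
      using der by simp
  next
    show "((\<lambda>t::real. norm (s *\<^sub>R e)) has_integral \<bar>s\<bar> * norm e) {0..1}"
      using has_integral_const_real[of "norm (s *\<^sub>R e)" "0::real" 1] by simp
  qed simp
  then have "joined 0 (s *\<^sub>R e) (\<bar>s\<bar> * norm e)"
    unfolding joined_def by (intro exI[of _ "\<lambda>t. (t * s) *\<^sub>R e"] exI[of _ "\<lambda>t. s *\<^sub>R e"]) simp
  from joined_left[OF this, of y] show ?thesis by simp
qed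

lemma joined_sym: "joined x y L \<Longrightarrow> joined y x L"
proof -
  assume "joined x y L"
  then obtain \<gamma> u where c: "\<gamma> 0 = x" "\<gamma> 1 = y" "horizontal_curve (V 1) mul \<gamma> u L"
    unfolding joined_def by blast
  then obtain N where N: "finite N" "\<And>t. t \<in> {0..1} - N \<Longrightarrow> u t \<in> V 1 \<and>
        (\<gamma> has_vector_derivative LT (\<gamma> t) (u t)) (at t)"
    and pw: "\<gamma> piecewise_C1_differentiable_on {0..1}" and int: "((\<lambda>t. norm (u t)) has_integral L) {0..1}"
    unfolding horizontal_curve_def by blast
  have "horizontal_curve (V 1) mul (\<lambda>t. \<gamma> (1 - t)) (\<lambda>t. - u (1 - t)) L"
    unfolding horizontal_curve_def
  proof (intro conjI exI[of _ "(\<lambda>t. 1 - t) ` N"] ballI)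
    show "(\<lambda>t. \<gamma> (1 - t)) piecewise_C1_differentiable_on {0..1}"
      using valid_path_imp_reverse[unfolded valid_path_def, OF pw] by (simp add: reversepath_def[abs_def])
    show "finite ((\<lambda>t. 1 - t) ` N)" using N(1) by simp
    fix t assume "t \<in> {0..1} - (\<lambda>t. 1 - t) ` N"
    then have t: "1 - t \<in> {0..1} - N"
      by (auto intro: image_eqI[of t _ "1 - t"])
    then show "- u (1 - t) \<in> V 1" using N(2) subspace_neg[OF subspace_layer] by blast
    have "((\<lambda>t. 1 - t) has_vector_derivative - 1) (at t)" by (auto intro!: derivative_eq_intros)
    then have "((\<lambda>t. 1 - t) has_field_derivative - 1) (at t)"
      by (simp add: has_real_derivative_iff_has_vector_derivative)
    from vector_diff_chain_at[OF this[unfolded has_real_derivative_iff_has_vector_derivative] conjunct2[OF N(2)[OF t]]]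
    show "((\<lambda>t. \<gamma> (1 - t)) has_vector_derivative LT (\<gamma> (1 - t)) (- u (1 - t))) (at t)"
      by (simp add: o_def linear_neg[OF linear_LT])
  next
    have "((\<lambda>t. norm (u (- t + 1))) has_integral L) ((\<lambda>x. 1 - x) ` {0..1})"
      using has_integral_affinity01[OF int, of "-1" 1] by simp
    moreover have "(\<lambda>x. 1 - x) ` {0..1} = {0..1::real}" by (auto intro: image_eqI[of _ _ "1 - _"])
    ultimately show "((\<lambda>t. norm (- u (1 - t))) has_integral L) {0..1}" by simp
  qed
  then show ?thesis unfolding joined_def
    by (intro exI[of _ "\<lambda>t. \<gamma> (1 - t)"] exI[of _ "\<lambda>t. - u (1 - t)"]) (simp add: c)
qed

lemma joined_trans:
  assumes "joined x y L" "joined y z M"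
  shows "joined x z (L + M)"
proof -
  obtain \<gamma> u where c: "\<gamma> 0 = x" "\<gamma> 1 = y" "horizontal_curve (V 1) mul \<gamma> u L"
    using assms(1) unfolding joined_def by blast
  then obtain N where N: "finite N" "\<And>t. t \<in> {0..1} - N \<Longrightarrow> u t \<in> V 1 \<and>
        (\<gamma> has_vector_derivative LT (\<gamma> t) (u t)) (at t)"
    and pw: "\<gamma> piecewise_C1_differentiable_on {0..1}" and int: "((\<lambda>t. norm (u t)) has_integral L) {0..1}"
    unfolding horizontal_curve_def by blast
  obtain \<delta> v where c': "\<delta> 0 = y" "\<delta> 1 = z" "horizontal_curve (V 1) mul \<delta> v M"
    using assms(2) unfolding joined_def by blast
  then obtain N' where N': "finite N'" "\<And>t. t \<in> {0..1} - N' \<Longrightarrow> v t \<in> V 1 \<and>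
        (\<delta> has_vector_derivative LT (\<delta> t) (v t)) (at t)"
    and pw': "\<delta> piecewise_C1_differentiable_on {0..1}" and int': "((\<lambda>t. norm (v t)) has_integral M) {0..1}"
    unfolding horizontal_curve_def by blast
  define w where "w t = (if t \<le> 1 / 2 then 2 *\<^sub>R u (2 * t) else 2 *\<^sub>R v (2 * t - 1))" for t
  define P where "P = insert (1 / 2) ((\<lambda>t. t / 2) ` N \<union> (\<lambda>t. (t + 1) / 2) ` N')"
  have "horizontal_curve (V 1) mul (\<gamma> +++ \<delta>) w (L + M)"
    unfolding horizontal_curve_def
  proof (intro conjI exI[of _ P] ballI)
    have "valid_path (\<gamma> +++ \<delta>)"
      using pw pw' c c' by (intro valid_path_join) (auto simp: valid_path_def pathfinish_def pathstart_def)
    then show "(\<gamma> +++ \<delta>) piecewise_C1_differentiable_on {0..1}" by (simp add: valid_path_def)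
    show "finite P" unfolding P_def using N(1) N'(1) by simp
    fix t assume t: "t \<in> {0..1} - P"
    then consider "t < 1 / 2" | "t > 1 / 2" unfolding P_def by fastforce
    then have "w t \<in> V 1 \<and> ((\<gamma> +++ \<delta>) has_vector_derivative LT ((\<gamma> +++ \<delta>) t) (w t)) (at t)"
    proof cases
      case 1
      have "2 * t \<notin> N"
      proof
        assume "2 * t \<in> N"
        from imageI[OF this, of "\<lambda>t. t / 2"] show False using t by (simp add: P_def)
      qed
      then have t2: "2 * t \<in> {0..1} - N" using t 1 by auto
      have "((\<lambda>t. 2 * t) has_vector_derivative 2) (at t)" by (auto intro!: derivative_eq_intros)
      from vector_diff_chain_at[OF this conjunct2[OF N(2)[OF t2]]]
      have "((\<lambda>t. \<gamma> (2 * t)) has_vector_derivative 2 *\<^sub>R LT (\<gamma> (2 * t)) (u (2 * t))) (at t)"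
        by (simp add: o_def)
      then have "((\<gamma> +++ \<delta>) has_vector_derivative 2 *\<^sub>R LT (\<gamma> (2 * t)) (u (2 * t))) (at t)"
        by (rule has_vector_derivative_transform_within_open[where S = "{..<1/2}"]) (use 1 in \<open>auto simp: joinpaths_def\<close>)
      then show ?thesis
        using 1 N(2)[OF t2] by (auto simp: w_def joinpaths_def linear_scale[OF linear_LT] intro: subspace_scale[OF subspace_layer])
    next
      case 2
      have "2 * t - 1 \<notin> N'"
      proof
        assume "2 * t - 1 \<in> N'"
        from imageI[OF this, of "\<lambda>t. (t + 1) / 2"] show False using t by (simp add: P_def)
      qed
      then have t2: "2 * t - 1 \<in> {0..1} - N'" using t 2 by auto
      have "((\<lambda>t. 2 * t - 1) has_vector_derivative 2) (at t)" by (auto intro!: derivative_eq_intros)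
      from vector_diff_chain_at[OF this conjunct2[OF N'(2)[OF t2]]]
      have "((\<lambda>t. \<delta> (2 * t - 1)) has_vector_derivative 2 *\<^sub>R LT (\<delta> (2 * t - 1)) (v (2 * t - 1))) (at t)"
        by (simp add: o_def)
      then have "((\<gamma> +++ \<delta>) has_vector_derivative 2 *\<^sub>R LT (\<delta> (2 * t - 1)) (v (2 * t - 1))) (at t)"
        by (rule has_vector_derivative_transform_within_open[where S = "{1/2<..}"]) (use 2 in \<open>auto simp: joinpaths_def\<close>)
      then show ?thesis
        using 2 N'(2)[OF t2] by (auto simp: w_def joinpaths_def linear_scale[OF linear_LT] intro: subspace_scale[OF subspace_layer])
    qed
    then show "w t \<in> V 1" "((\<gamma> +++ \<delta>) has_vector_derivative LT ((\<gamma> +++ \<delta>) t) (w t)) (at t)" by auto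
  next
    have "((\<lambda>t. norm (u (2 *\<^sub>R t + 0))) has_integral L /\<^sub>R 2 ^ DIM(real)) (cbox ((0 - 0) /\<^sub>R 2) ((1 - 0) /\<^sub>R 2))"
      by (rule has_integral_affinity') (use int in auto)
    from has_integral_mult_right[OF this, of 2]
    have "((\<lambda>t. 2 * norm (u (2 * t))) has_integral L) {0..1/2}" by simp
    then have 1: "((\<lambda>t. norm (w t)) has_integral L) {0..1/2}"
      by (rule has_integral_eq[rotated]) (simp add: w_def)
    have "((\<lambda>t. norm (v (2 *\<^sub>R t + - 1))) has_integral M /\<^sub>R 2 ^ DIM(real)) (cbox ((0 - - 1) /\<^sub>R 2) ((1 - - 1) /\<^sub>R 2))"
      by (rule has_integral_affinity') (use int' in auto)
    from has_integral_mult_right[OF this, of 2]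
    have "((\<lambda>t. 2 * norm (v (2 * t - 1))) has_integral M) {1/2..1}" by simp
    then have 2: "((\<lambda>t. norm (w t)) has_integral M) {1/2..1}"
      by (rule has_integral_spike_finite[of "{1/2}", rotated 2]) (auto simp: w_def)
    show "((\<lambda>t. norm (w t)) has_integral (L + M)) {0..1}"
      by (rule has_integral_combine[OF _ _ 1 2]) auto
  qed
  moreover have "(\<gamma> +++ \<delta>) 0 = x" "(\<gamma> +++ \<delta>) 1 = z" using c c' by (auto simp: joinpaths_def)
  ultimately show ?thesis unfolding joined_def by blast
qed

lemma joined_nonneg: "joined x y L \<Longrightarrow> L \<ge> 0"
  unfolding joined_def horizontal_curve_def by (auto intro: has_integral_nonneg)

lemma joined_hprod:
  "set ps \<subseteq> {-C..C} \<times> E \<Longrightarrow> \<exists>L::real. L \<le> real (length ps) * C \<and> joined 0 (hprod ps) L"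
proof (induction ps)
  case Nil
  have "joined 0 0 0" using joined_line[OF subspace_0[OF subspace_layer], of 0 0] by simp
  then show ?case by auto
next
  case (Cons p ps)
  obtain s e where p: "p = (s, e)" by (cases p)
  then have e: "e \<in> E" "\<bar>s\<bar> \<le> C" using Cons.prems by auto
  obtain L where L: "L \<le> real (length ps) * C" "joined 0 (hprod ps) L" using Cons by auto
  have "joined 0 (s *\<^sub>R e) \<bar>s\<bar>" using joined_line[OF E_layer[OF e(1)], of 0 s] norm_E[OF e(1)] by simp
  from joined_trans[OF this joined_left[OF L(2), of "s *\<^sub>R e", simplified]]
  have "joined 0 (hprod (p # ps)) (\<bar>s\<bar> + L)" by (simp add: p hprod_Cons)
  moreover have "\<bar>s\<bar> + L \<le> real (length (p # ps)) * C" using L(1) e(2) by (simp add: algebra_simps)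
  ultimately show ?case by blast
qed

lemma joined_exists: "\<exists>L. joined x y L"
proof -
  have "reachable {w. norm w \<le> norm (mul (- x) y)}" by (rule bounded_imp_reachable)
  then obtain N C where "mul (- x) y \<in> reach N C" unfolding reachable_def by blast
  then obtain ps where "mul (- x) y = hprod ps" "set ps \<subseteq> {-C..C} \<times> E" unfolding reach_iff by blast
  then obtain L where "joined 0 (mul (- x) y) L" using joined_hprod by metis
  from joined_left[OF this, of x] show ?thesis by auto
qed

text \<open>The left-invariant frame is bounded on the Euclidean unit ball. At the first time when a curve from
  the identity leaves this ball, its Euclidean displacement is one and is at most a constant
  times the length.\<close>

lemma joined_small: "\<exists>c>0. \<forall>x L. joined 0 x L \<longrightarrow> L < c \<longrightarrow> norm x \<le> 1"
proof -
  obtain C where C: "C > 0" "\<And>p v. norm p \<le> 1 \<Longrightarrow> norm (LT p v) \<le> C * norm v"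
    using LT_bounded[of 1] by blast
  have "norm x \<le> 1" if joined: "joined 0 x L" and L: "L < 1 / C" for x L
  proof (rule ccontr)
    assume x: "\<not> norm x \<le> 1"
    obtain \<gamma> u where c: "\<gamma> 0 = 0" "\<gamma> 1 = x" "horizontal_curve (V 1) mul \<gamma> u L"
      using joined unfolding joined_def by blast
    then obtain N where N: "finite N" "\<And>t. t \<in> {0..1} - N \<Longrightarrow> u t \<in> V 1 \<and>
          (\<gamma> has_vector_derivative LT (\<gamma> t) (u t)) (at t)"
      and pw: "\<gamma> piecewise_C1_differentiable_on {0..1}" and int: "((\<lambda>t. norm (u t)) has_integral L) {0..1}"
      unfolding horizontal_curve_def by blast
    have cont: "continuous_on {0..1} \<gamma>" using pw by (simp add: piecewise_C1_differentiable_on_def)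
    define T where "T = {t \<in> {0..1}. norm (\<gamma> t) \<in> {1..}}"
    have "T = {0..1} \<inter> (\<lambda>t. norm (\<gamma> t)) -` {1..}" by (auto simp: T_def)
    then have "closed T"
      using continuous_closed_preimage[OF continuous_on_norm[OF cont], of "{1..}"] by simp
    moreover have "bounded T"
      unfolding T_def by (rule bounded_subset[OF bounded_closed_interval[of 0 1]]) auto
    ultimately have cpt: "compact T" by (simp add: compact_eq_bounded_closed)
    have "1 \<in> T" using c(2) x by (simp add: T_def)
    then obtain t where t: "t \<in> T" "\<And>s. s \<in> T \<Longrightarrow> t \<le> s"
      using compact_attains_inf[OF cpt] by blast
    then have t01: "0 \<le> t" "t \<le> 1" "norm (\<gamma> t) \<ge> 1" by (auto simp: T_def)
    have small: "norm (\<gamma> s) \<le> 1" if "0 \<le> s" "s < t" for s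
      using t(2)[of s] that t01 by (force simp: T_def)
    \<comment> \<open>The derivative is set to 0 at the exceptional parameters, so that the bound by the speed holds
      everywhere; at \<open>t\<close> itself the norm of \<open>\<gamma>\<close> is only known to be at least 1.\<close>
    define f where "f s = (if s \<in> insert t N then 0 else LT (\<gamma> s) (u s))" for s
    have "(f has_integral (\<gamma> t - \<gamma> 0)) {0..t}"
    proof (rule fundamental_theorem_of_calculus_interior_strong[of "insert t N"])
      fix s assume "s \<in> {0<..<t} - insert t N"
      then show "(\<gamma> has_vector_derivative f s) (at s)" using N(2)[of s] t01 by (auto simp: f_def)
    qed (use N(1) t01 continuous_on_subset[OF cont, of "{0..t}"] in auto)
    then have fint: "f integrable_on {0..t}" and feq: "integral {0..t} f = \<gamma> t"
      using c(1) by (auto simp: integrable_on_def integral_unique)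
    have uint: "(\<lambda>s. norm (u s)) integrable_on {0..1}" using int by (rule has_integral_integrable)
    have uint': "(\<lambda>s. norm (u s)) integrable_on {0..t}"
      using uint t01 by (intro integrable_subinterval_real[OF uint]) auto
    have "norm (integral {0..t} f) \<le> integral {0..t} (\<lambda>s. C * norm (u s))"
    proof (rule integral_norm_bound_integral[OF fint])
      show "(\<lambda>s. C * norm (u s)) integrable_on {0..t}" using integrable_on_cmult_left[OF uint'] by simp
      fix s assume "s \<in> {0..t}"
      then show "norm (f s) \<le> C * norm (u s)"
        using C small[of s] by (auto simp: f_def)
    qed
    also have "\<dots> = C * integral {0..t} (\<lambda>s. norm (u s))" by simp
    also have "\<dots> \<le> C * integral {0..1} (\<lambda>s. norm (u s))"
      using C(1) t01 by (intro mult_left_mono integral_subset_le[OF _ uint' uint]) auto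
    also have "\<dots> = C * L" using int by (simp add: integral_unique)
    also have "\<dots> < 1" using L C(1) by (simp add: field_simps)
    finally show False using feq t01(3) by simp
  qed
  then show ?thesis using C(1) by (intro exI[of _ "1 / C"]) auto
qed

end

section \<open>The Carnot-Caratheodory distance\<close>

context carnot_group
begin

definition d :: "'a \<Rightarrow> 'a \<Rightarrow> real" where
  "d = cc_dist (V 1) mul"

lemma d_eq_Inf: "d x y = Inf {L. joined x y L}"
  by (simp add: d_def cc_dist_def joined_def)

lemma d_le_conn: "joined x y L \<Longrightarrow> d x y \<le> L"
  unfolding d_eq_Inf by (rule cInf_lower) (auto intro!: bdd_belowI[of _ 0] joined_nonneg)

lemma joined_less: "d x y < c \<Longrightarrow> \<exists>L<c. joined x y L"
  unfolding d_eq_Inf using joined_exists[of x y] cInf_lessD[of "{L. joined x y L}" c] by auto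

lemma d_nonneg: "0 \<le> d x y"
  unfolding d_eq_Inf using joined_exists[of x y] by (intro cInf_greatest) (auto intro: joined_nonneg)

lemma d_left: "d (mul g x) (mul g y) = d x y"
proof -
  have "joined (mul g x) (mul g y) L \<longleftrightarrow> joined x y L" for L
    using joined_left[of x y L g] joined_left[of "mul g x" "mul g y" L "- g"] by auto
  then show ?thesis by (simp add: d_eq_Inf)
qed

lemma d_sym: "d x y = d y x"
proof -
  have "joined x y L \<longleftrightarrow> joined y x L" for L using joined_sym by blast
  then show ?thesis by (simp add: d_eq_Inf)
qed

lemma d_triangle: "d x z \<le> d x y + d y z"
proof (rule field_le_epsilon)
  fix e :: real assume "e > 0"
  then obtain L M where "L < d x y + e / 2" "joined x y L" "M < d y z + e / 2" "joined y z M"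
    using joined_less[of x y "d x y + e / 2"] joined_less[of y z "d y z + e / 2"] by auto
  then show "d x z \<le> d x y + d y z + e"
    using d_le_conn[OF joined_trans[of x y L z M]] by linarith
qed

lemma d_line: "e \<in> E \<Longrightarrow> d y (mul y (s *\<^sub>R e)) \<le> \<bar>s\<bar>"
  using d_le_conn[OF joined_line[OF E_layer, of e y s]] norm_E[of e] by simp

lemma d_self [simp]: "d x x = 0"
  using d_le_conn[OF joined_line[OF subspace_0[OF subspace_layer], of x 0]] d_nonneg[of x x] by simp

lemma d_dil_le: "s > 0 \<Longrightarrow> d (dil s x) (dil s y) \<le> s * d x y"
proof (rule field_le_epsilon)
  fix e :: real assume "e > 0" "s > 0"
  then obtain L where "L < d x y + e / s" "joined x y L"
    using joined_less[of x y "d x y + e / s"] by auto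
  moreover from this have "s * L \<le> s * (d x y + e / s)" using \<open>s > 0\<close> by (intro mult_left_mono) auto
  ultimately show "d (dil s x) (dil s y) \<le> s * d x y + e"
    using d_le_conn[OF joined_dil[of s x y L]] \<open>s > 0\<close> by (simp add: distrib_left)
qed

lemma d_dil: "s > 0 \<Longrightarrow> d (dil s x) (dil s y) = s * d x y"
proof (rule antisym)
  assume s: "s > 0"
  have "d x y \<le> inverse s * d (dil s x) (dil s y)"
    using d_dil_le[of "inverse s" "dil s x" "dil s y"] s by simp
  then show "s * d x y \<le> d (dil s x) (dil s y)" using s by (simp add: field_simps)
qed (rule d_dil_le)

lemma d_dil_0: "s > 0 \<Longrightarrow> d 0 (dil s x) = s * d 0 x"
  using d_dil[of s 0 x] by simp

lemma d_unit_ball: "\<exists>c>0. \<forall>x. d 0 x < c \<longrightarrow> norm x \<le> 1"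
  using joined_small joined_less by blast

lemma d_bounded: "\<exists>C>0. \<forall>x. norm x \<le> B \<longrightarrow> d 0 x \<le> C"
proof -
  obtain N C where NC: "{x. norm x \<le> B} \<subseteq> reach N C"
    using bounded_imp_reachable unfolding reachable_def by blast
  have "d 0 x \<le> real N * \<bar>C\<bar> + 1" if x: "norm x \<le> B" for x
  proof -
    have "x \<in> reach N C" using NC x by auto
    then obtain ps where ps: "x = hprod ps" "length ps \<le> N" "set ps \<subseteq> {-C..C} \<times> E" unfolding reach_iff by blast
    obtain L where L: "L \<le> real (length ps) * C" "joined 0 x L" using joined_hprod[OF ps(3)] ps(1) by auto
    have "real (length ps) * C \<le> real (length ps) * \<bar>C\<bar>" by (intro mult_left_mono) auto
    also have "\<dots> \<le> real N * \<bar>C\<bar>" using ps(2) by (intro mult_right_mono) auto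
    finally have "real (length ps) * C \<le> real N * \<bar>C\<bar>" .
    then show ?thesis using d_le_conn[OF L(2)] L(1) by linarith
  qed
  moreover have "real N * \<bar>C\<bar> + 1 > 0" by (simp add: add_nonneg_pos)
  ultimately show ?thesis by blast
qed

text \<open>The quantitative form of Chow's theorem: a dilation takes a ball of radius \<open>\<rho>\<close> into the Euclidean
  unit ball, where reachability applies, and the factors are scaled back linearly because they
  lie in the first layer.\<close>

lemma horizontal_factorization:
  "\<exists>M::nat. \<exists>C>0. \<forall>x \<rho>. 0 < \<rho> \<longrightarrow> d 0 x \<le> \<rho> \<longrightarrow>
     (\<exists>ps. x = hprod ps \<and> length ps \<le> M \<and> set ps \<subseteq> {-(C * \<rho>)..C * \<rho>} \<times> E)"
proof -
  obtain c where c: "c > 0" "\<And>x. d 0 x < c \<Longrightarrow> norm x \<le> 1" using d_unit_ball by blast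
  obtain M C where MC: "{x. norm x \<le> 1} \<subseteq> reach M C"
    using bounded_imp_reachable unfolding reachable_def by blast
  define C' where "C' = 2 * (\<bar>C\<bar> + 1) / c"
  have "\<exists>ps. x = hprod ps \<and> length ps \<le> M \<and> set ps \<subseteq> {-(C' * \<rho>)..C' * \<rho>} \<times> E"
    if \<rho>: "0 < \<rho>" "d 0 x \<le> \<rho>" for x \<rho>
  proof -
    \<comment> \<open>Half of the critical radius, because the hypothesis on \<open>x\<close> is not strict.\<close>
    define s where "s = c / (2 * \<rho>)"
    have s: "s > 0" using c(1) \<rho>(1) by (simp add: s_def)
    have "s * d 0 x \<le> s * \<rho>" using s \<rho>(2) by simp
    also have "\<dots> < c" using c(1) \<rho>(1) by (simp add: s_def)
    finally have "dil s x \<in> reach M C" using c(2) MC d_dil_0[OF s] by force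
    then obtain ps where ps: "dil s x = hprod ps" "length ps \<le> M" "set ps \<subseteq> {-C..C} \<times> E"
      unfolding reach_iff by blast
    let ?qs = "map (\<lambda>(t, e). (inverse s * t, e)) ps"
    have "x = dil (inverse s) (dil s x)" using s by simp
    also have "\<dots> = hprod ?qs" unfolding ps(1) by (rule dil_hprod) (use ps(3) in auto)
    finally have 1: "x = hprod ?qs" .
    have "inverse s * \<bar>t\<bar> \<le> C' * \<rho>" if "\<bar>t\<bar> \<le> C" for t
    proof -
      have "inverse s * \<bar>t\<bar> \<le> inverse s * (\<bar>C\<bar> + 1)" using that s by (intro mult_left_mono) auto
      also have "\<dots> = C' * \<rho>" by (simp add: s_def C'_def)
      finally show ?thesis .
    qed
    then have bd: "\<bar>inverse s * t\<bar> \<le> C' * \<rho>" if "\<bar>t\<bar> \<le> C" for t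
      using s that by (simp add: abs_mult)
    have "(inverse s * t, e) \<in> {-(C' * \<rho>)..C' * \<rho>} \<times> E" if "(t, e) \<in> set ps" for t e
    proof -
      have "\<bar>t\<bar> \<le> C" "e \<in> E" using subsetD[OF ps(3) that] by auto
      then show ?thesis using bd[of t] by (auto simp: abs_le_iff)
    qed
    then have "set ?qs \<subseteq> {-(C' * \<rho>)..C' * \<rho>} \<times> E" by auto
    then show ?thesis using 1 ps(2) by (intro exI[of _ ?qs]) auto
  qed
  moreover have "C' > 0" using c(1) by (simp add: C'_def add_nonneg_pos)
  ultimately show ?thesis by blast
qed

lemma norm_dil_le: "\<exists>K>0. \<forall>s x. 0 \<le> s \<longrightarrow> norm (dil s x) \<le> K * max s (s ^ r) * norm x"
proof -
  have "\<exists>K>0. \<forall>x. norm (pr j x) \<le> K * norm x" for j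
    using linear_bounded_pos[OF linear_pr] by blast
  then obtain K where K: "\<And>j. K j > 0" "\<And>j x. norm (pr j x) \<le> K j * norm x" by metis
  have "norm (dil s x) \<le> ((\<Sum>j = 1..r. K j) + 1) * max s (s ^ r) * norm x" if s: "0 \<le> s" for s x
  proof -
    have "norm (dil s x) \<le> (\<Sum>j = 1..r. norm (s ^ j *\<^sub>R pr j x))" unfolding dil_def by (rule norm_sum)
    also have "\<dots> \<le> (\<Sum>j = 1..r. max s (s ^ r) * (K j * norm x))"
    proof (rule sum_mono)
      fix j assume j: "j \<in> {1..r}"
      have "s ^ j \<le> max s (s ^ r)"
      proof (cases "s \<le> 1")
        case True
        then have "s ^ j \<le> s ^ 1" using j s by (intro power_decreasing) auto
        then show ?thesis by simp
      next
        case False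
        then have "s ^ j \<le> s ^ r" using j by (intro power_increasing) auto
        then show ?thesis by simp
      qed
      then show "norm (s ^ j *\<^sub>R pr j x) \<le> max s (s ^ r) * (K j * norm x)"
        using K(2)[of j x] s by (auto intro!: mult_mono)
    qed
    also have "\<dots> = (\<Sum>j = 1..r. K j) * (max s (s ^ r) * norm x)"
      by (simp add: sum_distrib_right sum_distrib_left algebra_simps)
    also have "\<dots> \<le> ((\<Sum>j = 1..r. K j) + 1) * (max s (s ^ r) * norm x)"
      using s by (intro mult_right_mono mult_nonneg_nonneg) auto
    finally show ?thesis by (simp add: mult.assoc)
  qed
  moreover have "(\<Sum>j = 1..r. K j) + 1 > 0"
    using K(1) by (intro add_nonneg_pos sum_nonneg) (auto intro: less_imp_le)
  ultimately show ?thesis by blast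
qed

lemma root_power_r: "0 < \<eta> \<Longrightarrow> (\<eta> powr (1 / real r)) ^ r = \<eta>"
  using step_pos by (simp add: powr_realpow[symmetric] powr_powr)

text \<open>The dilation by \<open>\<eta>\<close> to the power \<open>-1 / r\<close> expands every layer by at most the factor \<open>1 / \<eta>\<close>; it brings
  \<open>x\<close> to a bounded set while multiplying \<open>d 0 x\<close> by a known factor.\<close>

lemma d_holder: "\<exists>A>0. \<forall>x \<eta>. 0 < \<eta> \<longrightarrow> \<eta> \<le> 1 \<longrightarrow> norm x \<le> B * \<eta> \<longrightarrow> d 0 x \<le> A * \<eta> powr (1 / real r)"
proof -
  obtain K where K: "K > 0" "\<And>s x. 0 \<le> s \<Longrightarrow> norm (dil s x) \<le> K * max s (s ^ r) * norm x"
    using norm_dil_le by blast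
  obtain A where A: "A > 0" "\<And>x. norm x \<le> K * B \<Longrightarrow> d 0 x \<le> A" using d_bounded by blast
  have "d 0 x \<le> A * \<eta> powr (1 / real r)" if \<eta>: "0 < \<eta>" "\<eta> \<le> 1" "norm x \<le> B * \<eta>" for x \<eta>
  proof -
    define l where "l = \<eta> powr (1 / real r)"
    have l: "l > 0" "l \<le> 1" "l ^ r = \<eta>"
      using \<eta> root_power_r powr_le1[of "1 / real r" \<eta>] by (auto simp: l_def)
    have "1 \<le> inverse l" using l by (simp add: one_le_inverse)
    then have "inverse l ^ 1 \<le> inverse l ^ r" using step_pos by (intro power_increasing) auto
    then have max: "max (inverse l) (inverse l ^ r) = inverse \<eta>"
      using l(3) by (simp add: power_inverse max_def)
    have "norm (dil (inverse l) x) \<le> K * inverse \<eta> * norm x"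
      using K(2)[of "inverse l" x] l(1) max by simp
    also have "\<dots> \<le> K * inverse \<eta> * (B * \<eta>)"
      using K(1) \<eta> by (intro mult_left_mono) auto
    also have "\<dots> = K * B" using \<eta> by simp
    finally have "d 0 (dil (inverse l) x) \<le> A" by (rule A(2))
    then have "inverse l * d 0 x \<le> A" using d_dil_0[of "inverse l" x] l(1) by simp
    then show ?thesis using l(1) by (simp add: field_simps flip: l_def)
  qed
  then show ?thesis using A(1) by blast
qed

lemma norm_le_d: "\<exists>A>0. \<forall>x \<eta>. 0 < \<eta> \<longrightarrow> \<eta> \<le> 1 \<longrightarrow> d 0 x \<le> \<eta> \<longrightarrow> norm x \<le> A * \<eta>"
proof -
  obtain K where K: "K > 0" "\<And>s x. 0 \<le> s \<Longrightarrow> norm (dil s x) \<le> K * max s (s ^ r) * norm x"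
    using norm_dil_le by blast
  obtain c where c: "c > 0" "\<And>x. d 0 x < c \<Longrightarrow> norm x \<le> 1" using d_unit_ball by blast
  define A where "A = K * max (2 / c) ((2 / c) ^ r)"
  have "norm x \<le> A * \<eta>" if \<eta>: "0 < \<eta>" "\<eta> \<le> 1" "d 0 x \<le> \<eta>" for x \<eta>
  proof -
    define s where "s = 2 / c * \<eta>"
    have s: "s > 0" using c(1) \<eta>(1) by (simp add: s_def)
    have "d 0 (dil (inverse s) x) = inverse s * d 0 x" using d_dil_0 s by simp
    also have "\<dots> \<le> inverse s * \<eta>" using \<eta> s by simp
    also have "\<dots> < c" using c(1) \<eta>(1) by (simp add: s_def)
    finally have n: "norm (dil (inverse s) x) \<le> 1" by (rule c(2))
    have "s ^ r \<le> (2 / c) ^ r * \<eta>"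
    proof -
      have "\<eta> ^ r \<le> \<eta> ^ 1" using \<eta> step_pos by (intro power_decreasing) auto
      then show ?thesis unfolding s_def power_mult_distrib using c(1) by (intro mult_left_mono) auto
    qed
    also have "\<dots> \<le> max (2 / c) ((2 / c) ^ r) * \<eta>" using \<eta>(1) by (intro mult_right_mono) auto
    finally have "s ^ r \<le> max (2 / c) ((2 / c) ^ r) * \<eta>" .
    moreover have "s \<le> max (2 / c) ((2 / c) ^ r) * \<eta>"
      unfolding s_def using \<eta>(1) by (intro mult_right_mono) auto
    ultimately have 1: "max s (s ^ r) \<le> max (2 / c) ((2 / c) ^ r) * \<eta>" by simp
    have "norm x = norm (dil s (dil (inverse s) x))" using s by simp
    also have "\<dots> \<le> K * max s (s ^ r) * norm (dil (inverse s) x)" using s by (intro K(2)) simp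
    also have "\<dots> \<le> K * max s (s ^ r) * 1"
      using n K(1) s by (intro mult_left_mono) auto
    also have "\<dots> \<le> K * (max (2 / c) ((2 / c) ^ r) * \<eta>)" using 1 K(1) by simp
    finally show ?thesis by (simp add: A_def mult.assoc)
  qed
  moreover have "A > 0" unfolding A_def using K(1) c(1) by (simp add: less_max_iff_disj)
  ultimately show ?thesis by blast
qed

text \<open>A left-invariant distance controls right translations only through conjugations. For \<open>R = 1\<close> the
  conjugation by \<open>e\<close> is Lipschitz for the Euclidean norm, and returning from the Euclidean norm to
  the distance costs a root of order \<open>r\<close>. This loss is the origin of the radius \<open>\<epsilon> ^ r\<close> in the final
  estimate.\<close>

lemma d_right_translation:
  "\<exists>C\<ge>1. \<forall>e\<in>E. \<forall>R \<eta> x y. 0 < R \<longrightarrow> 0 < \<eta> \<longrightarrow> \<eta> \<le> 1 \<longrightarrow> d x y \<le> \<eta> * R \<longrightarrow>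
     d (mul x (R *\<^sub>R e)) (mul y (R *\<^sub>R e)) \<le> C * \<eta> powr (1 / real r) * R"
proof -
  obtain A where A: "A > 0" "\<And>x \<eta>. 0 < \<eta> \<Longrightarrow> \<eta> \<le> 1 \<Longrightarrow> d 0 x \<le> \<eta> \<Longrightarrow> norm x \<le> A * \<eta>"
    using norm_le_d by blast
  obtain B where B: "\<And>x y. norm x \<le> max A 1 \<Longrightarrow> norm y \<le> max A 1 \<Longrightarrow> norm (mul x y) \<le> B"
    using mul_bounded_on_bounded[of "max A 1"] by blast
  define B' where "B' = max B (max A 1)"
  obtain K where K: "K > 0" "\<And>x y x' y'. norm x \<le> B' \<Longrightarrow> norm y \<le> B' \<Longrightarrow> norm x' \<le> B' \<Longrightarrow> norm y' \<le> B' \<Longrightarrow>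
     norm (mul x y - mul x' y') \<le> K * (norm (x - x') + norm (y - y'))"
    using mul_lipschitz_on_bounded[of B'] by blast
  obtain D where D: "D > 0" "\<And>x \<eta>. 0 < \<eta> \<Longrightarrow> \<eta> \<le> 1 \<Longrightarrow> norm x \<le> K * (K * A) * \<eta> \<Longrightarrow> d 0 x \<le> D * \<eta> powr (1 / real r)"
    using d_holder by blast
  have unit: "d e (mul w e) \<le> D * \<eta> powr (1 / real r)"
    if e: "e \<in> E" and \<eta>: "0 < \<eta>" "\<eta> \<le> 1" and w: "d 0 w \<le> \<eta>" for e \<eta> w
  proof -
    have nw: "norm w \<le> A * \<eta>" using A(2) \<eta> w by blast
    also have "\<dots> \<le> A * 1" using A(1) \<eta> by (intro mult_left_mono) auto
    finally have nw': "norm w \<le> A" by simp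
    have ne: "norm e = 1" "norm (- e) = 1" using norm_E[OF e] by auto
    have 1: "norm (mul w e - mul 0 e) \<le> K * (norm (w - 0) + norm (e - e))"
      using nw' ne A(1) by (intro K(2)) (auto simp: B'_def)
    have "norm (mul w e) \<le> B" using nw' ne by (intro B) auto
    then have "norm (mul (- e) (mul w e) - mul (- e) e) \<le> K * (norm (- e - - e) + norm (mul w e - e))"
      using ne by (intro K(2)) (auto simp: B'_def)
    also have "\<dots> \<le> K * (K * norm w)"
      using 1 K(1) by simp
    also have "\<dots> \<le> K * (K * (A * \<eta>))" using nw K(1) by simp
    finally have "norm (mul (- e) (mul w e)) \<le> K * (K * A) * \<eta>" by (simp add: mult.assoc)
    then have "d 0 (mul (- e) (mul w e)) \<le> D * \<eta> powr (1 / real r)" by (rule D(2)[OF \<eta>])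
    then show ?thesis using d_left[of "- e" e "mul w e"] by simp
  qed
  have main: "d (mul x (R *\<^sub>R e)) (mul y (R *\<^sub>R e)) \<le> max D 1 * \<eta> powr (1 / real r) * R"
    if e: "e \<in> E" and R: "0 < R" and \<eta>: "0 < \<eta>" "\<eta> \<le> 1" and xy: "d x y \<le> \<eta> * R" for e R \<eta> x y
  proof -
    define w where "w = dil (inverse R) (mul (- x) y)"
    have w: "dil R w = mul (- x) y" using R by (simp add: w_def)
    have "d 0 w = inverse R * d 0 (mul (- x) y)" using d_dil_0[of "inverse R"] R by (simp add: w_def)
    also have "d 0 (mul (- x) y) = d x y" using d_left[of "- x" x y] by simp
    also have "inverse R * d x y \<le> \<eta>" using xy R by (simp add: field_simps)
    finally have "d e (mul w e) \<le> D * \<eta> powr (1 / real r)" using unit e \<eta> by blast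
    have Re: "dil R e = R *\<^sub>R e" using dil_layer[OF E_layer[OF e]] by simp
    note \<open>d e (mul w e) \<le> D * \<eta> powr (1 / real r)\<close>
    then have Rd: "R * d e (mul w e) \<le> R * (D * \<eta> powr (1 / real r))"
      using R by (intro mult_left_mono) auto
    have "d (mul x (R *\<^sub>R e)) (mul y (R *\<^sub>R e)) = d (R *\<^sub>R e) (mul (mul (- x) y) (R *\<^sub>R e))"
      using d_left[of "- x" "mul x (R *\<^sub>R e)" "mul y (R *\<^sub>R e)"] by (simp add: mul_assoc)
    also have "\<dots> = d (dil R e) (dil R (mul w e))" by (simp add: dil_mul w Re)
    also have "\<dots> = R * d e (mul w e)" by (rule d_dil[OF R])
    also have "\<dots> \<le> R * (D * \<eta> powr (1 / real r))" by (rule Rd)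
    also have "\<dots> \<le> R * (max D 1 * \<eta> powr (1 / real r))"
      using R by (intro mult_left_mono mult_right_mono) auto
    finally show ?thesis by (simp add: mult_ac)
  qed
  then show ?thesis by (intro exI[of _ "max D 1"]) auto
qed

lemma d_small_if_norm_small: "\<epsilon> > 0 \<Longrightarrow> \<exists>\<delta>>0. \<forall>x. norm x < \<delta> \<longrightarrow> d 0 x < \<epsilon>"
proof -
  assume \<epsilon>: "\<epsilon> > 0"
  obtain A where A: "A > 0" "\<And>x \<eta>. 0 < \<eta> \<Longrightarrow> \<eta> \<le> 1 \<Longrightarrow> norm x \<le> 1 * \<eta> \<Longrightarrow> d 0 x \<le> A * \<eta> powr (1 / real r)"
    using d_holder[of 1] by blast
  define l where "l = min 1 (\<epsilon> / (2 * A))"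
  have l: "l > 0" "l \<le> 1" using \<epsilon> A(1) by (auto simp: l_def)
  have "(l ^ r) powr (1 / real r) = l"
    using l step_pos by (simp add: powr_realpow[symmetric] powr_powr)
  then have "d 0 x \<le> A * l" if "norm x < l ^ r" for x
    using A(2)[of "l ^ r" x] that l by (simp add: power_le_one)
  moreover have "A * l \<le> A * (\<epsilon> / (2 * A))" using A(1) by (intro mult_left_mono) (auto simp: l_def)
  then have "A * l < \<epsilon>" using \<epsilon> A(1) by simp
  ultimately have "\<forall>x. norm x < l ^ r \<longrightarrow> d 0 x < \<epsilon>" by (meson le_less_trans)
  then show ?thesis using l(1) by (intro exI[of _ "l ^ r"]) auto
qed

lemma open_dball: "open (dball d z \<rho>)"
  unfolding open_dist
proof
  fix y assume y: "y \<in> dball d z \<rho>"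
  then obtain \<delta> where \<delta>: "\<delta> > 0" "\<And>x. norm x < \<delta> \<Longrightarrow> d 0 x < \<rho> - d z y"
    using d_small_if_norm_small[of "\<rho> - d z y"] by (auto simp: dball_def)
  have "isCont (mul (- y)) y"
    using continuous_on_mul[OF continuous_on_const continuous_on_id, of UNIV "- y"]
    by (auto simp: continuous_on_eq_continuous_at)
  then obtain e where e: "e > 0" "\<And>x. dist x y < e \<Longrightarrow> dist (mul (- y) x) (mul (- y) y) < \<delta>"
    using \<delta>(1) unfolding continuous_at_eps_delta by blast
  have "x \<in> dball d z \<rho>" if "dist x y < e" for x
  proof -
    have "norm (mul (- y) x) < \<delta>" using e(2)[OF that] by simp
    from \<delta>(2)[OF this] have "d y x < \<rho> - d z y" using d_left[of "- y" y x] by simp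
    then show ?thesis using d_triangle[of z x y] by (simp add: dball_def)
  qed
  then show "\<exists>e>0. \<forall>x. dist x y < e \<longrightarrow> x \<in> dball d z \<rho>" using e(1) by blast
qed

end

section \<open>Invariance of Lebesgue measure\<close>

lemma emeasure_lborel_translation_vimage:
  fixes B :: "'a::euclidean_space set"
  assumes "B \<in> sets borel"
  shows "emeasure lborel {x. x + c \<in> B} = emeasure lborel B"
proof -
  have "emeasure lborel B = emeasure (distr lborel borel ((+) c)) B"
    using lborel_distr_plus[of c] by simp
  also have "\<dots> = emeasure lborel {x. x + c \<in> B}"
    using assms by (subst emeasure_distr) (auto simp: vimage_def add.commute)
  finally show ?thesis by simp
qed

text \<open>On each piece the map is a translation that preserves the piece, so the measure is preserved
  piece by piece.\<close>

lemma piecewise_translation_measure: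
  fixes A :: "nat \<Rightarrow> 'a::euclidean_space set"
  assumes A: "\<And>i. A i \<in> sets borel" "disjoint_family A" "(\<Union>i. A i) = UNIV"
    and inv: "\<And>i x. x + c i \<in> A i \<longleftrightarrow> x \<in> A i" and T: "\<And>i x. x \<in> A i \<Longrightarrow> T x = x + c i"
    and B: "B \<in> sets borel"
  shows "emeasure lborel (T -` B) = emeasure lborel B" "T -` B \<in> sets borel"
proof -
  have eq: "T -` B = (\<Union>i. {x. x + c i \<in> A i \<inter> B})"
  proof (rule set_eqI)
    fix x
    have "x \<in> (\<Union>i. A i)" using A(3) by simp
    then obtain i where i: "x \<in> A i" by blast
    have "x \<in> A j \<longleftrightarrow> j = i" for j
      using A(2) i by (auto simp: disjoint_family_on_def)
    then show "x \<in> T -` B \<longleftrightarrow> x \<in> (\<Union>i. {x. x + c i \<in> A i \<inter> B})"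
      using T[OF i] by (auto simp: inv)
  qed
  have meas: "{x. x + c i \<in> A i \<inter> B} \<in> sets borel" for i
  proof -
    have "(\<lambda>x. x + c i) -` (A i \<inter> B) \<inter> space borel \<in> sets borel"
      by (rule measurable_sets[of _ borel borel]) (use A(1) B in auto)
    then show ?thesis by (simp add: vimage_def)
  qed
  then show "T -` B \<in> sets borel" unfolding eq by blast
  have "disjoint_family (\<lambda>i. {x. x + c i \<in> A i \<inter> B})"
    using A(2) unfolding disjoint_family_on_def by (auto simp: inv)
  then have "emeasure lborel (T -` B) = (\<Sum>i. emeasure lborel {x. x + c i \<in> A i \<inter> B})"
    unfolding eq using meas by (intro suminf_emeasure[symmetric]) auto
  also have "\<dots> = (\<Sum>i. emeasure lborel (A i \<inter> B))"
    by (intro suminf_cong emeasure_lborel_translation_vimage sets.Int A B)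
  also have "\<dots> = emeasure lborel (\<Union>i. A i \<inter> B)"
    using A B by (intro suminf_emeasure) (auto simp: disjoint_family_on_def)
  also have "(\<Union>i. A i \<inter> B) = B" using A(3) by auto
  finally show "emeasure lborel (T -` B) = emeasure lborel B" .
qed

lemma tendsto_box_volume:
  fixes l u :: "'a::euclidean_space"
  assumes "(\<delta> \<longlongrightarrow> 0) F"
  shows "((\<lambda>n. ennreal (\<Prod>b\<in>Basis. ((u + \<delta> n *\<^sub>R One) - (l - \<delta> n *\<^sub>R One)) \<bullet> b)) \<longlongrightarrow>
      ennreal (\<Prod>b\<in>Basis. (u - l) \<bullet> b)) F"
proof -
  have "((\<lambda>n. (\<Prod>b\<in>Basis. ((u + \<delta> n *\<^sub>R One) - (l - \<delta> n *\<^sub>R One)) \<bullet> b)) \<longlongrightarrow>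
      (\<Prod>b\<in>Basis. ((u + 0 *\<^sub>R One) - (l - 0 *\<^sub>R One)) \<bullet> b)) F"
    by (intro tendsto_intros assms)
  then show ?thesis by (simp add: tendsto_ennrealI)
qed

text \<open>A shear along \<open>W\<close> translates each fibre by an amount that is constant on the fibre. Rounding
  this amount to countably many values gives piecewise translations that preserve the measure
  exactly and are uniformly close to the shear, and boxes can be squeezed between slightly smaller and
  slightly larger boxes.\<close>

lemma shear_measure:
  fixes f :: "'a::euclidean_space \<Rightarrow> 'a"
  assumes cont: "continuous_on UNIV f" and W: "subspace W" "\<And>x. f x \<in> W" "\<And>x w. w \<in> W \<Longrightarrow> f (x + w) = f x"
    and B: "B \<in> sets borel"
  shows "emeasure lborel ((\<lambda>x. x + f x) -` B) = emeasure lborel B"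
proof -
  let ?T = "\<lambda>x. x + f x"
  obtain D where D: "countable D" "D \<subseteq> W" "W \<subseteq> closure D" by (rule separable[of W])
  have "0 \<in> W" using W(1) by (rule subspace_0)
  then have "D \<noteq> {}" using D(3) by auto
  define c where "c = from_nat_into D"
  have c: "range c = D" unfolding c_def using D(1) \<open>D \<noteq> {}\<close> by (rule range_from_nat_into[rotated])
  \<comment> \<open>The rounded shears. On the set where the value \<open>c i\<close> is used, \<open>f\<close> is invariant under \<open>c i\<close>, so
    this set is invariant under the translation by \<open>c i\<close>.\<close>
  have approx: "\<exists>S. (\<forall>x. dist (S x) (?T x) < \<delta>) \<and> (\<forall>B \<in> sets borel. emeasure lborel (S -` B) = emeasure lborel B \<and> S -` B \<in> sets borel)"
    if \<delta>: "\<delta> > 0" for \<delta>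
  proof -
    have ex: "\<exists>i. dist (c i) (f x) < \<delta>" for x
    proof -
      have "f x \<in> closure (range c)" using W(2) D(3) c by auto
      then show ?thesis using \<delta> unfolding closure_approachable by auto
    qed
    define A where "A i = {x. dist (c i) (f x) < \<delta>} - (\<Union>j<i. {x. dist (c j) (f x) < \<delta>})" for i
    have op: "open {x. dist (c i) (f x) < \<delta>}" for i
      by (intro open_Collect_less continuous_on_dist continuous_on_const cont)
    have A1: "A i \<in> sets borel" for i unfolding A_def using op by auto
    have "A i \<inter> A j = {}" if "i < j" for i j using that by (auto simp: A_def)
    then have A2: "disjoint_family A"
      unfolding disjoint_family_on_def by (metis Int_commute nat_neq_iff)
    have A3: "(\<Union>i. A i) = UNIV"
    proof -
      have "x \<in> A (LEAST i. dist (c i) (f x) < \<delta>)" for x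
        using LeastI_ex[OF ex] not_less_Least by (auto simp: A_def)
      then show ?thesis by blast
    qed
    have cW: "c i \<in> W" for i using c D(2) by auto
    have inv: "x + c i \<in> A i \<longleftrightarrow> x \<in> A i" for i x using W(3)[OF cW[of i]] by (simp add: A_def)
    define S where "S x = x + c (LEAST i. dist (c i) (f x) < \<delta>)" for x
    have S: "S x = x + c i" if "x \<in> A i" for i x
    proof -
      have "(LEAST i. dist (c i) (f x) < \<delta>) = i"
        using that by (intro Least_equality) (auto simp: A_def not_less[symmetric])
      then show ?thesis by (simp add: S_def)
    qed
    have "dist (S x) (?T x) < \<delta>" for x
      using LeastI_ex[OF ex[of x]] by (simp add: S_def)
    then show ?thesis
      using piecewise_translation_measure[OF A1 A2 A3 inv S] by blast
  qed
  have "\<exists>S. (\<forall>x. dist (S x) (?T x) < inverse (Suc n)) \<and>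
      (\<forall>B \<in> sets borel. emeasure lborel (S -` B) = emeasure lborel B \<and> S -` B \<in> sets borel)" for n
    by (rule approx) simp
  then obtain S where S: "\<And>n x. dist (S n x) (?T x) < inverse (real (Suc n))"
    "\<And>n B. B \<in> sets borel \<Longrightarrow> emeasure lborel (S n -` B) = emeasure lborel B"
    "\<And>n B. B \<in> sets borel \<Longrightarrow> S n -` B \<in> sets borel" by metis
  have Tm [measurable]: "?T \<in> borel_measurable borel"
    by (intro borel_measurable_continuous_onI continuous_on_add continuous_on_id cont)
  have meas: "?T -` B \<in> sets borel" if "B \<in> sets borel" for B
    using measurable_sets[OF Tm that] by simp
  have comp: "\<bar>S n x \<bullet> b - ?T x \<bullet> b\<bar> < inverse (real (Suc n))" if "b \<in> Basis" for n x b
  proof -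
    have "\<bar>(S n x - ?T x) \<bullet> b\<bar> \<le> norm (S n x - ?T x)" using that by (rule Basis_le_norm)
    then show ?thesis using S(1)[of n x] by (simp add: dist_norm inner_diff_left)
  qed
  let ?\<delta> = "\<lambda>n. inverse (real (Suc n))"
  have lim: "?\<delta> \<longlonglongrightarrow> 0" by (rule LIMSEQ_inverse_real_of_nat)
  then have lim': "(\<lambda>n. - ?\<delta> n) \<longlonglongrightarrow> 0" using tendsto_minus[of ?\<delta> 0] by simp
  have "lborel = distr lborel borel ?T"
  proof (rule lborel_eqI)
    fix l u :: 'a assume lu: "\<And>b. b \<in> Basis \<Longrightarrow> l \<bullet> b \<le> u \<bullet> b"
    have eq: "emeasure (distr lborel borel ?T) (box l u) = emeasure lborel (?T -` box l u)"
      by (subst emeasure_distr) auto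
    have "emeasure lborel (?T -` box l u) \<le> ennreal (\<Prod>b\<in>Basis. ((u + ?\<delta> n *\<^sub>R One) - (l - ?\<delta> n *\<^sub>R One)) \<bullet> b)" for n
    proof -
      let ?l = "l - ?\<delta> n *\<^sub>R One" and ?u = "u + ?\<delta> n *\<^sub>R One"
      have "?T -` box l u \<subseteq> S n -` box ?l ?u"
      proof
        fix x assume x: "x \<in> ?T -` box l u"
        have "?l \<bullet> b < S n x \<bullet> b \<and> S n x \<bullet> b < ?u \<bullet> b" if "b \<in> Basis" for b
        proof -
          have "l \<bullet> b < ?T x \<bullet> b" "?T x \<bullet> b < u \<bullet> b" using x that by (auto simp: mem_box)
          moreover have "One \<bullet> b = 1" using that by simp
          ultimately show ?thesis
            using comp[OF that, of n x] unfolding inner_diff_left inner_add_left inner_scaleR_left by auto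
        qed
        then show "x \<in> S n -` box ?l ?u" by (simp add: mem_box)
      qed
      then have "emeasure lborel (?T -` box l u) \<le> emeasure lborel (S n -` box ?l ?u)"
        by (intro emeasure_mono) (auto intro!: S(3))
      also have "\<dots> = emeasure lborel (box ?l ?u)" by (rule S(2)) simp
      also have "\<dots> = ennreal (\<Prod>b\<in>Basis. (?u - ?l) \<bullet> b)"
        by (rule emeasure_lborel_box) (use lu in \<open>auto simp: inner_diff_left inner_add_left intro!: add_increasing\<close>)
      finally show ?thesis .
    qed
    then have upper: "emeasure lborel (?T -` box l u) \<le> ennreal (\<Prod>b\<in>Basis. (u - l) \<bullet> b)"
      by (intro tendsto_lowerbound[OF tendsto_box_volume[OF lim]]) auto
    have lower: "ennreal (\<Prod>b\<in>Basis. (u - l) \<bullet> b) \<le> emeasure lborel (?T -` box l u)"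
    proof (cases "\<exists>b\<in>Basis. l \<bullet> b = u \<bullet> b")
      case True
      then have "(\<Prod>b\<in>Basis. (u - l) \<bullet> b) = 0" by (intro prod_zero) (metis finite_Basis, metis diff_self inner_diff_left)
      then show ?thesis by (simp only: ennreal_0 zero_le)
    next
      case False
      with lu have lt: "\<And>b. b \<in> Basis \<Longrightarrow> l \<bullet> b < u \<bullet> b" by force
      have "\<forall>\<^sub>F n in sequentially. \<forall>b\<in>Basis. ?\<delta> n < (u \<bullet> b - l \<bullet> b) / 2"
        by (intro eventually_ball_finite ballI order_tendstoD(2)[OF lim]) (use lt in auto)
      then have "\<forall>\<^sub>F n in sequentially. ennreal (\<Prod>b\<in>Basis. ((u + (- ?\<delta> n) *\<^sub>R One) - (l - (- ?\<delta> n) *\<^sub>R One)) \<bullet> b)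
           \<le> emeasure lborel (?T -` box l u)"
      proof eventually_elim
        case (elim n)
        let ?l = "l - (- ?\<delta> n) *\<^sub>R One" and ?u = "u + (- ?\<delta> n) *\<^sub>R One"
        have "S n -` box ?l ?u \<subseteq> ?T -` box l u"
        proof
          fix x assume x: "x \<in> S n -` box ?l ?u"
          have "l \<bullet> b < ?T x \<bullet> b \<and> ?T x \<bullet> b < u \<bullet> b" if b: "b \<in> Basis" for b
          proof -
            have "?l \<bullet> b < S n x \<bullet> b" "S n x \<bullet> b < ?u \<bullet> b" using x b by (auto simp: mem_box)
            moreover have "One \<bullet> b = 1" using b by simp
            ultimately show ?thesis
              using comp[OF b, of n x] unfolding inner_diff_left inner_add_left inner_scaleR_left by auto
          qed
          then show "x \<in> ?T -` box l u" by (simp add: mem_box)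
        qed
        then have "emeasure lborel (S n -` box ?l ?u) \<le> emeasure lborel (?T -` box l u)"
          by (intro emeasure_mono) (auto intro!: meas)
        moreover have "emeasure lborel (S n -` box ?l ?u) = emeasure lborel (box ?l ?u)" by (rule S(2)) simp
        moreover have "\<dots> = ennreal (\<Prod>b\<in>Basis. (?u - ?l) \<bullet> b)"
        proof (rule emeasure_lborel_box)
          fix b :: 'a assume b: "b \<in> Basis"
          then have "?\<delta> n < (u \<bullet> b - l \<bullet> b) / 2" using elim by blast
          then show "?l \<bullet> b \<le> ?u \<bullet> b"
            using b unfolding inner_diff_left inner_add_left inner_scaleR_left by simp
        qed
        ultimately show ?case by simp
      qed
      then show ?thesis by (intro tendsto_upperbound[OF tendsto_box_volume[OF lim']]) auto
    qed
    show "emeasure (distr lborel borel ?T) (box l u) = ennreal (\<Prod>b\<in>Basis. (u - l) \<bullet> b)"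
      unfolding eq using upper lower by (rule antisym)
  qed simp
  then have "emeasure lborel B = emeasure (distr lborel borel ?T) B" by simp
  also have "\<dots> = emeasure lborel (?T -` B)" using B by (subst emeasure_distr) auto
  finally show ?thesis by simp
qed

context carnot_group
begin

text \<open>In the coordinates given by the layers, such a map adds to the component in \<open>V j\<close> a function of the
  components in \<open>V i\<close>, \<open>i < j\<close>. It is the composition of the shears along \<open>V r\<close>, ..., \<open>V 1\<close>, in
  this order. Left and right translations have this form by \<open>mul_perturb\<close>.\<close>

lemma triangular_map_measure:
  assumes cont: "continuous_on UNIV T"
    and tri: "\<And>m x y. x - y \<in> tail m \<Longrightarrow> T x - T y - (x - y) \<in> tail (Suc m)"
    and B: "B \<in> sets borel"
  shows "emeasure lborel (T -` B) = emeasure lborel B"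
proof -
  define P where "P j x = pr j (T x) - pr j x" for j x
  define S where "S j x = x + P j x" for j x
  define U where "U j x = x + (\<Sum>i = j..r. P i x)" for j x
  have contP: "continuous_on UNIV (P j)" for j
    unfolding P_def
    by (intro continuous_on_diff linear_continuous_on_compose[OF _ linear_pr] cont linear_continuous_on linear_conv_bounded_linear[THEN iffD1] linear_pr)
  have PV: "P j x \<in> V j" for j x
    unfolding P_def by (intro subspace_diff[OF subspace_layer] pr_in_layer)
  have Pinv: "P j (x + w) = P j x" if "w \<in> tail j" for j x w
  proof -
    have "T (x + w) - T x - w \<in> tail (Suc j)" using tri[of "x + w" x j] that by simp
    then have "pr j (T (x + w) - T x - w) = 0" by (rule pr_tail_0) simp
    then show ?thesis by (simp add: P_def linear_diff[OF linear_pr] linear_add[OF linear_pr] algebra_simps)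
  qed
  have contS: "continuous_on UNIV (S j)" for j
    unfolding S_def by (intro continuous_on_add continuous_on_id contP)
  have Sm: "S j -` B \<in> sets borel" if "B \<in> sets borel" for j B
    using measurable_sets[OF borel_measurable_continuous_onI[OF contS] that] by simp
  have SB: "emeasure lborel (S j -` B) = emeasure lborel B" if "B \<in> sets borel" for j B
  proof -
    have "P j (x + w) = P j x" if "w \<in> V j" for x w
      using Pinv that layer_subset_tail by blast
    from shear_measure[OF contP subspace_layer PV this that] show ?thesis by (simp add: S_def[abs_def])
  qed
  have US: "U j x = S j (U (Suc j) x)" if "j \<le> r" for j x
  proof -
    have "(\<Sum>i = Suc j..r. P i x) \<in> tail j"
    proof (rule tail_sum)
      fix i assume "i \<in> {Suc j..r}"
      then show "P i x \<in> tail j" using PV[of i x] layer_subset_tail[of i] tail_antimono[of j i] by auto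
    qed
    then have "P j (U (Suc j) x) = P j x" unfolding U_def by (rule Pinv)
    moreover have "(\<Sum>i = j..r. P i x) = P j x + (\<Sum>i = Suc j..r. P i x)" using that by (rule sum.atLeast_Suc_atMost)
    ultimately show ?thesis by (simp add: U_def S_def)
  qed
  have "\<forall>B \<in> sets borel. emeasure lborel (U (Suc r - k) -` B) = emeasure lborel B" for k
  proof (induction k)
    case 0
    have "U (Suc r) = (\<lambda>x. x)" by (simp add: U_def fun_eq_iff)
    then show ?case by simp
  next
    case (Suc k)
    show ?case
    proof (cases "k \<le> r")
      case True
      then have *: "U (Suc r - Suc k) = S (Suc r - Suc k) \<circ> U (Suc r - k)"
        using US[of "Suc r - Suc k"] by (auto simp: Suc_diff_le)
      show ?thesis unfolding * vimage_comp[symmetric] using Suc.IH SB Sm by simp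
    qed (use Suc.IH in simp)
  qed
  from this[of r] B have "emeasure lborel (U 1 -` B) = emeasure lborel B" by simp
  moreover have "U 1 x = T x" for x
    by (simp add: U_def P_def sum_subtractf)
  then have "U 1 = T" by (simp add: fun_eq_iff)
  ultimately show ?thesis by simp
qed

lemma right_translation_measure:
  assumes "B \<in> sets borel"
  shows "emeasure lborel {x. mul x g \<in> B} = emeasure lborel B"
proof -
  have "continuous_on UNIV (\<lambda>x. mul x g)" by (intro continuous_on_mul continuous_on_id continuous_on_const)
  moreover have "mul x g - mul y g - (x - y) \<in> tail (Suc m)" if "x - y \<in> tail m" for x y m
    using mul_perturb[of x y m g g] that by simp
  ultimately have "emeasure lborel ((\<lambda>x. mul x g) -` B) = emeasure lborel B"
    using assms by (rule triangular_map_measure)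
  then show ?thesis by (simp add: vimage_def)
qed

lemma left_translation_measure:
  assumes "B \<in> sets borel"
  shows "emeasure lborel {x. mul g x \<in> B} = emeasure lborel B"
proof -
  have "continuous_on UNIV (mul g)" by (intro continuous_on_mul continuous_on_id continuous_on_const)
  moreover have "mul g x - mul g y - (x - y) \<in> tail (Suc m)" if "x - y \<in> tail m" for x y m
    using mul_perturb[of g g m x y] that by simp
  ultimately have "emeasure lborel (mul g -` B) = emeasure lborel B"
    using assms by (rule triangular_map_measure)
  then show ?thesis by (simp add: vimage_def)
qed

section \<open>Volumes of balls\<close>

lemma dball_measure_center: "emeasure lborel (dball d z \<rho>) = emeasure lborel (dball d 0 \<rho>)"
proof -
  have "dball d z \<rho> = {x. mul (- z) x \<in> dball d 0 \<rho>}"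
    using d_left[of "- z" z] by (auto simp: dball_def)
  then show ?thesis using left_translation_measure[of "dball d 0 \<rho>" "- z"] open_dball by simp
qed

lemma dball_bounded: "bounded (dball d 0 \<rho>)"
proof (cases "\<rho> > 0")
  case True
  obtain c where c: "c > 0" "\<And>x. d 0 x < c \<Longrightarrow> norm x \<le> 1" using d_unit_ball by blast
  obtain K where K: "K > 0" "\<And>s x. 0 \<le> s \<Longrightarrow> norm (dil s x) \<le> K * max s (s ^ r) * norm x"
    using norm_dil_le by blast
  define s where "s = \<rho> / c"
  have s: "s > 0" using c(1) True by (simp add: s_def)
  have "norm x \<le> K * max s (s ^ r)" if "x \<in> dball d 0 \<rho>" for x
  proof -
    have "d 0 (dil (inverse s) x) = inverse s * d 0 x" using d_dil_0 s by simp
    also have "\<dots> < c" using that s c(1) by (simp add: dball_def s_def field_simps)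
    finally have n: "norm (dil (inverse s) x) \<le> 1" by (rule c(2))
    have "norm x = norm (dil s (dil (inverse s) x))" using s by simp
    also have "\<dots> \<le> K * max s (s ^ r) * norm (dil (inverse s) x)" using s by (intro K(2)) simp
    also have "\<dots> \<le> K * max s (s ^ r) * 1" using n K(1) s by (intro mult_left_mono) auto
    finally show ?thesis by simp
  qed
  then show ?thesis unfolding bounded_iff by blast
next
  case False
  then have "dball d 0 \<rho> = {}" using d_nonneg by (auto simp: dball_def) (meson le_less_trans not_le order.trans)
  then show ?thesis by simp
qed

lemma dball_measure_pos: "\<rho> > 0 \<Longrightarrow> emeasure lborel (dball d z \<rho>) > 0"
proof -
  assume "\<rho> > 0"
  then have "z \<in> dball d z \<rho>" by (simp add: dball_def)
  then have "\<not> negligible (dball d z \<rho>)" using open_not_negligible[OF open_dball] by blast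
  then show ?thesis
    using negligible_iff_emeasure0[of "dball d z \<rho>"] open_dball[of z \<rho>] by (simp add: zero_less_iff_neq_zero)
qed

text \<open>Compactness gives a covering of the ball of radius 2 by balls of radius 1; dilations carry it
  to all scales with the same number of balls.\<close>

lemma dball_doubling: "\<exists>k::nat. \<forall>\<rho>>0. emeasure lborel (dball d 0 (2 * \<rho>)) \<le> of_nat k * emeasure lborel (dball d 0 \<rho>)"
proof -
  have "compact (closure (dball d 0 2))" using dball_bounded by simp
  moreover have "closure (dball d 0 2) \<subseteq> (\<Union>g\<in>UNIV. dball d g 1)"
  proof
    fix x assume "x \<in> closure (dball d 0 2)"
    have "x \<in> dball d x 1" by (simp add: dball_def)
    then show "x \<in> (\<Union>g\<in>UNIV. dball d g 1)" by blast
  qed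
  ultimately obtain F where F: "finite F" "closure (dball d 0 2) \<subseteq> (\<Union>g\<in>F. dball d g 1)"
    using compactE_image[of "closure (dball d 0 2)" UNIV "\<lambda>g. dball d g 1"] open_dball by (metis subset_UNIV)
  have "emeasure lborel (dball d 0 (2 * \<rho>)) \<le> of_nat (card F) * emeasure lborel (dball d 0 \<rho>)" if \<rho>: "\<rho> > 0" for \<rho>
  proof -
    have "dball d 0 (2 * \<rho>) \<subseteq> (\<Union>g\<in>F. dball d (dil \<rho> g) \<rho>)"
    proof
      fix x assume "x \<in> dball d 0 (2 * \<rho>)"
      then have "inverse \<rho> * d 0 x < inverse \<rho> * (2 * \<rho>)"
        using \<rho> by (intro mult_strict_left_mono) (auto simp: dball_def)
      also have "\<dots> = 2" using \<rho> by simp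
      finally have "d 0 (dil (inverse \<rho>) x) < 2" using d_dil_0[of "inverse \<rho>" x] \<rho> by simp
      then have "dil (inverse \<rho>) x \<in> closure (dball d 0 2)" by (intro subsetD[OF closure_subset]) (simp add: dball_def)
      then obtain g where g: "g \<in> F" "d g (dil (inverse \<rho>) x) < 1" using F(2) by (auto simp: dball_def)
      have "d (dil \<rho> g) x = \<rho> * d g (dil (inverse \<rho>) x)"
        using d_dil[OF \<rho>, of g "dil (inverse \<rho>) x"] \<rho> by simp
      also have "\<dots> < \<rho>" using g(2) \<rho> by simp
      finally show "x \<in> (\<Union>g\<in>F. dball d (dil \<rho> g) \<rho>)" using g(1) by (auto simp: dball_def)
    qed
    then have "emeasure lborel (dball d 0 (2 * \<rho>)) \<le> emeasure lborel (\<Union>g\<in>F. dball d (dil \<rho> g) \<rho>)"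
      by (intro emeasure_mono) (auto intro!: borel_open open_UN open_dball)
    also have "\<dots> \<le> (\<Sum>g\<in>F. emeasure lborel (dball d (dil \<rho> g) \<rho>))"
      using F(1) by (intro emeasure_subadditive_finite) (auto intro!: borel_open open_dball)
    also have "\<dots> = of_nat (card F) * emeasure lborel (dball d 0 \<rho>)"
      by (subst dball_measure_center) simp
    finally show ?thesis .
  qed
  then show ?thesis by blast
qed

lemma dball_measure_le:
  "\<exists>C>0. \<exists>N::nat. \<forall>\<rho> R y z. 0 < \<rho> \<longrightarrow> \<rho> \<le> R \<longrightarrow>
     emeasure lborel (dball d z R) \<le> ennreal (C * (R / \<rho>) ^ N) * emeasure lborel (dball d y \<rho>)"
proof -
  obtain k :: nat where k: "\<And>\<rho>. \<rho> > 0 \<Longrightarrow> emeasure lborel (dball d 0 (2 * \<rho>)) \<le> of_nat k * emeasure lborel (dball d 0 \<rho>)"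
    using dball_doubling by blast
  obtain N where N: "k \<le> 2 ^ N" using less_exp[of k] less_imp_le by blast
  have iter: "emeasure lborel (dball d 0 (2 ^ n * \<rho>)) \<le> of_nat (k ^ n) * emeasure lborel (dball d 0 \<rho>)" if "\<rho> > 0" for n \<rho>
  proof (induction n)
    case (Suc n)
    have "emeasure lborel (dball d 0 (2 * (2 ^ n * \<rho>))) \<le> of_nat k * emeasure lborel (dball d 0 (2 ^ n * \<rho>))"
      using that by (intro k) simp
    also have "\<dots> \<le> of_nat k * (of_nat (k ^ n) * emeasure lborel (dball d 0 \<rho>))"
      by (intro mult_left_mono Suc) simp
    finally show ?case by (simp add: mult.assoc)
  qed simp
  have "emeasure lborel (dball d z R) \<le> ennreal (2 ^ N * (R / \<rho>) ^ N) * emeasure lborel (dball d y \<rho>)"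
    if \<rho>: "0 < \<rho>" "\<rho> \<le> R" for \<rho> R y z
  proof -
    define n where "n = nat \<lceil>log 2 (R / \<rho>)\<rceil>"
    have Rr: "1 \<le> R / \<rho>" using \<rho> by simp
    have "log 2 (R / \<rho>) \<le> real n" unfolding n_def by linarith
    then have "2 powr log 2 (R / \<rho>) \<le> 2 powr real n" by simp
    then have 1: "R / \<rho> \<le> 2 ^ n" using Rr by (simp add: powr_realpow)
    have "real n \<le> log 2 (R / \<rho>) + 1" using Rr unfolding n_def by (simp add: zero_le_log_cancel_iff)
    then have "2 powr real n \<le> 2 powr (log 2 (R / \<rho>) + 1)" by simp
    also have "\<dots> = 2 * (R / \<rho>)" using Rr by (simp add: powr_add)
    finally have 2: "2 ^ n \<le> 2 * (R / \<rho>)" by (simp add: powr_realpow)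
    have "real (k ^ n) \<le> (2 ^ N) ^ n" using N by (metis of_nat_le_iff of_nat_numeral of_nat_power power_mono zero_le)
    also have "\<dots> = (2 ^ n) ^ N" by (simp add: power_mult[symmetric] mult.commute)
    also have "\<dots> \<le> (2 * (R / \<rho>)) ^ N" using 2 by (intro power_mono) auto
    finally have 3: "real (k ^ n) \<le> 2 ^ N * (R / \<rho>) ^ N" by (simp add: power_mult_distrib[symmetric])
    have "emeasure lborel (dball d z R) = emeasure lborel (dball d 0 R)" by (rule dball_measure_center)
    also have "\<dots> \<le> emeasure lborel (dball d 0 (2 ^ n * \<rho>))"
    proof (rule emeasure_mono)
      have "R \<le> 2 ^ n * \<rho>" using 1 \<rho> by (simp add: field_simps)
      then show "dball d 0 R \<subseteq> dball d 0 (2 ^ n * \<rho>)" by (auto simp: dball_def)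
    qed (use open_dball in auto)
    also have "\<dots> \<le> of_nat (k ^ n) * emeasure lborel (dball d 0 \<rho>)" by (rule iter[OF \<rho>(1)])
    also have "\<dots> \<le> ennreal (2 ^ N * (R / \<rho>) ^ N) * emeasure lborel (dball d 0 \<rho>)"
      using 3 by (intro mult_right_mono) (auto simp: ennreal_of_nat_eq_real_of_nat intro!: ennreal_leI)
    finally show ?thesis by (simp add: dball_measure_center[of y])
  qed
  then show ?thesis by (intro exI[of _ "2 ^ N"] conjI exI[of _ N]) auto
qed

end

section \<open>Curves in a uniformly convex space\<close>

definition midpoint_defect :: "(real \<Rightarrow> 'b::real_normed_vector) \<Rightarrow> real \<Rightarrow> real \<Rightarrow> real" where
  "midpoint_defect f w t = norm (f t + f (t + w) - 2 *\<^sub>R f (t + w / 2))"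

text \<open>The distance to the chord at a midpoint is at most the mean of the distances at the end points plus
  half of the defect. As the defects are proportional to the mesh, they add up to a geometric
  series.\<close>

lemma dyadic_interpolation:
  fixes f :: "real \<Rightarrow> 'b::real_normed_vector"
  assumes u: "u > 0"
    and dev: "\<And>i l. i < n \<Longrightarrow> l < (2::nat) ^ i \<Longrightarrow> midpoint_defect f (u / 2 ^ i) (real l * (u / 2 ^ i)) \<le> \<theta> * (u / 2 ^ i)"
    and l: "l \<le> 2 ^ n"
  shows "norm (f (real l * (u / 2 ^ n)) - f 0 - (real l / 2 ^ n) *\<^sub>R (f u - f 0)) \<le> \<theta> * u * (1 - 1 / 2 ^ n)"
  using dev l
proof (induction n arbitrary: l)
  case 0
  then have "l = 0 \<or> l = 1" by auto
  then show ?case by auto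
next
  case (Suc n)
  \<comment> \<open>\<open>F\<close> is the deviation from the chord; subtracting an affine function leaves the defects unchanged.\<close>
  define F where "F t = f t - f 0 - (t / u) *\<^sub>R (f u - f 0)" for t
  define w where "w = u / 2 ^ n"
  have w: "w > 0" using u by (simp add: w_def)
  have IH: "norm (F (real k * w)) \<le> \<theta> * u * (1 - 1 / 2 ^ n)" if "k \<le> 2 ^ n" for k
    using Suc.IH[OF Suc.prems(1) that] u by (simp add: F_def w_def)
  have goal: "norm (F (real l * (w / 2))) \<le> \<theta> * u * (1 - 1 / 2 ^ Suc n)"
  proof (cases "even l")
    case True
    then obtain k where k: "l = 2 * k" by blast
    have "0 \<le> midpoint_defect f (u / 2 ^ 0) (real 0 * (u / 2 ^ 0))" unfolding midpoint_defect_def by (rule norm_ge_zero)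
    also have "\<dots> \<le> \<theta> * (u / 2 ^ 0)" by (rule Suc.prems(1)) auto
    finally have "\<theta> * u * (1 - 1 / 2 ^ n) \<le> \<theta> * u * (1 - 1 / 2 ^ Suc n)"
      by (intro mult_left_mono) (auto simp: field_simps)
    then show ?thesis using IH[of k] Suc.prems(2) k by (simp add: mult.assoc)
  next
    case False
    then obtain k where k: "l = 2 * k + 1" by (metis oddE)
    with Suc.prems(2) have k2: "k < 2 ^ n" by simp
    let ?t = "real k * w"
    have 1: "midpoint_defect f w ?t \<le> \<theta> * w" using Suc.prems(1)[of n k] k2 by (simp add: w_def)
    have 2: "?t + w = real (Suc k) * w" by (simp add: algebra_simps)
    have "F ?t + F (?t + w) - 2 *\<^sub>R F (?t + w / 2) = f ?t + f (?t + w) - 2 *\<^sub>R f (?t + w / 2)"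
    proof -
      have "2 *\<^sub>R ((?t + w / 2) / u) *\<^sub>R X = (?t / u) *\<^sub>R X + ((?t + w) / u) *\<^sub>R X" for X :: 'b
        by (simp flip: scaleR_left_distrib add: add_divide_distrib)
      then show ?thesis unfolding F_def by (simp add: scaleR_diff_right algebra_simps scaleR_2)
    qed
    then have "2 *\<^sub>R F (?t + w / 2) = F ?t + F (?t + w) - (f ?t + f (?t + w) - 2 *\<^sub>R f (?t + w / 2))"
      by (simp add: algebra_simps)
    then have "norm (2 *\<^sub>R F (?t + w / 2)) \<le> norm (F ?t) + norm (F (?t + w)) + midpoint_defect f w ?t"
      using norm_triangle_ineq4[of "F ?t + F (?t + w)" "f ?t + f (?t + w) - 2 *\<^sub>R f (?t + w / 2)"]
        norm_triangle_ineq[of "F ?t" "F (?t + w)"] unfolding midpoint_defect_def by simp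
    also have "\<dots> \<le> 2 * (\<theta> * u * (1 - 1 / 2 ^ n)) + \<theta> * w"
      using IH[of k] IH[of "Suc k"] 1 2 k2 by simp
    also have "\<dots> = 2 * (\<theta> * u * (1 - 1 / 2 ^ Suc n))" by (simp add: w_def field_simps)
    finally have "norm (F (?t + w / 2)) \<le> \<theta> * u * (1 - 1 / 2 ^ Suc n)" by simp
    moreover have "?t + w / 2 = real l * (w / 2)" by (simp add: k field_simps)
    ultimately show ?thesis by simp
  qed
  have 1: "real l * (u / 2 ^ Suc n) = real l * (w / 2)" by (simp add: w_def)
  have 2: "real l / 2 ^ Suc n = real l * (w / 2) / u" using u by (simp add: w_def)
  show ?case unfolding 1 2 using goal unfolding F_def .
qed

lemma sum_pairs: "(\<Sum>l<2 * m. g l) = (\<Sum>l<m. g (2 * l) + g (2 * l + 1))" for g :: "nat \<Rightarrow> real"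
  by (induction m) auto

text \<open>The mean of the \<open>p\<close>-th powers of the difference quotients increases when the mesh is halved, and
  uniform convexity bounds the increase from below by the midpoint defects. The sum telescopes.\<close>

lemma dyadic_energy:
  fixes f :: "real \<Rightarrow> 'b::real_normed_vector"
  assumes convexity: "\<And>x y z :: 'b.
          (norm (x - y) powr p + norm (y - z) powr p) / 2
            \<ge> norm ((1 / 2) *\<^sub>R (x - z)) powr p + norm ((1 / (2 * K)) *\<^sub>R (x + z - 2 *\<^sub>R y)) powr p"
    and K: "K > 0" and u: "u > 0"
  defines "w \<equiv> \<lambda>n::nat. u / 2 ^ n"
  shows "(\<Sum>n<N. (1 / 2 ^ n) * (\<Sum>l<2 ^ n. (midpoint_defect f (w n) (real l * w n) / (K * w n)) powr p))
    \<le> (1 / 2 ^ N) * (\<Sum>l<2 ^ N. (norm (f (real l * w N + w N) - f (real l * w N)) / w N) powr p)"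
proof (induction N)
  case 0
  then show ?case by simp
next
  case (Suc N)
  let ?w = "w N"
  have w: "?w > 0" and w2: "w (Suc N) = ?w / 2" using u by (simp_all add: w_def)
  define g where "g l = (norm (f (real l * (?w / 2) + ?w / 2) - f (real l * (?w / 2))) / (?w / 2)) powr p" for l
  have step: "(norm (f (real l * ?w + ?w) - f (real l * ?w)) / ?w) powr p + (midpoint_defect f ?w (real l * ?w) / (K * ?w)) powr p
     \<le> (g (2 * l) + g (2 * l + 1)) / 2" for l
  proof -
    let ?x = "f (real l * ?w)" and ?y = "f (real l * ?w + ?w / 2)" and ?z = "f (real l * ?w + ?w)"
    define c where "c = (2 / ?w) powr p"
    have c: "c \<ge> 0" by (simp add: c_def)
    have sc: "(a / (?w / 2)) powr p = c * a powr p" if "a \<ge> 0" for a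
      using w that by (simp add: c_def powr_mult[symmetric] mult.commute)
    have 1: "g (2 * l) = c * norm (?x - ?y) powr p"
    proof -
      have "real (2 * l) * (?w / 2) = real l * ?w" by simp
      then show ?thesis unfolding g_def by (simp only: sc[OF norm_ge_zero] norm_minus_commute)
    qed
    have 2: "g (2 * l + 1) = c * norm (?y - ?z) powr p"
    proof -
      have "real (2 * l + 1) * (?w / 2) = real l * ?w + ?w / 2" by (simp add: field_simps)
      moreover have "real l * ?w + ?w / 2 + ?w / 2 = real l * ?w + ?w" by simp
      ultimately show ?thesis unfolding g_def by (simp only: sc[OF norm_ge_zero] norm_minus_commute)
    qed
    have 3: "(norm (?z - ?x) / ?w) powr p = c * norm ((1 / 2) *\<^sub>R (?x - ?z)) powr p"
      using w by (simp add: c_def powr_mult[symmetric] norm_minus_commute)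
    have 4: "(midpoint_defect f ?w (real l * ?w) / (K * ?w)) powr p = c * norm ((1 / (2 * K)) *\<^sub>R (?x + ?z - 2 *\<^sub>R ?y)) powr p"
      using w K by (simp add: c_def powr_mult[symmetric] midpoint_defect_def mult.commute[of K])
    have "c * (norm ((1 / 2) *\<^sub>R (?x - ?z)) powr p + norm ((1 / (2 * K)) *\<^sub>R (?x + ?z - 2 *\<^sub>R ?y)) powr p)
       \<le> c * ((norm (?x - ?y) powr p + norm (?y - ?z) powr p) / 2)"
      using c convexity by (intro mult_left_mono)
    then show ?thesis unfolding 1 2 3 4 by (simp add: distrib_left)
  qed
  have "(\<Sum>n<Suc N. (1 / 2 ^ n) * (\<Sum>l<2 ^ n. (midpoint_defect f (w n) (real l * w n) / (K * w n)) powr p))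
     \<le> (1 / 2 ^ N) * (\<Sum>l<2 ^ N. (norm (f (real l * ?w + ?w) - f (real l * ?w)) / ?w) powr p)
        + (1 / 2 ^ N) * (\<Sum>l<2 ^ N. (midpoint_defect f ?w (real l * ?w) / (K * ?w)) powr p)"
    using Suc.IH by simp
  also have "\<dots> = (1 / 2 ^ N) * (\<Sum>l<2 ^ N. (norm (f (real l * ?w + ?w) - f (real l * ?w)) / ?w) powr p
        + (midpoint_defect f ?w (real l * ?w) / (K * ?w)) powr p)"
    by (simp add: sum.distrib distrib_left)
  also have "\<dots> \<le> (1 / 2 ^ N) * (\<Sum>l<2 ^ N. (g (2 * l) + g (2 * l + 1)) / 2)"
    by (intro mult_left_mono sum_mono step) simp
  also have "\<dots> = (1 / 2 ^ Suc N) * (\<Sum>l<2 ^ N. g (2 * l) + g (2 * l + 1))"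
    by (simp add: sum_divide_distrib[symmetric])
  also have "\<dots> = (1 / 2 ^ Suc N) * (\<Sum>l<2 ^ Suc N. g l)"
    using sum_pairs[of g "2 ^ N"] by simp
  also have "\<dots> = (1 / 2 ^ Suc N) * (\<Sum>l<2 ^ Suc N. (norm (f (real l * w (Suc N) + w (Suc N)) - f (real l * w (Suc N))) / w (Suc N)) powr p)"
    unfolding g_def w2 ..
  finally show ?case .
qed

section \<open>Affine lines and homomorphisms\<close>

context carnot_group
begin

definition line_defect :: "('a \<Rightarrow> 'b::real_normed_vector) \<Rightarrow> 'a \<Rightarrow> real \<Rightarrow> 'a \<Rightarrow> real" where
  "line_defect h e w y = norm (h y + h (mul y (w *\<^sub>R e)) - 2 *\<^sub>R h (mul y ((w / 2) *\<^sub>R e)))"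

lemma mul_line_line: "mul (mul y (s *\<^sub>R e)) (t *\<^sub>R e) = mul y ((s + t) *\<^sub>R e)"
  by (simp add: mul_assoc mul_collinear)

lemma midpoint_defect_line: "midpoint_defect (\<lambda>t. h (mul y (t *\<^sub>R e))) w t = line_defect h e w (mul y (t *\<^sub>R e))"
  by (simp add: midpoint_defect_def line_defect_def mul_line_line)

lemma d_along_line: "e \<in> E \<Longrightarrow> d (mul y (s *\<^sub>R e)) (mul y (t *\<^sub>R e)) \<le> \<bar>t - s\<bar>"
  using d_line[of e "mul y (s *\<^sub>R e)" "t - s"] by (simp add: mul_line_line)

text \<open>The projection to the first layer is a homomorphism to a vector space, so a homomorphism can
  have arbitrary values on the horizontal basis.\<close>

lemma homomorphism_extending:
  fixes A :: "'a \<Rightarrow> 'b::real_vector"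
  shows "\<exists>T. (\<forall>x y. T (mul x y) = T x + T y) \<and> (\<forall>e\<in>E. \<forall>s. T (s *\<^sub>R e) = s *\<^sub>R A e)"
proof -
  obtain g where g: "linear g" "\<And>e. e \<in> E \<Longrightarrow> g e = A e"
    using linear_independent_extend[OF independent_E, of A] by blast
  have "pr 1 (mul x y) = pr 1 x + pr 1 y" for x y
  proof -
    have "mul x y - (x + y) \<in> tail (Suc (Suc 0))" by (rule mul_tail_approx) (auto simp: tail_1)
    then have "pr 1 (mul x y - (x + y)) = 0" by (rule pr_tail_0) simp
    then show ?thesis by (simp add: linear_diff[OF linear_pr] linear_add[OF linear_pr])
  qed
  then have "g (pr 1 (mul x y)) = g (pr 1 x) + g (pr 1 y)" for x y by (simp add: linear_add[OF g(1)])
  moreover have "g (pr 1 (s *\<^sub>R e)) = s *\<^sub>R A e" if "e \<in> E" for s e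
    using that g pr_layer[OF E_layer[OF that], of 1] by (simp add: linear_scale[OF linear_pr] linear_scale[OF g(1)])
  ultimately show ?thesis by (intro exI[of _ "\<lambda>x. g (pr 1 x)"]) auto
qed

text \<open>If \<open>h\<close> is nearly affine on horizontal segments of length \<open>R\<close>, a short step of size \<open>s\<close> in direction
  \<open>e\<close> from \<open>y\<close> changes \<open>h\<close> by nearly \<open>s / R\<close> times the increment over the segment of length \<open>R\<close> from \<open>y\<close>.
  The latter differs little from the increment over the parallel segment from the centre \<open>z\<close>,
  because the end points of the two segments are close. Hence the change is nearly \<open>s\<close> times a vector
  that depends only on \<open>e\<close>. The homomorphism with these values on the basis approximates \<open>h\<close> along any
  chain of horizontal steps, and every point of the small ball is reached by \<open>M\<close> steps.\<close>

lemma near_homomorphism_on_ball: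
  fixes h :: "'a \<Rightarrow> 'b::real_normed_vector"
  assumes fact: "\<And>x \<rho>. 0 < \<rho> \<Longrightarrow> d 0 x \<le> \<rho> \<Longrightarrow>
       \<exists>ps. x = hprod ps \<and> length ps \<le> M \<and> set ps \<subseteq> {-(C3 * \<rho>)..C3 * \<rho>} \<times> E"
    and rt: "\<And>e R \<eta> x y. e \<in> E \<Longrightarrow> 0 < R \<Longrightarrow> 0 < \<eta> \<Longrightarrow> \<eta> \<le> 1 \<Longrightarrow> d x y \<le> \<eta> * R \<Longrightarrow>
       d (mul x (R *\<^sub>R e)) (mul y (R *\<^sub>R e)) \<le> C4 * \<eta> powr (1 / real r) * R"
    and hL: "\<And>x y. norm (h x - h y) \<le> L * max (d x y) \<psi>"
    and pos: "C3 > 0" "C4 \<ge> 1" "L \<ge> 0" "R > 0" "\<rho> > 0" "0 < \<eta>" "\<eta> \<le> 1" "M \<ge> 1" "\<psi> \<ge> 0"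
    and \<theta>: "\<theta> \<ge> 0"
    and small: "real M * C3 * \<rho> \<le> \<eta> * R" "\<psi> \<le> R / 2 ^ n"
    and good: "\<And>e y i l. e \<in> E \<Longrightarrow> d z y \<le> \<eta> * R \<Longrightarrow> i < n \<Longrightarrow> l < (2::nat) ^ i \<Longrightarrow>
       line_defect h e (R / 2 ^ i) (mul y ((real l * (R / 2 ^ i)) *\<^sub>R e)) \<le> \<theta> * L * (R / 2 ^ i)"
  shows "\<exists>T v. (\<forall>x y. T (mul x y) = T x + T y) \<and> (\<forall>x. d z x \<le> \<rho> \<longrightarrow>
    norm (h x - T x - v) \<le> M * (L * R * (\<theta> + 2 / 2 ^ n) + (C3 * \<rho> / R) * (2 * L * (C4 * \<eta> powr (1 / real r) * R + \<psi>))))"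
proof -
  define Err where "Err = L * R * (\<theta> + 2 / 2 ^ n) + (C3 * \<rho> / R) * (2 * L * (C4 * \<eta> powr (1 / real r) * R + \<psi>))"
  define A where "A e = (1 / R) *\<^sub>R (h (mul z (R *\<^sub>R e)) - h z)" for e
  obtain T :: "'a \<Rightarrow> 'b" where T: "\<And>x y. T (mul x y) = T x + T y" "\<And>e s. e \<in> E \<Longrightarrow> T (s *\<^sub>R e) = s *\<^sub>R A e"
    using homomorphism_extending[of A] by blast
  have C3\<rho>: "C3 * \<rho> \<le> \<eta> * R"
  proof -
    have "1 * (C3 * \<rho>) \<le> real M * (C3 * \<rho>)" using pos by (intro mult_right_mono) auto
    then show ?thesis using small(1) by (simp add: mult.assoc)
  qed
  also have "\<eta> * R \<le> 1 * R" using pos by (intro mult_right_mono) auto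
  finally have C3\<rho>R: "C3 * \<rho> \<le> R" by simp
  have \<psi>R: "\<psi> \<le> R"
  proof -
    have "R / 2 ^ n \<le> R / 1" using pos by (intro divide_left_mono) auto
    then show ?thesis using small(2) by simp
  qed
  have pos_step: "norm (h (mul y (s *\<^sub>R e)) - h y - s *\<^sub>R A e) \<le> Err"
    if e: "e \<in> E" and y: "d z y \<le> \<eta> * R" and s: "0 \<le> s" "s \<le> C3 * \<rho>" for e y s
  proof -
    define f where "f t = h (mul y (t *\<^sub>R e))" for t
    \<comment> \<open>Round \<open>s\<close> down to the grid of mesh \<open>R / 2 ^ n\<close>, the finest on which the defects are controlled.\<close>
    define l where "l = nat \<lfloor>s * 2 ^ n / R\<rfloor>"
    define s' where "s' = real l * (R / 2 ^ n)"
    have sR: "s \<le> R" using s C3\<rho>R by simp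
    have l1: "real l \<le> s * 2 ^ n / R" "s * 2 ^ n / R < real l + 1"
      unfolding l_def using s pos by (auto simp: of_nat_nat)
    have ss: "s = (s * 2 ^ n / R) * (R / 2 ^ n)" using pos by simp
    have "s' \<le> (s * 2 ^ n / R) * (R / 2 ^ n)"
      unfolding s'_def using l1(1) pos by (intro mult_right_mono) auto
    moreover have "(s * 2 ^ n / R) * (R / 2 ^ n) \<le> (real l + 1) * (R / 2 ^ n)"
      using l1(2) pos by (intro mult_right_mono) auto
    ultimately have s's: "s' \<le> s" "s - s' \<le> R / 2 ^ n"
      using ss unfolding s'_def distrib_right by linarith+
    have "s * 2 ^ n / R \<le> R * 2 ^ n / R" using sR pos by (intro divide_right_mono mult_right_mono) auto
    from order_trans[OF l1(1) this] have l2: "l \<le> 2 ^ n" using pos by simp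
    have "norm (f s' - f 0 - (real l / 2 ^ n) *\<^sub>R (f R - f 0)) \<le> \<theta> * L * R * (1 - 1 / 2 ^ n)"
      unfolding s'_def
    proof (rule dyadic_interpolation[OF \<open>R > 0\<close> _ l2])
      fix i l assume "i < n" "l < (2::nat) ^ i"
      then show "midpoint_defect f (R / 2 ^ i) (real l * (R / 2 ^ i)) \<le> \<theta> * L * (R / 2 ^ i)"
        unfolding f_def midpoint_defect_line using good[OF e y] by blast
    qed
    also have "\<dots> \<le> \<theta> * L * R"
      using \<theta> pos by (simp add: mult_left_le)
    finally have a: "norm (f s' - f 0 - (real l / 2 ^ n) *\<^sub>R (f R - f 0)) \<le> \<theta> * L * R" .
    have "norm (f s - f s') \<le> L * max (d (mul y (s *\<^sub>R e)) (mul y (s' *\<^sub>R e))) \<psi>"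
      unfolding f_def by (rule hL)
    also have "\<dots> \<le> L * (R / 2 ^ n)"
      using d_along_line[OF e, of y s s'] s's small(2) pos by (intro mult_left_mono) auto
    finally have b: "norm (f s - f s') \<le> L * (R / 2 ^ n)" .
    have "norm (f R - f 0) \<le> L * max (d (mul y (R *\<^sub>R e)) (mul y (0 *\<^sub>R e))) \<psi>"
      unfolding f_def by (rule hL)
    also have "\<dots> \<le> L * R"
      using d_along_line[OF e, of y R 0] \<psi>R pos by (intro mult_left_mono) auto
    finally have fR: "norm (f R - f 0) \<le> L * R" .
    have "\<bar>real l / 2 ^ n - s / R\<bar> \<le> 1 / 2 ^ n"
    proof -
      have "real l / 2 ^ n = s' / R" using pos by (simp add: s'_def)
      then have "\<bar>real l / 2 ^ n - s / R\<bar> = (s - s') / R" using s's pos by (simp add: abs_if field_simps)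
      also have "\<dots> \<le> (R / 2 ^ n) / R" using s's pos by (intro divide_right_mono) auto
      finally show ?thesis using pos by simp
    qed
    then have c: "norm ((real l / 2 ^ n - s / R) *\<^sub>R (f R - f 0)) \<le> (1 / 2 ^ n) * (L * R)"
      using fR pos unfolding norm_scaleR by (intro mult_mono) auto
    have "d (mul y (R *\<^sub>R e)) (mul z (R *\<^sub>R e)) \<le> C4 * \<eta> powr (1 / real r) * R"
      using y by (intro rt e pos) (simp add: d_sym)
    moreover have "0 \<le> C4 * \<eta> powr (1 / real r) * R" using pos by simp
    ultimately have "max (d (mul y (R *\<^sub>R e)) (mul z (R *\<^sub>R e))) \<psi> \<le> C4 * \<eta> powr (1 / real r) * R + \<psi>"
      using pos by auto
    then have d1: "norm (h (mul y (R *\<^sub>R e)) - h (mul z (R *\<^sub>R e))) \<le> L * (C4 * \<eta> powr (1 / real r) * R + \<psi>)"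
      using pos by (intro order_trans[OF hL] mult_left_mono) auto
    have "\<eta> \<le> \<eta> powr (1 / real r)"
    proof -
      have "\<eta> powr 1 \<le> \<eta> powr (1 / real r)" using pos step_pos by (intro powr_mono') auto
      then show ?thesis using pos by simp
    qed
    then have "\<eta> * R \<le> C4 * \<eta> powr (1 / real r) * R"
      using pos by (intro mult_right_mono) (auto intro: order_trans[of _ "1 * \<eta> powr (1 / real r)"] mult_right_mono)
    then have "max (d y z) \<psi> \<le> C4 * \<eta> powr (1 / real r) * R + \<psi>"
      using y \<open>\<psi> \<ge> 0\<close> d_sym[of y z] \<open>0 \<le> C4 * \<eta> powr (1 / real r) * R\<close> by (intro max.boundedI) linarith+
    then have d2: "norm (h y - h z) \<le> L * (C4 * \<eta> powr (1 / real r) * R + \<psi>)"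
      using pos by (intro order_trans[OF hL] mult_left_mono) auto
    have "norm ((f R - f 0) - R *\<^sub>R A e) \<le> 2 * L * (C4 * \<eta> powr (1 / real r) * R + \<psi>)"
    proof -
      have "(f R - f 0) - R *\<^sub>R A e = (h (mul y (R *\<^sub>R e)) - h (mul z (R *\<^sub>R e))) - (h y - h z)"
        using pos by (simp add: f_def A_def)
      then show ?thesis using d1 d2 norm_triangle_ineq4[of "h (mul y (R *\<^sub>R e)) - h (mul z (R *\<^sub>R e))" "h y - h z"] by simp
    qed
    moreover have "s / R \<le> C3 * \<rho> / R" using s pos by (intro divide_right_mono) auto
    ultimately have e': "norm ((s / R) *\<^sub>R ((f R - f 0) - R *\<^sub>R A e)) \<le> (C3 * \<rho> / R) * (2 * L * (C4 * \<eta> powr (1 / real r) * R + \<psi>))"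
      using s pos unfolding norm_scaleR by (intro mult_mono) auto
    have "h (mul y (s *\<^sub>R e)) - h y - s *\<^sub>R A e
       = (f s - f s') + (f s' - f 0 - (real l / 2 ^ n) *\<^sub>R (f R - f 0)) + (real l / 2 ^ n - s / R) *\<^sub>R (f R - f 0)
         + (s / R) *\<^sub>R ((f R - f 0) - R *\<^sub>R A e)"
      using pos by (simp add: f_def algebra_simps)
    then have "norm (h (mul y (s *\<^sub>R e)) - h y - s *\<^sub>R A e) \<le> norm (f s - f s')
        + norm (f s' - f 0 - (real l / 2 ^ n) *\<^sub>R (f R - f 0)) + norm ((real l / 2 ^ n - s / R) *\<^sub>R (f R - f 0))
         + norm ((s / R) *\<^sub>R ((f R - f 0) - R *\<^sub>R A e))"
      by (simp only:) (intro order_trans[OF norm_triangle_ineq] add_right_mono norm_triangle_ineq)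
    also have "\<dots> \<le> L * (R / 2 ^ n) + \<theta> * L * R + (1 / 2 ^ n) * (L * R)
       + (C3 * \<rho> / R) * (2 * L * (C4 * \<eta> powr (1 / real r) * R + \<psi>))"
      using a b c e' by linarith
    also have "\<dots> = Err" by (simp add: Err_def algebra_simps)
    finally show ?thesis .
  qed
  have step: "norm (h (mul y (s *\<^sub>R e)) - h y - s *\<^sub>R A e) \<le> Err"
    if e: "e \<in> E" and y: "d z y \<le> \<eta> * R" "d z (mul y (s *\<^sub>R e)) \<le> \<eta> * R" and s: "\<bar>s\<bar> \<le> C3 * \<rho>" for e y s
  proof (cases "0 \<le> s")
    case True
    then show ?thesis using pos_step[OF e y(1)] s by simp
  next
    case False
    \<comment> \<open>A negative step is a positive one, run backwards from its end point.\<close>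
    have "norm (h (mul (mul y (s *\<^sub>R e)) ((- s) *\<^sub>R e)) - h (mul y (s *\<^sub>R e)) - (- s) *\<^sub>R A e) \<le> Err"
      using False s by (intro pos_step[OF e y(2)]) auto
    then have "norm (- (h (mul y (s *\<^sub>R e)) - h y - s *\<^sub>R A e)) \<le> Err"
      unfolding mul_line_line by (simp add: algebra_simps)
    then show ?thesis by (simp only: norm_minus_cancel)
  qed
  have path: "norm (h (mul y (hprod ps)) - h y - T (hprod ps)) \<le> real (length ps) * Err"
    if "d z y + real (length ps) * (C3 * \<rho>) \<le> \<eta> * R" "set ps \<subseteq> {-(C3 * \<rho>)..C3 * \<rho>} \<times> E" for y ps
    using that
  proof (induction ps arbitrary: y)
    case Nil
    have "T 0 = 0" using T(1)[of 0 0] by simp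
    then show ?case by simp
  next
    case (Cons q ps)
    obtain s e where q: "q = (s, e)" by (cases q)
    have e: "e \<in> E" and s: "\<bar>s\<bar> \<le> C3 * \<rho>" using Cons.prems(2) q by auto
    let ?y = "mul y (s *\<^sub>R e)"
    have "d z ?y \<le> d z y + C3 * \<rho>" using d_triangle[of z ?y y] d_line[OF e, of y s] s by simp
    then have 1: "d z ?y + real (length ps) * (C3 * \<rho>) \<le> \<eta> * R" using Cons.prems(1) by (simp add: algebra_simps)
    have 2: "norm (h (mul ?y (hprod ps)) - h ?y - T (hprod ps)) \<le> real (length ps) * Err"
      using Cons.IH[OF 1] Cons.prems(2) by simp
    have nn: "0 \<le> C3 * \<rho>" "0 \<le> real (length ps) * (C3 * \<rho>)" using pos by auto
    have 3: "norm (h ?y - h y - s *\<^sub>R A e) \<le> Err"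
      using 1 nn Cons.prems(1) by (intro step e s) (auto simp: algebra_simps)
    have "h (mul y (hprod (q # ps))) - h y - T (hprod (q # ps))
      = (h (mul ?y (hprod ps)) - h ?y - T (hprod ps)) + (h ?y - h y - s *\<^sub>R A e)"
      by (simp add: q hprod_Cons T e mul_assoc)
    note eq = this
    have "norm (h (mul y (hprod (q # ps))) - h y - T (hprod (q # ps))) \<le> real (length ps) * Err + Err"
      unfolding eq using 2 3 norm_triangle_ineq[of "h (mul ?y (hprod ps)) - h ?y - T (hprod ps)" "h ?y - h y - s *\<^sub>R A e"]
      by linarith
    then show ?case by (simp add: algebra_simps)
  qed
  have Err0: "Err \<ge> 0"
    unfolding Err_def using \<theta> pos by (intro add_nonneg_nonneg mult_nonneg_nonneg divide_nonneg_nonneg) auto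
  have "norm (h x - T x - (h z - T z)) \<le> real M * Err" if x: "d z x \<le> \<rho>" for x
  proof -
    define w where "w = mul (- z) x"
    have xw: "x = mul z w" by (simp add: w_def)
    have "d 0 w \<le> \<rho>" using x d_left[of "- z" z x] by (simp add: w_def)
    then obtain ps where ps: "w = hprod ps" "length ps \<le> M" "set ps \<subseteq> {-(C3 * \<rho>)..C3 * \<rho>} \<times> E"
      using fact pos by blast
    have "real (length ps) * (C3 * \<rho>) \<le> real M * (C3 * \<rho>)" using ps(2) pos by (intro mult_right_mono) auto
    then have "norm (h (mul z (hprod ps)) - h z - T (hprod ps)) \<le> real (length ps) * Err"
      using small(1) ps(3) by (intro path) (auto simp: mult.assoc)
    also have "\<dots> \<le> real M * Err" using ps(2) Err0 by (intro mult_right_mono) auto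
    finally show ?thesis using T(1)[of z w] by (simp add: xw ps(1) algebra_simps)
  qed
  then show ?thesis using T(1) unfolding Err_def by (intro exI[of _ T] exI[of _ "h z - T z"]) blast
qed

end

section \<open>Dyadic scales\<close>

text \<open>The scales on lines are dyadic, whereas the side lengths of cubes are powers of \<open>\<tau>\<close>. This is the
  exponent of the dyadic scale next to \<open>t\<close>.\<close>

definition dyadic_level :: "real \<Rightarrow> nat" where
  "dyadic_level t = (LEAST n. (1 / 2) ^ n \<le> t)"

lemma dyadic_level:
  assumes "0 < t" "t \<le> 1"
  shows "1 / 2 ^ dyadic_level t \<le> t" "t < 2 / 2 ^ dyadic_level t"
proof -
  obtain n where "(1 / 2 :: real) ^ n < t" using real_arch_pow_inv[of t "1 / 2"] assms by auto
  then have "(1 / 2 :: real) ^ dyadic_level t \<le> t"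
    unfolding dyadic_level_def using LeastI[of "\<lambda>n. (1 / 2 :: real) ^ n \<le> t" n] by simp
  then show "1 / 2 ^ dyadic_level t \<le> t" by (simp add: power_one_over)
  show "t < 2 / 2 ^ dyadic_level t"
  proof (cases "dyadic_level t")
    case 0
    then show ?thesis using assms by simp
  next
    case (Suc n)
    then have "\<not> (1 / 2 :: real) ^ n \<le> t" unfolding dyadic_level_def by (metis lessI not_less_Least)
    then show ?thesis using Suc by (simp add: power_one_over)
  qed
qed

lemma dyadic_level_least: "1 / 2 ^ n \<le> t \<Longrightarrow> dyadic_level t \<le> n"
  unfolding dyadic_level_def by (rule Least_le) (simp add: power_one_over)

lemma dyadic_level_antimono: "0 < s \<Longrightarrow> s \<le> t \<Longrightarrow> t \<le> 1 \<Longrightarrow> dyadic_level t \<le> dyadic_level s"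
  using dyadic_level(1)[of s] by (intro dyadic_level_least) auto

lemma dyadic_level_half:
  assumes "0 < s" "s \<le> t / 2" "t \<le> 1"
  shows "dyadic_level t < dyadic_level s"
proof -
  have s: "1 / 2 ^ dyadic_level s \<le> s" using assms by (intro dyadic_level) auto
  have "dyadic_level s \<noteq> 0"
  proof
    assume "dyadic_level s = 0"
    then show False using s assms by simp
  qed
  then obtain n where n: "dyadic_level s = Suc n" by (cases "dyadic_level s") auto
  then have "1 / 2 ^ n \<le> t" using s assms by simp
  then show ?thesis using dyadic_level_least n by fastforce
qed

text \<open>The monotone function \<open>\<phi>\<close> takes each value on a set of integers contained in an interval of
  length \<open>q\<close>.\<close>

lemma sum_bounded_multiplicity:
  fixes g :: "nat \<Rightarrow> ennreal"
  assumes mono: "\<And>k k'. k \<le> k' \<Longrightarrow> \<phi> k \<le> \<phi> k'" and q: "\<And>k. \<phi> k < \<phi> (k + q)" and N: "\<phi> m < N"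
  shows "(\<Sum>k\<le>m. g (\<phi> k)) \<le> of_nat q * (\<Sum>n<N. g n)"
proof -
  have card: "card {k. k \<le> m \<and> \<phi> k = n} \<le> q" for n
  proof (cases "\<exists>k. \<phi> k = n")
    case True
    define k0 where "k0 = (LEAST k. \<phi> k = n)"
    have k0: "\<phi> k0 = n" unfolding k0_def using True by (rule LeastI_ex)
    have "{k. k \<le> m \<and> \<phi> k = n} \<subseteq> {k0..<k0 + q}"
    proof
      fix k assume k: "k \<in> {k. k \<le> m \<and> \<phi> k = n}"
      then have "k0 \<le> k" unfolding k0_def by (intro Least_le) auto
      moreover have "\<not> k0 + q \<le> k"
      proof
        assume "k0 + q \<le> k"
        then have "\<phi> (k0 + q) \<le> \<phi> k" by (rule mono)
        then show False using q[of k0] k k0 by auto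
      qed
      ultimately show "k \<in> {k0..<k0 + q}" by auto
    qed
    then have "card {k. k \<le> m \<and> \<phi> k = n} \<le> card {k0..<k0 + q}" by (intro card_mono) auto
    then show ?thesis by simp
  qed simp
  have "(\<Sum>k\<le>m. g (\<phi> k)) = (\<Sum>k\<le>m. \<Sum>n<N. if n = \<phi> k then g n else 0)"
  proof (rule sum.cong[OF refl])
    fix k assume "k \<in> {..m}"
    then have "\<phi> k < N" using mono[of k m] N by simp
    then show "g (\<phi> k) = (\<Sum>n<N. if n = \<phi> k then g n else 0)" by simp
  qed
  also have "\<dots> = (\<Sum>n<N. \<Sum>k\<le>m. if n = \<phi> k then g n else 0)" by (rule sum.swap)
  also have "\<dots> = (\<Sum>n<N. of_nat (card {k. k \<le> m \<and> \<phi> k = n}) * g n)"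
  proof (rule sum.cong[OF refl])
    fix n
    have "{..m} \<inter> {k. n = \<phi> k} = {k. k \<le> m \<and> \<phi> k = n}" by auto
    then show "(\<Sum>k\<le>m. if n = \<phi> k then g n else 0) = of_nat (card {k. k \<le> m \<and> \<phi> k = n}) * g n"
      by (simp add: sum.If_cases)
  qed
  also have "\<dots> \<le> (\<Sum>n<N. of_nat q * g n)"
    using card by (intro sum_mono mult_right_mono) auto
  finally show ?thesis by (simp add: sum_distrib_left)
qed

context carnot_group
begin

section \<open>Bent and straight lines\<close>

text \<open>On every line, \<open>dyadic_energy\<close> bounds the total weight of the dyadic intervals whose starting point lies
  in the sets \<open>U n\<close>. Integrate this over all parallel lines: right translations preserve the measure, so
  each of the \<open>2 ^ n\<close> intervals of level \<open>n\<close> contributes the full measure of \<open>U n\<close>, with weight \<open>1 / 2 ^ n\<close>.\<close>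

lemma measure_of_bent_points:
  fixes h :: "'a \<Rightarrow> 'b::real_normed_vector"
  assumes convexity: "\<And>x y z :: 'b.
          (norm (x - y) powr p + norm (y - z) powr p) / 2
            \<ge> norm ((1 / 2) *\<^sub>R (x - z)) powr p + norm ((1 / (2 * K)) *\<^sub>R (x + z - 2 *\<^sub>R y)) powr p"
    and pos: "K > 0" "u > 0" "L > 0" "c > 0" "p \<ge> 0" and e: "e \<in> E"
    and hL: "\<And>x y. norm (h x - h y) \<le> L * max (d x y) \<psi>" and \<psi>: "\<psi> \<le> u / 2 ^ N"
    and U: "\<And>n. U n \<in> sets borel" and S': "S' \<in> sets borel"
    and dev: "\<And>n y. n < N \<Longrightarrow> y \<in> U n \<Longrightarrow> c * L * (u / 2 ^ n) \<le> line_defect h e (u / 2 ^ n) y"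
    and US: "\<And>n y t. n < N \<Longrightarrow> y \<in> U n \<Longrightarrow> 0 \<le> t \<Longrightarrow> t \<le> u \<Longrightarrow> mul y ((- t) *\<^sub>R e) \<in> S'"
  shows "(\<Sum>n<N. emeasure lborel (U n)) \<le> ennreal ((K / c) powr p) * emeasure lborel S'"
proof -
  define w where "w n = u / 2 ^ n" for n :: nat
  have w: "w n > 0" for n using pos by (simp add: w_def)
  define P where "P n l = {x. mul x ((real l * w n) *\<^sub>R e) \<in> U n}" for n l :: nat
  have lw: "0 \<le> real l * w n" "l < 2 ^ n \<Longrightarrow> real l * w n \<le> u" for n l
  proof -
    show "0 \<le> real l * w n" using w[of n] by simp
    assume "l < 2 ^ n"
    then have "real l \<le> 2 ^ n" by (metis less_imp_le of_nat_le_iff of_nat_numeral of_nat_power)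
    then have "real l * w n \<le> 2 ^ n * w n" using w[of n] by (intro mult_right_mono) auto
    then show "real l * w n \<le> u" by (simp add: w_def)
  qed
  have Pm: "P n l \<in> sets borel" for n l
  proof -
    have "(\<lambda>x. mul x ((real l * w n) *\<^sub>R e)) \<in> borel_measurable borel"
      by (intro borel_measurable_continuous_onI continuous_on_mul continuous_on_id continuous_on_const)
    from measurable_sets[OF this U[of n]] show ?thesis by (simp add: P_def vimage_def)
  qed
  have PS: "x \<in> S'" if "n < N" "l < 2 ^ n" "x \<in> P n l" for x n l
    using US[OF that(1), of "mul x ((real l * w n) *\<^sub>R e)" "real l * w n"] that lw
    by (simp add: P_def mul_line_line)
  have real_bound: "(\<Sum>n<N. (1 / 2 ^ n) * (\<Sum>l<2 ^ n. indicator (P n l) x)) \<le> (K / c) powr p" for x :: 'a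
  proof -
    define f where "f t = h (mul x (t *\<^sub>R e))" for t
    define b where "b = (c * L / K) powr p"
    have b: "b > 0" using pos by (simp add: b_def)
    have "(\<Sum>n<N. (1 / 2 ^ n) * (\<Sum>l<2 ^ n. indicator (P n l) x)) * b
       = (\<Sum>n<N. (1 / 2 ^ n) * (\<Sum>l<2 ^ n. indicator (P n l) x * b))"
      by (simp add: sum_distrib_right mult.assoc)
    also have "\<dots> \<le> (\<Sum>n<N. (1 / 2 ^ n) * (\<Sum>l<2 ^ n. (midpoint_defect f (w n) (real l * w n) / (K * w n)) powr p))"
    proof (intro sum_mono mult_left_mono)
      fix n l assume n: "n \<in> {..<N}"
      show "indicator (P n l) x * b \<le> (midpoint_defect f (w n) (real l * w n) / (K * w n)) powr p"
      proof (cases "x \<in> P n l")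
        case True
        then have "c * L * w n \<le> midpoint_defect f (w n) (real l * w n)"
          using dev[of n "mul x ((real l * w n) *\<^sub>R e)"] n
          unfolding f_def midpoint_defect_line by (simp add: P_def w_def)
        then have "c * L * w n / (K * w n) \<le> midpoint_defect f (w n) (real l * w n) / (K * w n)"
          using w[of n] pos by (intro divide_right_mono) auto
        moreover have "c * L * w n / (K * w n) = c * L / K" using w[of n] by simp
        ultimately have "b \<le> (midpoint_defect f (w n) (real l * w n) / (K * w n)) powr p"
          unfolding b_def using pos by (intro powr_mono2) auto
        then show ?thesis using True by simp
      qed simp
    qed simp
    also have "\<dots> \<le> (1 / 2 ^ N) * (\<Sum>l<2 ^ N. (norm (f (real l * w N + w N) - f (real l * w N)) / w N) powr p)"
      unfolding w_def by (rule dyadic_energy[OF convexity pos(1,2)])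
    also have "\<dots> \<le> (1 / 2 ^ N) * (\<Sum>l<(2::nat) ^ N. L powr p)"
    proof (intro mult_left_mono sum_mono powr_mono2)
      fix l
      have "norm (f (real l * w N + w N) - f (real l * w N))
          \<le> L * max (d (mul x ((real l * w N + w N) *\<^sub>R e)) (mul x ((real l * w N) *\<^sub>R e))) \<psi>"
        unfolding f_def by (rule hL)
      also have "\<dots> \<le> L * w N"
        using d_along_line[OF e, of x "real l * w N + w N" "real l * w N"] \<psi> pos w[of N]
        by (intro mult_left_mono) (auto simp: w_def)
      finally show "norm (f (real l * w N + w N) - f (real l * w N)) / w N \<le> L"
        using w[of N] by (simp add: divide_le_eq)
      show "0 \<le> norm (f (real l * w N + w N) - f (real l * w N)) / w N" using w[of N] by simp
    qed (use pos in auto)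
    also have "\<dots> = L powr p" by simp
    finally have "(\<Sum>n<N. (1 / 2 ^ n) * (\<Sum>l<2 ^ n. indicator (P n l) x)) \<le> L powr p / b"
      using b by (simp add: le_divide_eq)
    also have "L powr p / b = (K / c) powr p"
      unfolding b_def using pos by (simp add: powr_divide[symmetric])
    finally show ?thesis .
  qed
  have bound: "(\<Sum>n<N. ennreal (1 / 2 ^ n) * (\<Sum>l<2 ^ n. indicator (P n l) x)) \<le> ennreal ((K / c) powr p) * indicator S' x" for x
  proof (cases "x \<in> S'")
    case True
    have "(\<Sum>l<(2::nat) ^ n. indicator (P n l) x) = ennreal (\<Sum>l<(2::nat) ^ n. indicator (P n l) x)" for n
      by (subst sum_ennreal[symmetric]) (auto simp: ennreal_indicator)
    then have "(\<Sum>n<N. ennreal (1 / 2 ^ n) * (\<Sum>l<2 ^ n. indicator (P n l) x))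
        = (\<Sum>n<N. ennreal ((1 / 2 ^ n) * (\<Sum>l<2 ^ n. indicator (P n l) x)))"
      by (intro sum.cong refl) (simp only: ennreal_mult' divide_nonneg_nonneg zero_le_one zero_le_power zero_le_numeral)
    also have "\<dots> = ennreal (\<Sum>n<N. (1 / 2 ^ n) * (\<Sum>l<2 ^ n. indicator (P n l) x))"
      by (intro sum_ennreal mult_nonneg_nonneg sum_nonneg) auto
    also have "\<dots> \<le> ennreal ((K / c) powr p)" by (rule ennreal_leI[OF real_bound])
    finally show ?thesis using True by simp
  next
    case False
    then have "indicator (P n l) x = (0::ennreal)" if "n < N" "l < 2 ^ n" for n l
      using PS that by (auto simp: indicator_def)
    then show ?thesis by simp
  qed
  have "(\<Sum>n<N. emeasure lborel (U n)) = (\<Sum>n<N. ennreal (1 / 2 ^ n) * (\<Sum>l<(2::nat) ^ n. emeasure lborel (P n l)))"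
  proof (rule sum.cong[OF refl])
    fix n
    have "(\<Sum>l<(2::nat) ^ n. emeasure lborel (P n l)) = ennreal (2 ^ n) * emeasure lborel (U n)"
      unfolding P_def right_translation_measure[OF U] by (simp add: ennreal_power[symmetric])
    then show "emeasure lborel (U n) = ennreal (1 / 2 ^ n) * (\<Sum>l<(2::nat) ^ n. emeasure lborel (P n l))"
      by (simp add: mult.assoc[symmetric] ennreal_mult[symmetric])
  qed
  also have "\<dots> = (\<integral>\<^sup>+x. (\<Sum>n<N. ennreal (1 / 2 ^ n) * (\<Sum>l<2 ^ n. indicator (P n l) x)) \<partial>lborel)"
    using Pm by (simp add: nn_integral_sum nn_integral_cmult)
  also have "\<dots> \<le> (\<integral>\<^sup>+x. ennreal ((K / c) powr p) * indicator S' x \<partial>lborel)"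
    by (intro nn_integral_mono bound)
  also have "\<dots> = ennreal ((K / c) powr p) * emeasure lborel S'"
    using S' by (simp add: nn_integral_cmult)
  finally show ?thesis .
qed

text \<open>A bend persists in a ball of radius \<open>\<kappa> w\<close>: the three points of the segment move by at most \<open>\<theta> w / 8\<close>
  when the starting point moves by \<open>\<kappa> w\<close>, and at this distance \<open>h\<close> obeys the Lipschitz bound up to the
  cut-off \<open>\<psi>\<close>. For an arbitrary map \<open>h\<close> the set of bent points may fail to be measurable; a
  union of such balls is open.\<close>

lemma line_defect_stable:
  fixes h :: "'a \<Rightarrow> 'b::real_normed_vector"
  assumes rt: "\<And>e R \<eta> x y. e \<in> E \<Longrightarrow> 0 < R \<Longrightarrow> 0 < \<eta> \<Longrightarrow> \<eta> \<le> 1 \<Longrightarrow> d x y \<le> \<eta> * R \<Longrightarrow>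
       d (mul x (R *\<^sub>R e)) (mul y (R *\<^sub>R e)) \<le> C4 * \<eta> powr (1 / real r) * R"
    and hL: "\<And>x y. norm (h x - h y) \<le> L * max (d x y) \<psi>"
    and pos: "C4 \<ge> 1" "L \<ge> 0" "w > 0" "0 < \<theta>" "\<theta> \<le> 1" and e: "e \<in> E"
    and \<psi>: "\<psi> \<le> \<theta> * w / 8" and \<kappa>: "\<kappa> = (\<theta> / (8 * C4)) ^ r / 2" and xy: "d x y \<le> \<kappa> * w"
  shows "line_defect h e w x - \<theta> / 2 * L * w \<le> line_defect h e w y"
proof -
  let ?q = "\<theta> / (8 * C4)"
  have q: "0 < ?q" "?q \<le> 1" "?q \<le> \<theta> / 8"
  proof -
    show "0 < ?q" using pos by simp
    show 1: "?q \<le> \<theta> / 8" using pos by (intro divide_left_mono) auto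
    then show "?q \<le> 1" using pos by simp
  qed
  have qr: "?q ^ r \<le> 1" "0 < ?q ^ r" "(?q ^ r) powr (1 / real r) = ?q"
  proof -
    show "?q ^ r \<le> 1" using q by (intro power_le_one) auto
    show "0 < ?q ^ r" using q(1) by (rule zero_less_power)
    have "(?q ^ r) powr (1 / real r) = (?q powr real r) powr (1 / real r)" by (simp only: powr_realpow[OF q(1)])
    also have "\<dots> = ?q powr 1" unfolding powr_powr using step_pos by simp
    finally show "(?q ^ r) powr (1 / real r) = ?q" using q(1) by (simp only: powr_one)
  qed
  have shift: "norm (h (mul x (s *\<^sub>R e)) - h (mul y (s *\<^sub>R e))) \<le> L * (\<theta> * w / 8)" if s: "w / 2 \<le> s" "s \<le> w" for s
  proof -
    have s0: "s > 0" using s pos by simp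
    \<comment> \<open>The factor 1/2 in \<open>\<kappa>\<close> covers the segment of length \<open>w / 2\<close> that ends at the midpoint.\<close>
    have "?q ^ r / 2 * w \<le> ?q ^ r * s"
      using s qr mult_left_mono[of "w / 2" s "?q ^ r"] by simp
    then have "d x y \<le> ?q ^ r * s" using xy \<kappa> by simp
    then have "d (mul x (s *\<^sub>R e)) (mul y (s *\<^sub>R e)) \<le> C4 * ?q * s"
      using rt[OF e s0 qr(2,1), of x y] qr(3) by simp
    also have "\<dots> = \<theta> / 8 * s" using pos by simp
    also have "\<dots> \<le> \<theta> / 8 * w" using s pos by (intro mult_left_mono) auto
    finally show ?thesis
      using \<psi> pos by (intro order_trans[OF hL] mult_left_mono) auto
  qed
  have "?q ^ r \<le> ?q ^ 1" using q step_pos by (intro power_decreasing) auto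
  then have "\<kappa> \<le> \<theta> / 8" using q \<kappa> by simp
  then have "\<kappa> * w \<le> \<theta> / 8 * w" using pos by (intro mult_right_mono) auto
  then have "max (d x y) \<psi> \<le> \<theta> * w / 8"
    using xy \<psi> by (intro max.boundedI) linarith+
  then have 1: "norm (h x - h y) \<le> L * (\<theta> * w / 8)"
    using pos by (intro order_trans[OF hL] mult_left_mono) auto
  have 2: "norm (h (mul x (w *\<^sub>R e)) - h (mul y (w *\<^sub>R e))) \<le> L * (\<theta> * w / 8)" using pos by (intro shift) auto
  have 3: "norm (h (mul x ((w / 2) *\<^sub>R e)) - h (mul y ((w / 2) *\<^sub>R e))) \<le> L * (\<theta> * w / 8)"
    using pos by (intro shift) auto
  let ?X = "h x + h (mul x (w *\<^sub>R e)) - 2 *\<^sub>R h (mul x ((w / 2) *\<^sub>R e))"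
  let ?Y = "h y + h (mul y (w *\<^sub>R e)) - 2 *\<^sub>R h (mul y ((w / 2) *\<^sub>R e))"
  have eq: "?X - ?Y = (h x - h y) + (h (mul x (w *\<^sub>R e)) - h (mul y (w *\<^sub>R e)))
      - 2 *\<^sub>R (h (mul x ((w / 2) *\<^sub>R e)) - h (mul y ((w / 2) *\<^sub>R e)))"
    by (simp add: scaleR_diff_right)
  have "norm (?X - ?Y) \<le> norm (h x - h y) + norm (h (mul x (w *\<^sub>R e)) - h (mul y (w *\<^sub>R e)))
      + 2 * norm (h (mul x ((w / 2) *\<^sub>R e)) - h (mul y ((w / 2) *\<^sub>R e)))"
    unfolding eq by (rule order_trans[OF norm_triangle_ineq4]) (simp add: norm_triangle_ineq)
  also have "\<dots> \<le> 4 * (L * (\<theta> * w / 8))" using 1 2 3 by linarith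
  also have "\<dots> = \<theta> / 2 * L * w" by simp
  finally have "norm (?X - ?Y) \<le> \<theta> / 2 * L * w" .
  moreover have "norm ?X - norm ?Y \<le> norm (?X - ?Y)" by (rule norm_triangle_ineq2)
  ultimately show ?thesis unfolding line_defect_def by linarith
qed

text \<open>The radius \<open>\<rho>\<close> is of order \<open>\<epsilon> ^ r B\<close>, so that right translation by \<open>R e\<close> spreads the ball to
  order \<open>\<epsilon> B\<close>, and the error \<open>\<theta> R\<close> along lines must be of order \<open>\<epsilon> \<rho>\<close>, which makes \<open>\<theta>\<close> of order
  \<open>\<epsilon> ^ (r + 1)\<close>. The two parts of the error bound of \<open>near_homomorphism_on_ball\<close> are then
  at most \<open>\<epsilon> L \<rho> / 2\<close> each.\<close>

lemma near_homomorphism_if_lines_straight: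
  fixes h :: "'a \<Rightarrow> 'b::real_normed_vector"
  assumes fact: "\<And>x \<rho>. 0 < \<rho> \<Longrightarrow> d 0 x \<le> \<rho> \<Longrightarrow>
       \<exists>ps. x = hprod ps \<and> length ps \<le> M \<and> set ps \<subseteq> {-(C3 * \<rho>)..C3 * \<rho>} \<times> E"
    and rt: "\<And>e R \<eta> x y. e \<in> E \<Longrightarrow> 0 < R \<Longrightarrow> 0 < \<eta> \<Longrightarrow> \<eta> \<le> 1 \<Longrightarrow> d x y \<le> \<eta> * R \<Longrightarrow>
       d (mul x (R *\<^sub>R e)) (mul y (R *\<^sub>R e)) \<le> C4 * \<eta> powr (1 / real r) * R"
    and hL: "\<And>x y. norm (h x - h y) \<le> L * max (d x y) \<psi>"
    and pos: "C3 > 0" "C4 \<ge> 1" "L \<ge> 0" "M \<ge> 1" "\<psi> \<ge> 0" "0 < \<epsilon>" "\<epsilon> < 1" "B > 0" "0 \<le> \<kappa>" "\<kappa> \<le> 1 / 2"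
    and A: "A = real M * C3"
    and \<zeta>: "\<zeta> > 0" "\<zeta> \<le> 1" "8 * A * \<zeta> \<le> 1" "8 * A * \<zeta> \<le> (1 / (8 * A * C4)) ^ r"
    and R: "B / 8 \<le> R" "R \<le> B / 4"
    and \<rho>: "\<rho> = \<zeta> * \<epsilon> ^ r * B" and \<theta>: "\<theta> = 2 * \<zeta> / (3 * real M) * \<epsilon> ^ (r + 1)"
    and n: "1 / 2 ^ n \<le> \<theta>" and \<psi>: "\<psi> \<le> R / 2 ^ n"
    and straight: "\<And>e i y. e \<in> E \<Longrightarrow> i < n \<Longrightarrow> dball d y (\<kappa> * (R / 2 ^ i)) \<subseteq> dball d z B \<Longrightarrow>
       line_defect h e (R / 2 ^ i) y \<le> \<theta> * L * (R / 2 ^ i)"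
  shows "\<exists>T v. (\<forall>x y. T (mul x y) = T x + T y) \<and> (\<forall>x. d z x \<le> \<rho> \<longrightarrow> norm (h x - T x - v) \<le> \<epsilon> * L * \<rho>)"
proof -
  have A0: "A > 0" using pos A by simp
  have R0: "R > 0" using R pos by linarith
  have \<rho>0: "\<rho> > 0" using \<rho> \<zeta> pos by simp
  have \<theta>0: "\<theta> \<ge> 0" using \<theta> \<zeta> pos by simp
  define \<eta> where "\<eta> = A * \<rho> / R"
  have \<eta>0: "\<eta> > 0" using A0 R0 \<rho>0 by (simp add: \<eta>_def)
  have "A * \<rho> = A * \<zeta> * \<epsilon> ^ r * B" by (simp add: \<rho>)
  also have "\<dots> \<le> A * \<zeta> * \<epsilon> ^ r * (8 * R)" using R A0 \<zeta> pos by (intro mult_left_mono) auto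
  finally have \<eta>1: "\<eta> \<le> 8 * A * \<zeta> * \<epsilon> ^ r" using R0 by (simp add: \<eta>_def divide_le_eq)
  also have "\<dots> \<le> (1 / (8 * A * C4)) ^ r * \<epsilon> ^ r" using \<zeta> pos by (intro mult_right_mono) auto
  also have "\<dots> = (\<epsilon> / (8 * A * C4)) ^ r" by (simp add: power_mult_distrib[symmetric])
  finally have "\<eta> powr (1 / real r) \<le> ((\<epsilon> / (8 * A * C4)) ^ r) powr (1 / real r)"
    using \<eta>0 by (intro powr_mono2) auto
  also have "\<dots> = \<epsilon> / (8 * A * C4)"
    using pos A0 step_pos by (simp add: powr_realpow[symmetric] powr_powr)
  finally have "C4 * \<eta> powr (1 / real r) \<le> C4 * (\<epsilon> / (8 * A * C4))" using pos by (intro mult_left_mono) auto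
  also have "\<dots> = \<epsilon> / (8 * A)" using pos by simp
  finally have \<eta>2: "C4 * \<eta> powr (1 / real r) \<le> \<epsilon> / (8 * A)" .
  have \<epsilon>r: "\<epsilon> ^ r \<le> 1" using pos by (intro power_le_one) auto
  have \<eta>3: "\<eta> \<le> 1"
  proof -
    have "8 * A * \<zeta> * \<epsilon> ^ r \<le> 1 * 1" using \<zeta> \<epsilon>r A0 pos by (intro mult_mono) auto
    then show ?thesis using \<eta>1 by simp
  qed
  have \<psi>R: "\<psi> / R \<le> \<epsilon> / (8 * A)"
  proof -
    have "\<psi> \<le> R * \<theta>" using \<psi> n R0 mult_left_mono[OF n, of R] by simp
    then have "\<psi> / R \<le> \<theta>" using R0 by (simp add: divide_le_eq mult.commute)
    also have "\<theta> \<le> \<zeta> * \<epsilon>"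
    proof -
      have "2 * \<zeta> / (3 * real M) \<le> \<zeta>" using \<zeta> pos by (simp add: field_simps)
      moreover have "\<epsilon> ^ (r + 1) \<le> \<epsilon>" using \<epsilon>r pos by (simp add: mult_left_le)
      ultimately show ?thesis unfolding \<theta> using pos \<zeta> by (intro mult_mono) auto
    qed
    also have "\<dots> \<le> \<epsilon> / (8 * A)" using \<zeta>(3) A0 pos by (simp add: field_simps)
    finally show ?thesis .
  qed
  have Mc: "real M * C3 * \<rho> \<le> \<eta> * R" using R0 by (simp add: \<eta>_def A)
  have good: "line_defect h e (R / 2 ^ i) (mul y ((real l * (R / 2 ^ i)) *\<^sub>R e)) \<le> \<theta> * L * (R / 2 ^ i)"
    if e: "e \<in> E" and y: "d z y \<le> \<eta> * R" and i: "i < n" and l: "l < (2::nat) ^ i" for e y i l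
  proof (rule straight[OF e i])
    let ?y = "mul y ((real l * (R / 2 ^ i)) *\<^sub>R e)"
    have "real l \<le> 2 ^ i" using l by (metis less_imp_le of_nat_le_iff of_nat_numeral of_nat_power)
    then have "real l * (R / 2 ^ i) \<le> 2 ^ i * (R / 2 ^ i)" using R0 by (intro mult_right_mono) auto
    then have "d y ?y \<le> R" using d_line[OF e, of y "real l * (R / 2 ^ i)"] R0 by simp
    moreover have "\<eta> * R \<le> 1 * R" using \<eta>3 R0 by (intro mult_right_mono) auto
    ultimately have zy: "d z ?y \<le> 2 * R" using d_triangle[of z ?y y] y by simp
    have "R / 2 ^ i \<le> R / 1" using R0 by (intro divide_left_mono) auto
    then have "\<kappa> * (R / 2 ^ i) \<le> 1 / 2 * R" using pos R0 by (intro mult_mono) auto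
    then have B: "2 * R + \<kappa> * (R / 2 ^ i) \<le> B" using R R0 by linarith
    show "dball d ?y (\<kappa> * (R / 2 ^ i)) \<subseteq> dball d z B"
    proof
      fix x assume "x \<in> dball d ?y (\<kappa> * (R / 2 ^ i))"
      then have "d ?y x < \<kappa> * (R / 2 ^ i)" by (simp add: dball_def)
      then have "d z x < B" using zy B d_triangle[of z x ?y] by linarith
      then show "x \<in> dball d z B" by (simp add: dball_def)
    qed
  qed
  obtain T v where T: "\<forall>x y. T (mul x y) = T x + T y" and Tv: "\<And>x. d z x \<le> \<rho> \<Longrightarrow>
    norm (h x - T x - v) \<le> M * (L * R * (\<theta> + 2 / 2 ^ n) + (C3 * \<rho> / R) * (2 * L * (C4 * \<eta> powr (1 / real r) * R + \<psi>)))"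
    using near_homomorphism_on_ball[OF fact rt hL pos(1,2,3) R0 \<rho>0 \<eta>0 \<eta>3 pos(4,5) \<theta>0 Mc \<psi> good] by blast
  have "M * (L * R * (\<theta> + 2 / 2 ^ n) + (C3 * \<rho> / R) * (2 * L * (C4 * \<eta> powr (1 / real r) * R + \<psi>)))
    = M * (L * R * (\<theta> + 2 / 2 ^ n)) + A * \<rho> * (2 * L * (C4 * \<eta> powr (1 / real r) + \<psi> / R))"
    using R0 by (simp add: A field_simps)
  also have "\<dots> \<le> M * (L * (B / 4) * (3 * \<theta>)) + A * \<rho> * (2 * L * (\<epsilon> / (8 * A) + \<epsilon> / (8 * A)))"
    using n R pos R0 A0 \<rho>0 \<eta>2 \<psi>R \<theta>0 by (intro add_mono mult_mono mult_left_mono) auto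
  also have "\<dots> = \<epsilon> * L * \<rho>"
    using pos A0 by (simp add: \<theta> \<rho> field_simps)
  finally show ?thesis using T Tv by (intro exI[of _ T] exI[of _ v]) (auto intro: order_trans)
qed

end

section \<open>Bad cubes\<close>

text \<open>As \<open>\<epsilon> < 1 / 2\<close>, a constant is at most a power of \<open>1 / \<epsilon>\<close>.\<close>

lemma constant_absorbed_in_power:
  fixes B s :: real
  shows "\<exists>\<alpha>>0. \<forall>\<epsilon>. 0 < \<epsilon> \<longrightarrow> \<epsilon> < 1 / 2 \<longrightarrow> B * \<epsilon> powr (- s) \<le> \<epsilon> powr (- \<alpha>)"
proof -
  define B' where "B' = max B 1"
  define \<alpha> where "\<alpha> = \<bar>s\<bar> + log 2 B' + 1"
  have l: "log 2 B' \<ge> 0" by (simp add: B'_def zero_le_log_cancel_iff)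
  have "B * \<epsilon> powr (- s) \<le> \<epsilon> powr (- \<alpha>)" if \<epsilon>: "0 < \<epsilon>" "\<epsilon> < 1 / 2" for \<epsilon>
  proof -
    have "B \<le> 2 powr log 2 B'" by (simp add: B'_def)
    also have "\<dots> \<le> (1 / \<epsilon>) powr log 2 B'" using \<epsilon> l by (intro powr_mono2) (auto simp: field_simps)
    also have "\<dots> = \<epsilon> powr (- log 2 B')" using \<epsilon> by (simp add: powr_divide powr_minus_divide)
    finally have "B * \<epsilon> powr (- s) \<le> \<epsilon> powr (- log 2 B') * \<epsilon> powr (- s)" by (intro mult_right_mono) auto
    also have "\<dots> = \<epsilon> powr (- log 2 B' - s)" by (simp add: powr_add[symmetric])
    also have "\<dots> \<le> \<epsilon> powr (- \<alpha>)" using \<epsilon> by (intro powr_mono') (auto simp: \<alpha>_def)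
    finally show ?thesis .
  qed
  moreover have "\<alpha> > 0" using l by (simp add: \<alpha>_def)
  ultimately show ?thesis by blast
qed

lemma infsum_le_ennreal:
  fixes f :: "'i \<Rightarrow> ennreal"
  assumes "\<And>F. finite F \<Longrightarrow> F \<subseteq> A \<Longrightarrow> sum f F \<le> b"
  shows "infsum f A \<le> b"
proof -
  have "infsum f A = (SUP F\<in>{F. finite F \<and> F \<subseteq> A}. sum f F)"
    by (rule nonneg_infsum_complete) simp
  also have "\<dots> \<le> b" using assms by (intro SUP_least) auto
  finally show ?thesis .
qed

lemma LLD_bound:
  fixes h :: "'a \<Rightarrow> 'b::real_normed_vector"
  assumes h: "LLD d \<psi> h" and \<psi>: "\<psi> \<ge> 0"
  obtains L where "L \<ge> 0" "Lip_at d h \<psi> = ennreal L" "\<And>x y. norm (h x - h y) \<le> L * max (d x y) \<psi>"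
proof -
  have fin: "Lip_at d h \<psi> < \<infinity>"
    and near: "(SUP (x, y)\<in>{(x, y). d x y \<le> \<psi>}. ennreal (norm (h x - h y))) \<le> Lip_at d h \<psi> * ennreal \<psi>"
    using h by (auto simp: LLD_def)
  define L where "L = enn2real (Lip_at d h \<psi>)"
  have L: "Lip_at d h \<psi> = ennreal L" "L \<ge> 0" using fin by (auto simp: L_def)
  have "norm (h x - h y) \<le> L * max (d x y) \<psi>" for x y
  proof (cases "d x y > \<psi>")
    case True
    then have "ennreal (norm (h x - h y) / d x y) \<le> Lip_at d h \<psi>"
      unfolding Lip_at_def by (intro SUP_upper2[of "(x, y)"]) auto
    then have "norm (h x - h y) / d x y \<le> L" using L by simp
    then show ?thesis using True \<psi> by (simp add: divide_le_eq)
  next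
    case False
    have "ennreal (norm (h x - h y)) \<le> (SUP (x, y)\<in>{(x, y). d x y \<le> \<psi>}. ennreal (norm (h x - h y)))"
      using False by (intro SUP_upper2[of "(x, y)"]) auto
    also note near
    also have "Lip_at d h \<psi> * ennreal \<psi> = ennreal (L * \<psi>)" using L \<psi> by (simp add: ennreal_mult)
    finally have "norm (h x - h y) \<le> L * \<psi>" using L \<psi> by simp
    then show ?thesis using False by simp
  qed
  then show thesis using that[of L] L by blast
qed

lemma cd_UC_ball_le:
  assumes T: "\<And>x y. T (mul x y) = T x + T y" and c: "c \<ge> 0" "\<rho> > 0"
    and b: "\<And>x. d z x \<le> \<rho> \<Longrightarrow> norm (h x - T x - v) \<le> c * \<rho>"
  shows "cd_UC_ball d mul h z \<rho> \<le> ennreal c"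
proof -
  have "(INF (T, v)\<in>{T. \<forall>x y. T (mul x y) = T x + T y} \<times> UNIV. SUP x\<in>dball d z \<rho>. ennreal (norm (h x - T x - v)))
      \<le> (SUP x\<in>dball d z \<rho>. ennreal (norm (h x - T x - v)))"
    using T by (intro INF_lower2[of "(T, v)"]) auto
  also have "\<dots> \<le> ennreal (c * \<rho>)"
    by (intro SUP_least ennreal_leI b) (simp add: dball_def)
  also have "\<dots> = ennreal \<rho> * ennreal c" using c by (simp add: ennreal_mult mult.commute)
  finally show ?thesis
    unfolding cd_UC_ball_def using c by (intro divide_le_posI_ennreal) auto
qed

context carnot_group
begin

text \<open>If one cube contained another one of the same generation, a cube of the next generation inside the
  smaller one, which exists because the smaller cube has positive measure, would have two ancestors.\<close>

lemma cubes_of_one_generation_disjoint: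
  assumes cubes: "christ_cubes d I Q z a0 a1 \<tau>" and \<omega>: "\<omega> \<in> I k" "\<omega>' \<in> I k" "\<omega> \<noteq> \<omega>'"
  shows "Q k \<omega> \<inter> Q k \<omega>' = {}"
proof (rule ccontr)
  interpret C: christ_cubes d I Q z a0 a1 \<tau> by (rule cubes)
  have no_sub: False if sub: "Q k \<alpha> \<subseteq> Q k \<beta>" and \<alpha>: "\<alpha> \<in> I k" and \<beta>: "\<beta> \<in> I k" "\<alpha> \<noteq> \<beta>" for \<alpha> \<beta>
  proof -
    let ?B = "dball d (z k \<alpha>) (a0 * \<tau> powi k)"
    have pos: "emeasure lebesgue ?B > 0"
      using dball_measure_pos[of "a0 * \<tau> powi k" "z k \<alpha>"] C.constants open_dball
      by simp
    have "\<not> ?B \<subseteq> UNIV - (\<Union>\<omega>\<in>I (k + 1). Q (k + 1) \<omega>)"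
    proof
      assume "?B \<subseteq> UNIV - (\<Union>\<omega>\<in>I (k + 1). Q (k + 1) \<omega>)"
      then have "emeasure lebesgue ?B \<le> emeasure lebesgue (UNIV - (\<Union>\<omega>\<in>I (k + 1). Q (k + 1) \<omega>))"
        using C.covering[of "k + 1"] by (intro emeasure_mono) (auto simp: null_sets_def)
      then show False using pos C.covering[of "k + 1"] by (simp add: null_sets_def)
    qed
    then obtain x \<gamma> where x: "x \<in> ?B" "\<gamma> \<in> I (k + 1)" "x \<in> Q (k + 1) \<gamma>" by blast
    then have "Q (k + 1) \<gamma> \<inter> Q k \<alpha> \<noteq> {}" using C.inner_ball[OF \<alpha>] by blast
    then have "Q (k + 1) \<gamma> \<subseteq> Q k \<alpha>" using C.nested[of k "k + 1" \<gamma> \<alpha>] x(2) \<alpha> by auto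
    moreover from this sub have "Q (k + 1) \<gamma> \<subseteq> Q k \<beta>" by (rule subset_trans)
    moreover have "\<exists>!\<omega>. \<omega> \<in> I k \<and> Q (k + 1) \<gamma> \<subseteq> Q k \<omega>" using x(2) by (intro C.ancestor) auto
    ultimately show False using \<alpha> \<beta> by metis
  qed
  assume "Q k \<omega> \<inter> Q k \<omega>' \<noteq> {}"
  then have "Q k \<omega> \<subseteq> Q k \<omega>'" using C.nested[of k k \<omega> \<omega>'] \<omega> by auto
  then show False using no_sub \<omega> by blast
qed

text \<open>Each bad cube contains a ball on which a line bends at one of about \<open>log (1 / \<epsilon>)\<close> dyadic
  scales below its size, and this ball occupies a part of the cube that is polynomial in \<open>\<epsilon>\<close>. Cubes of one
  generation are disjoint, and boundedly many generations share a dyadic scale, so the total measure is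
  controlled by that of the bent points at all scales.\<close>

theorem coarse_differentiation:
  fixes I :: "int \<Rightarrow> 'i set" and Q :: "int \<Rightarrow> 'i \<Rightarrow> 'a set" and z :: "int \<Rightarrow> 'i \<Rightarrow> 'a"
    and a0 a1 \<tau> p K :: real
  assumes cubes: "christ_cubes d I Q z a0 a1 \<tau>" and p: "p \<ge> 2" and K: "K \<ge> 1"
    and convexity: "\<And>x y z :: 'b::real_normed_vector.
          (norm (x - y) powr p + norm (y - z) powr p) / 2
            \<ge> norm ((1 / 2) *\<^sub>R (x - z)) powr p + norm ((1 / (2 * K)) *\<^sub>R (x + z - 2 *\<^sub>R y)) powr p"
  shows "\<exists>\<alpha>>0. \<exists>\<zeta>>0. \<exists>lam>0. \<forall>\<epsilon> (m::nat) \<psi> (h :: 'a \<Rightarrow> 'b) j \<sigma>.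
           0 < \<epsilon> \<and> \<epsilon> < 1 / 2 \<and> \<psi> \<ge> 0 \<and> LLD d \<psi> h \<and> \<sigma> \<in> I j \<and>
           \<tau> powi j \<ge> lam * \<epsilon> powr (- ((real r + 1) * (3 * p + 1))) * \<tau> powi (- int m) * \<psi> \<longrightarrow>
           (\<Sum>k = 0..m.
              \<Sum>\<^sub>\<infinity>\<omega>\<in>{\<omega> \<in> subcubes I Q j \<sigma> k.
                     cd_UC d mul z a0 \<tau> h (j + int k) \<omega> (\<zeta> * \<epsilon> ^ r) > ennreal \<epsilon> * Lip_at d h \<psi>}.
                emeasure lebesgue (Q (j + int k) \<omega>))
           \<le> ennreal (\<epsilon> powr (- \<alpha>)) * emeasure lebesgue (Q j \<sigma>)"
proof -
  interpret C: christ_cubes d I Q z a0 a1 \<tau> by (rule cubes)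
  note a0 = C.constants(1) and a1 = C.constants(2) and \<tau>0 = C.constants(3) and \<tau>1 = C.constants(4)
  obtain M0 C3 where C3: "C3 > 0" and fact0: "\<And>x \<rho>. 0 < \<rho> \<Longrightarrow> d 0 x \<le> \<rho> \<Longrightarrow>
       \<exists>ps. x = hprod ps \<and> length ps \<le> M0 \<and> set ps \<subseteq> {-(C3 * \<rho>)..C3 * \<rho>} \<times> E"
    using horizontal_factorization by blast
  define M where "M = max M0 1"
  have M: "M \<ge> 1" by (simp add: M_def)
  have fact: "\<exists>ps. x = hprod ps \<and> length ps \<le> M \<and> set ps \<subseteq> {-(C3 * \<rho>)..C3 * \<rho>} \<times> E"
    if "0 < \<rho>" "d 0 x \<le> \<rho>" for x \<rho>
  proof -
    obtain ps where "x = hprod ps" "length ps \<le> M0" "set ps \<subseteq> {-(C3 * \<rho>)..C3 * \<rho>} \<times> E"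
      using fact0[of \<rho> x] \<open>0 < \<rho>\<close> \<open>d 0 x \<le> \<rho>\<close> by blast
    then show ?thesis by (intro exI[of _ ps]) (simp add: M_def max.coboundedI1)
  qed
  obtain C4 where C4: "C4 \<ge> 1" and rt: "\<And>e R \<eta> x y. e \<in> E \<Longrightarrow> 0 < R \<Longrightarrow> 0 < \<eta> \<Longrightarrow> \<eta> \<le> 1 \<Longrightarrow> d x y \<le> \<eta> * R \<Longrightarrow>
       d (mul x (R *\<^sub>R e)) (mul y (R *\<^sub>R e)) \<le> C4 * \<eta> powr (1 / real r) * R"
    using d_right_translation by blast
  obtain Cv Nv where Cv: "Cv > 0" and vol: "\<And>\<rho> R y z. 0 < \<rho> \<Longrightarrow> \<rho> \<le> R \<Longrightarrow>
     emeasure lborel (dball d z R) \<le> ennreal (Cv * (R / \<rho>) ^ Nv) * emeasure lborel (dball d y \<rho>)"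
    using dball_measure_le by blast
  \<comment> \<open>At most \<open>q\<close> generations share a dyadic scale.\<close>
  obtain q where q: "\<tau> ^ q < 1 / 2" using real_arch_pow_inv[of "1 / 2" \<tau>] \<tau>1 by auto
  define A where "A = real M * C3"
  have A: "A > 0" using M C3 by (simp add: A_def)
  \<comment> \<open>The three bounds give \<open>\<theta> \<le> 1\<close>, make \<open>\<eta> = A \<rho> / R\<close> at most 1, and make
    \<open>C4\<close> times the root of order \<open>r\<close> of \<open>\<eta>\<close> at most \<open>\<epsilon> / (8 A)\<close>.\<close>
  define \<zeta> where "\<zeta> = min (min 1 (1 / (8 * A))) ((1 / (8 * A * C4)) ^ r / (8 * A))"
  have \<zeta>: "\<zeta> > 0" "\<zeta> \<le> 1" using A C4 by (auto simp: \<zeta>_def)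
  have \<zeta>3: "8 * A * \<zeta> \<le> 1"
  proof -
    have "\<zeta> \<le> 1 / (8 * A)" by (simp add: \<zeta>_def)
    then show ?thesis using A by (simp add: field_simps)
  qed
  have \<zeta>4: "8 * A * \<zeta> \<le> (1 / (8 * A * C4)) ^ r"
  proof -
    have "\<zeta> \<le> (1 / (8 * A * C4)) ^ r / (8 * A)" by (simp add: \<zeta>_def)
    then have "8 * A * \<zeta> \<le> 8 * A * ((1 / (8 * A * C4)) ^ r / (8 * A))" using A by (intro mult_left_mono) auto
    then show ?thesis using A by simp
  qed
  define b0 where "b0 = 2 * \<zeta> / (3 * real M)"
  have b0: "b0 > 0" "b0 \<le> 1" using \<zeta> M by (auto simp: b0_def field_simps)
  \<comment> \<open>With this constant the size condition implies \<open>\<psi> \<le> \<theta>\<^sup>2 B m / 128\<close>, where \<open>B m\<close> is the radius of the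
    inner balls of the smallest cubes.\<close>
  define lam where "lam = 128 / (a0 * b0\<^sup>2)"
  have lam: "lam > 0" using a0 b0 by (simp add: lam_def)
  define D where "D = (a1 + a0) / a0"
  have D: "D > 0" using a0 a1 by (simp add: D_def)
  define CS where "CS = Cv * D ^ Nv"
  define W0 where "W0 = 32 * D * (8 * C4) ^ r"
  define s where "s = real ((r + 1) * Nv + 1) + p"
  define B0 where "B0 = Cv * W0 ^ Nv * (real (card E) * (2 * (real q * ((2 * K) powr p * CS))))"
  have CS: "CS > 0" and W0: "W0 > 0" using Cv D C4 by (auto simp: CS_def W0_def)
  obtain \<alpha> where \<alpha>: "\<alpha> > 0" "\<And>\<epsilon>. 0 < \<epsilon> \<Longrightarrow> \<epsilon> < 1 / 2 \<Longrightarrow>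
      (B0 * b0 powr (- s)) * \<epsilon> powr (- (real (r + 1) * s)) \<le> \<epsilon> powr (- \<alpha>)"
    using constant_absorbed_in_power by blast
  have main: "(\<Sum>k = 0..m.
              \<Sum>\<^sub>\<infinity>\<omega>\<in>{\<omega> \<in> subcubes I Q j \<sigma> k.
                     cd_UC d mul z a0 \<tau> h (j + int k) \<omega> (\<zeta> * \<epsilon> ^ r) > ennreal \<epsilon> * Lip_at d h \<psi>}.
                emeasure lebesgue (Q (j + int k) \<omega>))
           \<le> ennreal (\<epsilon> powr (- \<alpha>)) * emeasure lebesgue (Q j \<sigma>)"
    if \<epsilon>: "0 < \<epsilon>" "\<epsilon> < 1 / 2" and \<psi>0: "\<psi> \<ge> 0" and h: "LLD d \<psi> h" and \<sigma>: "\<sigma> \<in> I j"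
      and size: "\<tau> powi j \<ge> lam * \<epsilon> powr (- ((real r + 1) * (3 * p + 1))) * \<tau> powi (- int m) * \<psi>"
    for \<epsilon> :: real and m :: nat and \<psi> and h :: "'a \<Rightarrow> 'b" and j \<sigma>
  proof -
    obtain L where L: "L \<ge> 0" "Lip_at d h \<psi> = ennreal L" and hL: "\<And>x y. norm (h x - h y) \<le> L * max (d x y) \<psi>"
      by (rule LLD_bound[OF h \<psi>0]) blast
    define \<theta> where "\<theta> = b0 * \<epsilon> ^ (r + 1)"
    have \<epsilon>r: "\<epsilon> ^ (r + 1) \<le> 1" "0 < \<epsilon> ^ (r + 1)" using \<epsilon> by (auto intro: power_le_one simp del: power_Suc)
    have \<theta>: "0 < \<theta>" "\<theta> \<le> 1"
      unfolding \<theta>_def using \<epsilon>r b0 by (auto intro: mult_le_one simp del: power_Suc)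
    define n where "n = dyadic_level \<theta>"
    have n: "1 / 2 ^ n \<le> \<theta>" "\<theta> < 2 / 2 ^ n" using dyadic_level[OF \<theta>] by (simp_all add: n_def)
    define \<kappa> where "\<kappa> = (\<theta> / (8 * C4)) ^ r / 2"
    have qq: "0 < \<theta> / (8 * C4)" "\<theta> / (8 * C4) \<le> 1" using \<theta> C4 by auto
    have \<kappa>: "0 < \<kappa>" "\<kappa> \<le> 1 / 2"
      unfolding \<kappa>_def using zero_less_power[OF qq(1), of r] power_le_one[of "\<theta> / (8 * C4)" r] qq by auto
    define lev where "lev k = dyadic_level (\<tau> ^ k)" for k
    have \<tau>k: "0 < \<tau> ^ k" "\<tau> ^ k \<le> 1" for k using \<tau>0 \<tau>1 by (auto intro: power_le_one)
    have lev: "1 / 2 ^ lev k \<le> \<tau> ^ k" "\<tau> ^ k < 2 / 2 ^ lev k" for k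
      using dyadic_level[OF \<tau>k] by (simp_all add: lev_def)
    have lev_mono: "lev k \<le> lev k'" if "k \<le> k'" for k k'
      unfolding lev_def using that \<tau>0 \<tau>1 \<tau>k by (intro dyadic_level_antimono power_decreasing) auto
    have lev_q: "lev k < lev (k + q)" for k
    proof -
      have "\<tau> ^ (k + q) \<le> \<tau> ^ k / 2"
        using mult_left_mono[of "\<tau> ^ q" "1 / 2" "\<tau> ^ k"] q \<tau>k[of k] by (simp add: power_add)
      then show ?thesis unfolding lev_def using \<tau>k by (intro dyadic_level_half)
    qed
    \<comment> \<open>The longest segments for generation \<open>j + k\<close> have length \<open>w (lev k)\<close>, between 1/8 and 1/4 of the
      radius \<open>B k\<close> of the inner balls, so that segments starting near the centre stay well inside.\<close>
    define u where "u = a0 * \<tau> powi j / 4"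
    have \<tau>j: "\<tau> powi j > 0" for j using \<tau>0 by simp
    have u: "u > 0" using a0 \<tau>j by (simp add: u_def)
    define w where "w i = u / 2 ^ i" for i :: nat
    have w: "w i > 0" for i using u by (simp add: w_def)
    have w_antimono: "w i' \<le> w i" if "i \<le> i'" for i i'
      unfolding w_def using u that by (intro divide_left_mono power_increasing) auto
    define B where "B k = a0 * \<tau> powi (j + int k)" for k
    have \<tau>jk: "\<tau> powi (j + int k) = \<tau> powi j * \<tau> ^ k" for k
      using \<tau>0 by (simp add: power_int_add)
    have B: "B k > 0" for k using a0 \<tau>j by (simp add: B_def)
    have Bu: "B k = 4 * u * \<tau> ^ k" for k by (simp add: B_def u_def \<tau>jk)
    have wB: "w (lev k) \<le> B k / 4" "B k / 8 \<le> w (lev k)" for k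
    proof -
      have "u * (1 / 2 ^ lev k) \<le> u * \<tau> ^ k" using lev(1)[of k] u by (intro mult_left_mono) auto
      then show "w (lev k) \<le> B k / 4" by (simp add: w_def Bu)
      have "u * \<tau> ^ k \<le> u * (2 / 2 ^ lev k)" using lev(2)[of k] u by (intro mult_left_mono) auto
      then show "B k / 8 \<le> w (lev k)" by (simp add: w_def Bu)
    qed
    have w_split: "w (lev k) / 2 ^ i = w (lev k + i)" for k i by (simp add: w_def power_add)
    have w_low: "\<theta> * B k / 16 \<le> w (lev k + i)" if "i \<le> n" for k i
    proof -
      have "\<theta> * B k / 16 = (B k / 8) * (\<theta> / 2)" by simp
      also have "\<dots> \<le> w (lev k) * (1 / 2 ^ n)" using wB(2)[of k] n(2) B[of k] \<theta> w by (intro mult_mono) (auto intro: less_imp_le)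
      also have "\<dots> = w (lev k + n)" by (simp add: w_split)
      also have "\<dots> \<le> w (lev k + i)" using that by (intro w_antimono) simp
      finally show ?thesis .
    qed
    define N where "N = lev m + n"
    have \<psi>B: "\<psi> \<le> \<theta>\<^sup>2 * B m / 128"
    proof -
      have "\<epsilon> powr ((real r + 1) * (3 * p + 1)) \<le> \<epsilon> powr (2 * (real r + 1))"
      proof (rule powr_mono')
        have "(real r + 1) * 2 \<le> (real r + 1) * (3 * p + 1)" using p by (intro mult_left_mono) auto
        then show "2 * (real r + 1) \<le> (real r + 1) * (3 * p + 1)" by simp
      qed (use \<epsilon> in auto)
      also have "2 * (real r + 1) = real (2 * (r + 1))" by simp
      also have "\<epsilon> powr real (2 * (r + 1)) = \<epsilon> ^ (2 * (r + 1))" using \<epsilon> by (intro powr_realpow) auto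
      finally have e2: "\<epsilon> powr ((real r + 1) * (3 * p + 1)) \<le> (\<epsilon> ^ (r + 1))\<^sup>2"
        by (simp only: power_mult[symmetric] mult.commute)
      let ?P = "\<epsilon> powr ((real r + 1) * (3 * p + 1))"
      have P0: "?P > 0" using \<epsilon> by simp
      have "lam * inverse ?P * inverse (\<tau> ^ m) * \<psi> \<le> \<tau> powi j"
        using size \<epsilon> by (simp add: powr_minus power_int_minus)
      then have "lam * \<psi> \<le> \<tau> powi j * \<tau> ^ m * ?P" using P0 \<tau>k[of m] by (simp add: field_simps)
      also have "\<dots> \<le> \<tau> powi j * \<tau> ^ m * (\<epsilon> ^ (r + 1))\<^sup>2"
        using e2 \<tau>j[of j] \<tau>k[of m] by (intro mult_left_mono) auto
      finally have "lam * \<psi> \<le> \<tau> powi (j + int m) * (\<epsilon> ^ (r + 1))\<^sup>2" by (simp only: \<tau>jk)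
      then have "\<psi> \<le> \<tau> powi (j + int m) * (\<epsilon> ^ (r + 1))\<^sup>2 / lam" using lam by (simp add: field_simps)
      also have "\<dots> = \<theta>\<^sup>2 * B m / 128"
        by (simp add: lam_def \<theta>_def B_def power_mult_distrib mult_ac del: power_Suc)
      finally show ?thesis .
    qed
    have \<psi>w: "\<psi> \<le> \<theta> * w i / 8" if "i \<le> N" for i
    proof -
      have "\<theta> * B m / 16 \<le> w i" using w_low[of n m] w_antimono[OF that] by (simp add: N_def)
      then have "\<theta> * (\<theta> * B m / 16) / 8 \<le> \<theta> * w i / 8" using \<theta> by (intro divide_right_mono mult_left_mono) auto
      then show ?thesis using \<psi>B by (simp add: power2_eq_square)
    qed
    have \<psi>w1: "\<psi> \<le> w i" if "i \<le> N" for i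
    proof -
      have "\<theta> * w i / 8 \<le> w i" using \<theta> w[of i] by (simp add: mult_le_cancel_right1)
      then show ?thesis using \<psi>w[OF that] by simp
    qed
    \<comment> \<open>Balls around starting points of bent segments, on which half of the bend persists. They lie in
      the cube \<open>Q j \<sigma>\<close>, so that the lines through them can be traced back into the ball \<open>S'\<close>,
      whose measure is comparable.\<close>
    define U where "U e i = (\<Union>y\<in>{y. dball d y (\<kappa> * w i) \<subseteq> Q j \<sigma> \<and> \<theta> * L * w i < line_defect h e (w i) y}. dball d y (\<kappa> * w i))" for e i
    have Uopen: "open (U e i)" for e i unfolding U_def by (intro open_UN ballI open_dball)
    have Um: "U e i \<in> sets borel" for e i using Uopen by simp
    have US: "U e i \<subseteq> Q j \<sigma>" for e i by (auto simp: U_def)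
    have Udev: "\<theta> / 2 * L * w i \<le> line_defect h e (w i) y" if e: "e \<in> E" and i: "i < N" and y: "y \<in> U e i" for e i y
    proof -
      obtain x where x: "\<theta> * L * w i < line_defect h e (w i) x" "d x y < \<kappa> * w i"
        using y by (auto simp: U_def dball_def)
      have "line_defect h e (w i) x - \<theta> / 2 * L * w i \<le> line_defect h e (w i) y"
        using i x by (intro line_defect_stable[OF rt hL C4 L(1) w \<theta> e \<psi>w \<kappa>_def]) auto
      then show ?thesis using x(1) by simp
    qed
    define S' where "S' = dball d (z j \<sigma>) ((a1 + a0) * \<tau> powi j)"
    have zQ: "z k \<omega> \<in> Q k \<omega>" if "\<omega> \<in> I k" for k \<omega>
      using C.inner_ball[OF that] a0 \<tau>j[of k] by (auto simp: dball_def)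
    have S'_bound: "emeasure lborel S' \<le> ennreal CS * emeasure lebesgue (Q j \<sigma>)"
    proof -
      have "emeasure lborel S' \<le> ennreal (Cv * (((a1 + a0) * \<tau> powi j) / (a0 * \<tau> powi j)) ^ Nv)
          * emeasure lborel (dball d (z j \<sigma>) (a0 * \<tau> powi j))"
        unfolding S'_def using a0 a1 \<tau>j[of j] by (intro vol) auto
      also have "((a1 + a0) * \<tau> powi j) / (a0 * \<tau> powi j) = D" using \<tau>0 by (simp add: D_def)
      also have "emeasure lborel (dball d (z j \<sigma>) (a0 * \<tau> powi j)) = emeasure lebesgue (dball d (z j \<sigma>) (a0 * \<tau> powi j))"
        using open_dball by simp
      also have "ennreal (Cv * D ^ Nv) * \<dots> \<le> ennreal (Cv * D ^ Nv) * emeasure lebesgue (Q j \<sigma>)"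
        using C.inner_ball[OF \<sigma>] C.measurable_cube[OF \<sigma>] by (intro mult_left_mono emeasure_mono) auto
      finally show ?thesis by (simp add: CS_def)
    qed
    have Usum: "(\<Sum>i<N. emeasure lborel (U e i)) \<le> ennreal ((K / (\<theta> / 2)) powr p) * emeasure lborel S'" if e: "e \<in> E" for e
    proof (cases "L > 0")
      case True
      show ?thesis
      proof (rule measure_of_bent_points[OF convexity _ u True _ _ e hL])
        show "\<psi> \<le> u / 2 ^ N" using \<psi>w1[of N] by (simp add: w_def)
        show "S' \<in> sets borel" unfolding S'_def using open_dball by simp
        show "\<theta> / 2 * L * (u / 2 ^ i) \<le> line_defect h e (u / 2 ^ i) y" if "i < N" "y \<in> U e i" for i y
          using Udev[OF e that] by (simp add: w_def)
        show "mul y ((- t) *\<^sub>R e) \<in> S'" if "i < N" "y \<in> U e i" "0 \<le> t" "t \<le> u" for i y t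
        proof -
          have "d (z j \<sigma>) y \<le> a1 * \<tau> powi j" using C.diam[OF \<sigma> zQ[OF \<sigma>]] US that by blast
          moreover have "d y (mul y ((- t) *\<^sub>R e)) \<le> t" using d_line[OF e, of y "- t"] that by simp
          moreover have "u < a0 * \<tau> powi j" using u by (simp add: u_def)
          ultimately have "d (z j \<sigma>) (mul y ((- t) *\<^sub>R e)) < a1 * \<tau> powi j + a0 * \<tau> powi j"
            using d_triangle[of "z j \<sigma>" "mul y ((- t) *\<^sub>R e)" y] that by linarith
          then show ?thesis by (simp add: S'_def dball_def distrib_right)
        qed
      qed (use K \<theta> p Um in auto)
    next
      case False
      then have "L = 0" using L by simp
      then have "h x = h y" for x y using hL[of x y] by simp
      then have "line_defect h e (w i) y = 0" for i y unfolding line_defect_def by (metis diff_self norm_zero scaleR_2)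
      then have "U e i = {}" for i using \<open>L = 0\<close> by (simp add: U_def)
      then show ?thesis by simp
    qed
    define W where "W = W0 / \<theta> ^ (r + 1)"
    have W: "W > 0" using W0 \<theta> by (simp add: W_def)
    define bad where "bad k = {\<omega> \<in> subcubes I Q j \<sigma> k.
        cd_UC d mul z a0 \<tau> h (j + int k) \<omega> (\<zeta> * \<epsilon> ^ r) > ennreal \<epsilon> * Lip_at d h \<psi>}" for k
    have bad_cube: "\<exists>e\<in>E. \<exists>i<n. emeasure lebesgue (Q (j + int k) \<omega>)
        \<le> ennreal (Cv * W ^ Nv) * emeasure lebesgue (Q (j + int k) \<omega> \<inter> U e (lev k + i))"
      if k: "k \<le> m" and bad: "\<omega> \<in> bad k" for k \<omega>
    proof -
      let ?k = "j + int k" and ?Q = "Q (j + int k) \<omega>" and ?z = "z (j + int k) \<omega>"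
      have \<omega>: "\<omega> \<in> I ?k" and QS: "?Q \<subseteq> Q j \<sigma>" using bad by (auto simp: bad_def subcubes_def)
      have ball_Q: "dball d ?z (B k) \<subseteq> ?Q" unfolding B_def by (rule C.inner_ball[OF \<omega>])
      \<comment> \<open>Without a bent segment near its centre, the cube would not be bad.\<close>
      have "\<exists>e\<in>E. \<exists>i<n. \<exists>y. dball d y (\<kappa> * (w (lev k) / 2 ^ i)) \<subseteq> dball d ?z (B k) \<and>
          \<theta> * L * (w (lev k) / 2 ^ i) < line_defect h e (w (lev k) / 2 ^ i) y"
      proof (rule ccontr)
        assume neg: "\<not> ?thesis"
        have "\<epsilon> < 1" using \<epsilon> by simp
        have \<kappa>': "0 \<le> \<kappa>" using \<kappa> by simp
        have \<theta>eq: "\<theta> = 2 * \<zeta> / (3 * real M) * \<epsilon> ^ (r + 1)" by (simp only: \<theta>_def b0_def)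
        have "lev k \<le> lev m" using k by (rule lev_mono)
        then have \<psi>': "\<psi> \<le> w (lev k) / 2 ^ n" unfolding w_split by (intro \<psi>w1) (simp add: N_def)
        have straight: "line_defect h e (w (lev k) / 2 ^ i) y \<le> \<theta> * L * (w (lev k) / 2 ^ i)"
          if "e \<in> E" "i < n" "dball d y (\<kappa> * (w (lev k) / 2 ^ i)) \<subseteq> dball d ?z (B k)" for e i y
          using neg that not_less by blast
        obtain T v where T: "\<forall>x y. T (mul x y) = T x + T y"
          and Tv: "\<forall>x. d ?z x \<le> \<zeta> * \<epsilon> ^ r * B k \<longrightarrow> norm (h x - T x - v) \<le> \<epsilon> * L * (\<zeta> * \<epsilon> ^ r * B k)"
          using near_homomorphism_if_lines_straight[OF fact rt hL C3 C4 L(1) M \<psi>0 \<epsilon>(1) \<open>\<epsilon> < 1\<close> B \<kappa>' \<kappa>(2) A_def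
              \<zeta> \<zeta>3 \<zeta>4 wB(2) wB(1) refl \<theta>eq n(1) \<psi>' straight] by blast
        have "\<zeta> * \<epsilon> ^ r * B k > 0" using \<zeta> \<epsilon> B by simp
        then have "cd_UC_ball d mul h ?z (\<zeta> * \<epsilon> ^ r * B k) \<le> ennreal (\<epsilon> * L)"
          using T Tv \<epsilon> L by (intro cd_UC_ball_le[of T]) auto
        then have "cd_UC d mul z a0 \<tau> h ?k \<omega> (\<zeta> * \<epsilon> ^ r) \<le> ennreal \<epsilon> * Lip_at d h \<psi>"
          using \<epsilon> L by (simp add: cd_UC_def B_def mult.assoc ennreal_mult)
        moreover have "ennreal \<epsilon> * Lip_at d h \<psi> < cd_UC d mul z a0 \<tau> h ?k \<omega> (\<zeta> * \<epsilon> ^ r)"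
          using bad unfolding bad_def by blast
        ultimately show False using leD by blast
      qed
      then obtain e i y where e: "e \<in> E" "i < n" and ball: "dball d y (\<kappa> * w (lev k + i)) \<subseteq> dball d ?z (B k)"
        and dev: "\<theta> * L * w (lev k + i) < line_defect h e (w (lev k + i)) y" unfolding w_split by blast
      let ?r = "\<kappa> * w (lev k + i)"
      have "dball d y ?r \<subseteq> ?Q \<inter> U e (lev k + i)"
        using ball ball_Q QS dev unfolding U_def by blast
      then have le: "emeasure lebesgue (dball d y ?r) \<le> emeasure lebesgue (?Q \<inter> U e (lev k + i))"
        using C.measurable_cube[OF \<omega>] Um by (intro emeasure_mono) auto
      have r0: "?r > 0" using \<kappa> w by simp
      let ?R = "(a1 + a0) * \<tau> powi ?k"
      have RB: "?R = D * B k" using a0 by (simp add: D_def B_def)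
      have "?r \<le> 1 / 2 * (B k / 4)"
        using \<kappa> w[of "lev k + i"] wB(1)[of k] w_antimono[of "lev k" "lev k + i"] by (intro mult_mono) auto
      also have "\<dots> \<le> B k" using B[of k] by simp
      also have "B k \<le> ?R" using a1 \<tau>j[of ?k] by (simp add: B_def)
      finally have rR: "?r \<le> ?R" .
      have "?Q \<subseteq> dball d ?z ?R"
      proof
        fix x assume "x \<in> ?Q"
        then have "d ?z x \<le> a1 * \<tau> powi ?k" using C.diam[OF \<omega> zQ[OF \<omega>]] by blast
        moreover have "0 < a0 * \<tau> powi ?k" using a0 \<tau>j by simp
        ultimately have "d ?z x < ?R" unfolding distrib_right by linarith
        then show "x \<in> dball d ?z ?R" by (simp add: dball_def)
      qed
      then have "emeasure lebesgue ?Q \<le> emeasure lebesgue (dball d ?z ?R)"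
        using open_dball by (intro emeasure_mono) auto
      also have "\<dots> = emeasure lborel (dball d ?z ?R)" using open_dball by simp
      also have "\<dots> \<le> ennreal (Cv * (?R / ?r) ^ Nv) * emeasure lborel (dball d y ?r)" by (rule vol[OF r0 rR])
      also have "\<dots> \<le> ennreal (Cv * W ^ Nv) * emeasure lborel (dball d y ?r)"
      proof (intro mult_right_mono ennreal_leI mult_left_mono power_mono)
        have "\<kappa> * (\<theta> * B k / 16) \<le> ?r" using w_low[of i k] e(2) \<kappa> by (intro mult_left_mono) auto
        then have "?R / ?r \<le> ?R / (\<kappa> * (\<theta> * B k / 16))"
          using \<kappa> \<theta> B[of k] D w[of "lev k + i"] unfolding RB by (intro divide_left_mono mult_pos_pos) auto
        also have "\<dots> = W"
          unfolding RB W_def W0_def \<kappa>_def using B[of k] \<theta> C4 by (simp add: power_divide field_simps)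
        finally show "?R / ?r \<le> W" .
        show "0 \<le> ?R / ?r" using r0 a0 a1 \<tau>j[of ?k] by (intro divide_nonneg_pos) auto
      qed (use Cv in auto)
      also have "emeasure lborel (dball d y ?r) = emeasure lebesgue (dball d y ?r)"
        using open_dball by simp
      also have "ennreal (Cv * W ^ Nv) * emeasure lebesgue (dball d y ?r)
          \<le> ennreal (Cv * W ^ Nv) * emeasure lebesgue (?Q \<inter> U e (lev k + i))"
        by (intro mult_left_mono le) auto
      finally show ?thesis using e by blast
    qed
    define G where "G k = (\<Sum>e\<in>E. \<Sum>i<n. emeasure lborel (U e (lev k + i)))" for k
    have gen: "(\<Sum>\<^sub>\<infinity>\<omega>\<in>bad k. emeasure lebesgue (Q (j + int k) \<omega>)) \<le> ennreal (Cv * W ^ Nv) * G k" if k: "k \<le> m" for k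
    proof (rule infsum_le_ennreal)
      fix F assume F: "finite F" "F \<subseteq> bad k"
      let ?Q = "Q (j + int k)"
      have FI: "F \<subseteq> I (j + int k)" using F(2) by (auto simp: bad_def subcubes_def)
      \<comment> \<open>The pair \<open>(e, i)\<close> depends on the cube; summing over all pairs removes the choice.\<close>
      have 1: "emeasure lebesgue (?Q \<omega>) \<le> ennreal (Cv * W ^ Nv) * (\<Sum>e\<in>E. \<Sum>i<n. emeasure lebesgue (?Q \<omega> \<inter> U e (lev k + i)))"
        if \<omega>: "\<omega> \<in> F" for \<omega>
      proof -
        obtain e i where ei: "e \<in> E" "i < n"
          "emeasure lebesgue (?Q \<omega>) \<le> ennreal (Cv * W ^ Nv) * emeasure lebesgue (?Q \<omega> \<inter> U e (lev k + i))"
          using bad_cube[OF k] F(2) \<omega> by blast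
        have "emeasure lebesgue (?Q \<omega> \<inter> U e (lev k + i)) \<le> (\<Sum>i<n. emeasure lebesgue (?Q \<omega> \<inter> U e (lev k + i)))"
          using ei(2) by (intro member_le_sum) auto
        also have "\<dots> \<le> (\<Sum>e\<in>E. \<Sum>i<n. emeasure lebesgue (?Q \<omega> \<inter> U e (lev k + i)))"
          using ei(1) finite_E by (intro member_le_sum[where f = "\<lambda>e. \<Sum>i<n. emeasure lebesgue (?Q \<omega> \<inter> U e (lev k + i))"]) auto
        finally show ?thesis using ei(3) by (meson mult_left_mono order_trans zero_le)
      qed
      have 2: "(\<Sum>\<omega>\<in>F. emeasure lebesgue (?Q \<omega> \<inter> U e (lev k + i))) \<le> emeasure lborel (U e (lev k + i))" for e i
      proof -
        have "disjoint_family_on (\<lambda>\<omega>. ?Q \<omega> \<inter> U e (lev k + i)) F"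
          unfolding disjoint_family_on_def
          using cubes_of_one_generation_disjoint[OF cubes] FI by blast
        then have "(\<Sum>\<omega>\<in>F. emeasure lebesgue (?Q \<omega> \<inter> U e (lev k + i))) = emeasure lebesgue (\<Union>\<omega>\<in>F. ?Q \<omega> \<inter> U e (lev k + i))"
          using F(1) FI C.measurable_cube Um by (intro sum_emeasure) (auto intro!: sets.Int)
        also have "\<dots> \<le> emeasure lebesgue (U e (lev k + i))"
          using Um by (intro emeasure_mono) auto
        also have "\<dots> = emeasure lborel (U e (lev k + i))" using Um by simp
        finally show ?thesis .
      qed
      have "(\<Sum>\<omega>\<in>F. emeasure lebesgue (?Q \<omega>))
          \<le> (\<Sum>\<omega>\<in>F. ennreal (Cv * W ^ Nv) * (\<Sum>e\<in>E. \<Sum>i<n. emeasure lebesgue (?Q \<omega> \<inter> U e (lev k + i))))"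
        by (intro sum_mono 1)
      also have "\<dots> = ennreal (Cv * W ^ Nv) * (\<Sum>e\<in>E. \<Sum>i<n. \<Sum>\<omega>\<in>F. emeasure lebesgue (?Q \<omega> \<inter> U e (lev k + i)))"
        unfolding sum_distrib_left[symmetric] by (subst sum.swap, subst sum.swap[of _ _ F]) (rule refl)
      also have "\<dots> \<le> ennreal (Cv * W ^ Nv) * G k"
        unfolding G_def by (intro mult_left_mono sum_mono 2) auto
      finally show "(\<Sum>\<omega>\<in>F. emeasure lebesgue (?Q \<omega>)) \<le> ennreal (Cv * W ^ Nv) * G k" .
    qed
    have "(\<Sum>k = 0..m. \<Sum>\<^sub>\<infinity>\<omega>\<in>bad k. emeasure lebesgue (Q (j + int k) \<omega>)) \<le> (\<Sum>k = 0..m. ennreal (Cv * W ^ Nv) * G k)"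
      by (intro sum_mono gen) auto
    also have "\<dots> = ennreal (Cv * W ^ Nv) * (\<Sum>k\<le>m. G k)" by (simp add: sum_distrib_left atLeast0AtMost)
    also have "(\<Sum>k\<le>m. G k) = (\<Sum>e\<in>E. \<Sum>i<n. \<Sum>k\<le>m. emeasure lborel (U e (lev k + i)))"
      unfolding G_def by (subst sum.swap, subst sum.swap[of _ _ "{..m}"]) (rule refl)
    also have "ennreal (Cv * W ^ Nv) * \<dots> \<le> ennreal (Cv * W ^ Nv) * (\<Sum>e\<in>E. \<Sum>i<n.
        of_nat q * (ennreal ((K / (\<theta> / 2)) powr p) * (ennreal CS * emeasure lebesgue (Q j \<sigma>))))"
    proof (intro mult_left_mono sum_mono)
      fix e i assume e: "e \<in> E" and i: "i \<in> {..<n}"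
      have "(\<Sum>k\<le>m. emeasure lborel (U e (lev k + i))) \<le> of_nat q * (\<Sum>i<N. emeasure lborel (U e i))"
        using lev_mono lev_q i by (intro sum_bounded_multiplicity) (auto simp: N_def)
      also have "\<dots> \<le> of_nat q * (ennreal ((K / (\<theta> / 2)) powr p) * emeasure lborel S')"
        by (intro mult_left_mono Usum e) auto
      also have "\<dots> \<le> of_nat q * (ennreal ((K / (\<theta> / 2)) powr p) * (ennreal CS * emeasure lebesgue (Q j \<sigma>)))"
        by (intro mult_left_mono S'_bound) auto
      finally show "(\<Sum>k\<le>m. emeasure lborel (U e (lev k + i)))
         \<le> of_nat q * (ennreal ((K / (\<theta> / 2)) powr p) * (ennreal CS * emeasure lebesgue (Q j \<sigma>)))" .
    qed auto
    also have "\<dots> = ennreal (Cv * W ^ Nv * (real (card E) * (real n * (real q * ((K / (\<theta> / 2)) powr p * CS)))))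
        * emeasure lebesgue (Q j \<sigma>)"
      using Cv W CS by (simp add: ennreal_mult ennreal_of_nat_eq_real_of_nat mult.assoc)
    also have "\<dots> \<le> ennreal (\<epsilon> powr (- \<alpha>)) * emeasure lebesgue (Q j \<sigma>)"
    proof (intro mult_right_mono ennreal_leI)
      have n\<theta>: "real n \<le> 2 / \<theta>"
      proof -
        have "real n \<le> 2 ^ n" using less_exp[of n] by (metis less_imp_le of_nat_le_iff of_nat_numeral of_nat_power)
        also have "\<dots> \<le> 2 / \<theta>" using n(2) \<theta> by (simp add: field_simps)
        finally show ?thesis .
      qed
      have K\<theta>: "(K / (\<theta> / 2)) powr p = (2 * K) powr p / \<theta> powr p"
        using K \<theta> by (simp add: powr_divide[symmetric] mult.commute)
      have "Cv * W ^ Nv * (real (card E) * (real n * (real q * ((K / (\<theta> / 2)) powr p * CS))))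
        \<le> Cv * W ^ Nv * (real (card E) * (2 / \<theta> * (real q * ((K / (\<theta> / 2)) powr p * CS))))"
        using n\<theta> Cv W CS by (intro mult_left_mono mult_right_mono) auto
      also have "\<dots> = B0 * (1 / (\<theta> ^ ((r + 1) * Nv) * \<theta> * \<theta> powr p))"
        unfolding B0_def K\<theta> W_def power_divide power_mult by (simp add: field_simps)
      also have "\<theta> ^ ((r + 1) * Nv) * \<theta> * \<theta> powr p = \<theta> powr s"
        using \<theta> unfolding s_def powr_add by (simp only: powr_realpow) simp
      also have "B0 * (1 / \<theta> powr s) = B0 * b0 powr (- s) * \<epsilon> powr (- (real (r + 1) * s))"
      proof -
        have "1 / \<theta> powr s = \<theta> powr (- s)" by (simp add: powr_minus_divide)
        also have "\<dots> = b0 powr (- s) * (\<epsilon> powr real (r + 1)) powr (- s)"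
          unfolding \<theta>_def using b0 \<epsilon> by (simp only: powr_realpow) (simp add: powr_mult)
        also have "(\<epsilon> powr real (r + 1)) powr (- s) = \<epsilon> powr (- (real (r + 1) * s))"
          by (simp only: powr_powr mult_minus_right)
        finally show ?thesis by (simp only: mult.assoc)
      qed
      also have "\<dots> \<le> \<epsilon> powr (- \<alpha>)" by (rule \<alpha>(2)[OF \<epsilon>])
      finally show "Cv * W ^ Nv * (real (card E) * (real n * (real q * ((K / (\<theta> / 2)) powr p * CS)))) \<le> \<epsilon> powr (- \<alpha>)" .
    qed auto
    finally show ?thesis unfolding bad_def .
  qed
  show ?thesis
    using \<alpha>(1) \<zeta>(1) lam main by (intro exI[of _ \<alpha>] exI[of _ \<zeta>] exI[of _ lam]) blast
qed

end

theorem theorem5p1: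
  fixes r :: nat
    and V :: "nat \<Rightarrow> 'a::euclidean_space set"
    and brk mul :: "'a \<Rightarrow> 'a \<Rightarrow> 'a"
    and d :: "'a \<Rightarrow> 'a \<Rightarrow> real"
    and I :: "int \<Rightarrow> 'i set"
    and Q :: "int \<Rightarrow> 'i \<Rightarrow> 'a set"
    and z :: "int \<Rightarrow> 'i \<Rightarrow> 'a"
    and a0 a1 \<tau> p K :: real
  assumes carnot: "carnot_group r V brk mul"
    and d_def: "d = cc_dist (V 1) mul"
    and cubes: "christ_cubes d I Q z a0 a1 \<tau>"
    and "p \<ge> 2" and "K \<ge> 1"
    and convexity: "\<And>x y z :: 'b::banach.
          (norm (x - y) powr p + norm (y - z) powr p) / 2
            \<ge> norm ((1 / 2) *\<^sub>R (x - z)) powr p + norm ((1 / (2 * K)) *\<^sub>R (x + z - 2 *\<^sub>R y)) powr p"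
  shows "\<exists>\<alpha>>0. \<exists>\<zeta>>0. \<exists>lam>0. \<forall>\<epsilon> (m::nat) \<psi> (h :: 'a \<Rightarrow> 'b) j \<sigma>.
           0 < \<epsilon> \<and> \<epsilon> < 1 / 2 \<and> \<psi> \<ge> 0 \<and> LLD d \<psi> h \<and> \<sigma> \<in> I j \<and>
           \<tau> powi j \<ge> lam * \<epsilon> powr (- ((real r + 1) * (3 * p + 1))) * \<tau> powi (- int m) * \<psi> \<longrightarrow>
           (\<Sum>k = 0..m.
              \<Sum>\<^sub>\<infinity>\<omega>\<in>{\<omega> \<in> subcubes I Q j \<sigma> k.
                     cd_UC d mul z a0 \<tau> h (j + int k) \<omega> (\<zeta> * \<epsilon> ^ r) > ennreal \<epsilon> * Lip_at d h \<psi>}.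
                emeasure lebesgue (Q (j + int k) \<omega>))
           \<le> ennreal (\<epsilon> powr (- \<alpha>)) * emeasure lebesgue (Q j \<sigma>)"
proof -
  interpret carnot_group r V brk mul by (rule carnot)
  have d: "carnot_group.d V mul = d" using carnot_group.d_def[OF carnot] assms(2) by (simp only:)
  show ?thesis
    using coarse_differentiation[of I Q z a0 a1 \<tau> p K, unfolded d] cubes \<open>p \<ge> 2\<close> \<open>K \<ge> 1\<close> convexity
    by blast
qed

end
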